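(* Suppose the noise random field $\{\varepsilon_{i_1,i_2,i_3}\}$ is weakly stationary with mean zero and satisfies $$(n_1n_2n_3)^{-1/2}\sum_{i_1=1}^{\lfloor n_1v_1\rfloor}\sum_{i_2=1}^{\lfloor n_2v_2\rfloor}\sum_{i_3=1}^{\lfloor n_3v_3\rfloor}\varepsilon_{i_1,i_2,i_3}\Rightarrow\sigma B(v_1,v_2,v_3)\quad\text{in } D[0,1]^3$$ as $\min_{1\le i\le 3}n_i\to\infty$, for some constant $\sigma^2\in(0,\infty)$, where $B$ is the standard Brownian motion on $[0,1]^3$. Assume that the sampling periods fulfill $n_j\tau_j\to\overline{\tau}_j$, $j=1,2,3$, as $\min_{1\le i\le 3}n_i\to\infty$, and that the reference signal is time-constant, i.e. $f_0(t,r_2,r_3)=f_0(0,r_2,r_3)$ for all $t\in[0,\overline\tau_1]$ and $(r_2,r_3)\in[0,\overline\tau_2]\times[0,\overline\tau_3]$. Define $$\overline{y}_{\cdot,l_2,l_3}:=\frac{1}{\lfloor n_1s_0\rfloor}\sum_{l_1=1}^{\lfloor n_1s_0\rfloor}y_{l_1,l_2,l_3},\qquad (l_2,l_3)\in\{1,\dots,n_2\}\times\{1,\dots,n_3\},$$ $$\mathcal{F}^c_n(s,t,r_2,r_3):=\sqrt{\tau_1\tau_2\tau_3}\sum_{l_1=1}^{\lfloor n_1s\rfloor}\sum_{l_2=1}^{n_2}\sum_{l_3=1}^{n_3}(y_{l_1,l_2,l_3}-\overline{y}_{\cdot,l_2,l_3})\,\varphi(t-l_1\tau_1,r_2-l_2\tau_2,r_3-l_3\tau_3).$$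 Then, under the null hypothesis $H_0$ (that the signal $f$ equals $f_0$), $\mathcal{F}^c_n(s,t,r_2,r_3)\Rightarrow\mathcal{F}^c(s,t,r_2,r_3)$ as $\min_{1\le i\le 3}n_i\to\infty$, as processes indexed by $(s,t,r_2,r_3)\in[s_0,1]\times[0,\overline{\tau}_1]\times[0,\overline{\tau}_2]\times[0,\overline{\tau}_3]$ (weak convergence in the Skorohod space on this box), where $$\mathcal{F}^c(s,t,r_2,r_3):=\sqrt{\overline{\tau}_1\overline{\tau}_2\overline{\tau}_3}\,\sigma\int_0^s\int_0^1\int_0^1\varphi(t-\overline{\tau}_1z_1,r_2-\overline{\tau}_2z_2,r_3-\overline{\tau}_3z_3)\,\mathrm{d}B^c(z_1,z_2,z_3)$$ and $$B^c(z_1,z_2,z_3):=B(z_1,z_2,z_3)-\frac{z_1}{s_0}B(s_0,z_2,z_3),\qquad (z_1,z_2,z_3)\in[0,1]^3.$$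
   Context: Setting. Constants $s_0\in(0,1)$, $\Omega_1,\Omega_2,\Omega_3\in(0,\infty)$ and $\overline\tau_1,\overline\tau_2,\overline\tau_3\in(0,\infty)$ are fixed. For sample sizes $n_1,n_2,n_3\in\mathbb N$ there are sampling periods $\tau_j=\tau_{n_j}>0$, $j=1,2,3$. One observes $y_{i_1,i_2,i_3}=f(i_1\tau_1,i_2\tau_2,i_3\tau_3)+\varepsilon_{i_1,i_2,i_3}$, $1\le i_j\le n_j$, where $f$ is the signal, $f_0$ the (here unknown) reference signal and $\{\varepsilon_{i_1,i_2,i_3}\}$ a zero mean random field. Under $H_0$ one has $f=f_0$, so $y_{i_1,i_2,i_3}=f_0(i_1\tau_1,i_2\tau_2,i_3\tau_3)+\varepsilon_{i_1,i_2,i_3}$ with $f_0$ constant in its first argument at the sampling points. The subscript $n$ stands for dependence on $(n_1,n_2,n_3)$. Kernel. $\varphi(t,r_2,r_3)=\frac{\sin(\Omega_1t)}{\pi t}\frac{\sin(\Omega_2r_2)}{\pi r_2}\frac{\sin(\Omega_3r_3)}{\pi r_3}$, each factor being set equal to $\Omega_j/\pi$ at argument $0$. Notation. For $u\subseteq\{1,\dots,q\}$, $-u$ denotes its complement and $x_u$ the subvector of $x\in\mathbb R^q$ with indices in $u$; for disjoint $u,v$, $x_u:z_v$ is the point with coordinates $x_j$ ($j\in u$) and $z_j$ ($j\in v$). The $q$-fold alternating sum is $[f]_a^b=\sum_{v\subseteq\{1,\dots,q\}}(-1)^{|v|}f(a_v:b_{-v})$. Brownian motion. The standard Brownian motion $B$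 on $[0,1]^q$ is the process with a.s. continuous paths, vanishing when some coordinate is $0$, whose increments $B(W)=[B]_s^t$ over pairwise disjoint blocks $W=\prod_j(s_j,t_j]$ are independent normal with mean zero and variance equal to the Lebesgue measure of $W$. Skorohod space. For a box $I\subset\mathbb R^q$, $D(I)$ (written $D[0,1]^q$ for $I=[0,1]^q$) is the space of functions $f:I\to\mathbb R$ such that at each $t\in I$ the limit of $f$ exists along each of the $2^q$ quadrants $\{s\in I: s_pR_pt_p,\ 1\le p\le q\}$, $R_p\in\{<,\ge\}$, and $f(t)$ equals the limit along the quadrant with all $R_p$ equal to $\ge$. It carries the usual multiparameter Skorohod topology (Straf; Bickel–Wichura): $f_n\to f$ iff there are coordinatewise time changes $\lambda_n$ of $I$ (each coordinate an increasing homeomorphism) with $\sup|\lambda_n-\mathrm{id}|\to0$ and $\sup|f_n-f\circ\lambda_n|\to0$. "$\Rightarrow$" is weak convergence. Stochastic integral. The integral with respect to $B^c$ is a pathwise multivariate Riemann–Stieltjes integral defined through integration by parts. For functions $g,h$ on $[a,b]\subset\mathbb R^q$, $\int_a^b h\,\mathrm dg$ is the limit, as the mesh tends to $0$, of sums over the cells $[y,y^+]$ of product partitions of $h(\tilde y)[g]_{y}^{y^+}$, $\tilde y\in[y,y^+]$. When $h$ is not of bounded variation (here $h=B^c$), one puts $$\int_a^b g\,\mathrm dh:=[hg]_a^b+(-1)^q\int_a^b h\,\mathrm dg+\sum_{v\subseteq\{1,\dots,q\},\,1\le|v|\le q-1}(-1)^{|v|}\int_{a_v}^{b_v}[h\,\mathrm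 dg]_{a_{-v}}^{b_{-v}},$$ where $\int_{a_v}^{b_v}[h\,\mathrm dg]_{a_{-v}}^{b_{-v}}=\sum_{w\subseteq -v}(-1)^{|w|}\int_{a_v}^{b_v}h\,\mathrm dg$ with the variables in $w$ fixed at $a_w$, those in $(-v)\setminus w$ fixed at $b$, and integration over the variables in $v$. The constant $\sigma^2$ is the long-run variance of the noise: $\sigma^2=\lim\mathrm{Var}\big((n_1n_2n_3)^{-1/2}\sum_{i_1\le n_1}\sum_{i_2\le n_2}\sum_{i_3\le n_3}\varepsilon_{i_1,i_2,i_3}\big)=\sum_{k\in\mathbb Z^3}\mathbb E(\varepsilon_{0}\varepsilon_{k})$. *)

theory Defs
  imports "HOL-Probability.Probability"
begin

section \<open>Alternating sums and Riemann--Stieltjes integrals\<close>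

text \<open>The point \<open>a\<^sub>w : b\<^sub>-\<^sub>w\<close>.\<close>

definition glue :: "'q set \<Rightarrow> real^'q \<Rightarrow> real^'q \<Rightarrow> real^'q" where
  "glue w a b = (\<chi> j. if j \<in> w then a$j else b$j)"

text \<open>Alternating sum in the variables from \<open>v\<close> only; the remaining variables are kept at \<open>b\<close>.
  The full alternating sum \<open>[f]\<^sub>a\<^sup>b\<close> is the case \<open>v = UNIV\<close>.\<close>

definition alt_sum :: "'q::finite set \<Rightarrow> (real^'q \<Rightarrow> real) \<Rightarrow> real^'q \<Rightarrow> real^'q \<Rightarrow> real" where
  "alt_sum v f a b = (\<Sum>w\<in>Pow v. (-1) ^ card w * f (glue w a b))"

text \<open>Product partitions of the \<open>v\<close>-face of \<open>[a,b]\<close> through \<open>b\<close>: coordinate \<open>j \<in> v\<close> is subdivided by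
  \<open>p j 0 < \<dots> < p j (m j)\<close>, coordinates outside \<open>v\<close> are frozen at \<open>b\<close>.\<close>

definition product_partition ::
    "'q set \<Rightarrow> real^'q \<Rightarrow> real^'q \<Rightarrow> ('q \<Rightarrow> nat) \<Rightarrow> ('q \<Rightarrow> nat \<Rightarrow> real) \<Rightarrow> bool" where
  "product_partition v a b m p \<longleftrightarrow>
     (\<forall>j\<in>v. p j 0 = a$j \<and> p j (m j) = b$j \<and> (\<forall>i<m j. p j i < p j (Suc i)))"

definition cells :: "'q set \<Rightarrow> ('q \<Rightarrow> nat) \<Rightarrow> ('q \<Rightarrow> nat) set" where
  "cells v m = (\<Pi>\<^sub>E j\<in>v. {..<m j})"

definition cell_lower :: "'q set \<Rightarrow> real^'q \<Rightarrow> ('q \<Rightarrow> nat \<Rightarrow> real) \<Rightarrow> ('q \<Rightarrow> nat) \<Rightarrow> real^'q" where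
  "cell_lower v b p k = (\<chi> j. if j \<in> v then p j (k j) else b$j)"

definition cell_upper :: "'q set \<Rightarrow> real^'q \<Rightarrow> ('q \<Rightarrow> nat \<Rightarrow> real) \<Rightarrow> ('q \<Rightarrow> nat) \<Rightarrow> real^'q" where
  "cell_upper v b p k = (\<chi> j. if j \<in> v then p j (Suc (k j)) else b$j)"

text \<open>The integral of \<open>h\<close> with respect to \<open>g\<close> over the variables in \<open>v\<close>, from \<open>a\<^sub>v\<close> to \<open>b\<^sub>v\<close>, with the
  other variables fixed at \<open>b\<close>.\<close>

definition has_rs_integral ::
    "'q::finite set \<Rightarrow> real^'q \<Rightarrow> real^'q \<Rightarrow> (real^'q \<Rightarrow> real) \<Rightarrow> (real^'q \<Rightarrow> real) \<Rightarrow> real \<Rightarrow> bool" where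
  "has_rs_integral v a b h g I \<longleftrightarrow>
     (\<forall>e>0. \<exists>d>0. \<forall>m p \<xi>.
        product_partition v a b m p \<longrightarrow>
        (\<forall>j\<in>v. \<forall>i<m j. p j (Suc i) - p j i < d) \<longrightarrow>
        (\<forall>k\<in>cells v m. \<xi> k \<in> cbox (cell_lower v b p k) (cell_upper v b p k)) \<longrightarrow>
        \<bar>(\<Sum>k\<in>cells v m. h (\<xi> k) * alt_sum v g (cell_lower v b p k) (cell_upper v b p k)) - I\<bar> < e)"

definition rs_integral ::
    "'q::finite set \<Rightarrow> real^'q \<Rightarrow> real^'q \<Rightarrow> (real^'q \<Rightarrow> real) \<Rightarrow> (real^'q \<Rightarrow> real) \<Rightarrow> real" where
  "rs_integral v a b h g = (THE I. has_rs_integral v a b h g I)"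

text \<open>The integral of \<open>g\<close> with respect to \<open>h\<close>, defined through integration by parts.\<close>

definition ibp_integral ::
    "real^'q::finite \<Rightarrow> real^'q \<Rightarrow> (real^'q \<Rightarrow> real) \<Rightarrow> (real^'q \<Rightarrow> real) \<Rightarrow> real" where
  "ibp_integral a b g h =
     alt_sum UNIV (\<lambda>x. h x * g x) a b
     + (-1) ^ CARD('q) * rs_integral UNIV a b h g
     + (\<Sum>v | 1 \<le> card v \<and> card v \<le> CARD('q) - 1.
          (-1) ^ card v * (\<Sum>w\<in>Pow (-v). (-1) ^ card w * rs_integral v a (glue w a b) h g))"


section \<open>Skorohod space on a box\<close>

definition quadrant :: "real^'q \<Rightarrow> real^'q \<Rightarrow> 'q set \<Rightarrow> real^'q \<Rightarrow> (real^'q) set" where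
  "quadrant a b R t = {s \<in> cbox a b. \<forall>p. if p \<in> R then s$p < t$p else s$p \<ge> t$p}"

text \<open>Functions are made extensional, i.e. they carry no information outside the box. Limits along
  quadrants that do not accumulate at \<open>t\<close> (at the boundary of the box) exist vacuously.\<close>

definition skorohod_space :: "real^'q \<Rightarrow> real^'q \<Rightarrow> (real^'q \<Rightarrow> real) set" where
  "skorohod_space a b = {f \<in> extensional (cbox a b). \<forall>t\<in>cbox a b.
     (\<forall>R. \<exists>L. (f \<longlongrightarrow> L) (at t within quadrant a b R t)) \<and>
     (f \<longlongrightarrow> f t) (at t within quadrant a b {} t)}"

definition time_change :: "real^'q \<Rightarrow> real^'q \<Rightarrow> ('q \<Rightarrow> real \<Rightarrow> real) \<Rightarrow> bool" where
  "time_change a b \<theta> \<longleftrightarrow> (\<forall>j. strict_mono_on {a$j..b$j} (\<theta> j) \<and>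
     continuous_on {a$j..b$j} (\<theta> j) \<and> \<theta> j ` {a$j..b$j} = {a$j..b$j})"

text \<open>\<open>skorohod_close a b e f g\<close>: some time change is uniformly \<open>e\<close>-close to the identity
  and makes \<open>f\<close> and \<open>g\<close> uniformly \<open>e\<close>-close.\<close>

definition skorohod_close ::
    "real^'q \<Rightarrow> real^'q \<Rightarrow> real \<Rightarrow> (real^'q \<Rightarrow> real) \<Rightarrow> (real^'q \<Rightarrow> real) \<Rightarrow> bool" where
  "skorohod_close a b e f g \<longleftrightarrow> (\<exists>\<theta>. time_change a b \<theta> \<and>
     (\<forall>j. \<forall>u\<in>{a$j..b$j}. \<bar>\<theta> j u - u\<bar> \<le> e) \<and>
     (\<forall>t\<in>cbox a b. \<bar>f t - g (\<chi> j. \<theta> j (t$j))\<bar> \<le> e))"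

definition skorohod_dist ::
    "real^'q \<Rightarrow> real^'q \<Rightarrow> (real^'q \<Rightarrow> real) \<Rightarrow> (real^'q \<Rightarrow> real) \<Rightarrow> real" where
  "skorohod_dist a b f g =
     (if f \<in> skorohod_space a b \<and> g \<in> skorohod_space a b
      then Inf {e. 0 < e \<and> skorohod_close a b e f g} else 0)"

definition skorohod_topology :: "real^'q \<Rightarrow> real^'q \<Rightarrow> (real^'q \<Rightarrow> real) topology" where
  "skorohod_topology a b = Metric_space.mtopology (skorohod_space a b) (skorohod_dist a b)"

definition skorohod_borel :: "real^'q \<Rightarrow> real^'q \<Rightarrow> (real^'q \<Rightarrow> real) measure" where
  "skorohod_borel a b = sigma (skorohod_space a b) {U. openin (skorohod_topology a b) U}"

text \<open>The Skorohod distance is a metric, and its convergent sequences are the expected ones.\<close>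

abbreviation warp :: "('q \<Rightarrow> real \<Rightarrow> real) \<Rightarrow> real^'q \<Rightarrow> real^'q" where
  "warp \<theta> t \<equiv> (\<chi> j. \<theta> j (t$j))"

lemma mem_box_coord: "t \<in> cbox a b \<longleftrightarrow> (\<forall>j. t$j \<in> {a$j..b$j})"
  for t a b :: "real^'q::finite"
  by (simp add: mem_box_cart)

lemma warp_in_cbox:
  assumes "time_change a b \<theta>" "t \<in> cbox a b"
  shows "warp \<theta> t \<in> cbox a b"
proof -
  have "\<theta> j (t$j) \<in> {a$j..b$j}" for j
  proof -
    have "\<theta> j (t$j) \<in> \<theta> j ` {a$j..b$j}"
      using assms(2) unfolding mem_box_coord by blast
    then show ?thesis
      using assms(1) unfolding time_change_def by simp
  qed
  then show ?thesis
    unfolding mem_box_coord by simp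
qed

lemma time_change_id: "time_change a b (\<lambda>_ u. u)"
  by (auto simp: time_change_def strict_mono_on_def)

lemma time_change_comp:
  assumes "time_change a b \<theta>" "time_change a b \<eta>"
  shows "time_change a b (\<lambda>j u. \<eta> j (\<theta> j u))"
  unfolding time_change_def
proof (intro allI conjI)
  fix j
  let ?I = "{a$j..b$j}"
  have 1: "strict_mono_on ?I (\<theta> j)" "continuous_on ?I (\<theta> j)" "\<theta> j ` ?I = ?I"
    and 2: "strict_mono_on ?I (\<eta> j)" "continuous_on ?I (\<eta> j)" "\<eta> j ` ?I = ?I"
    using assms unfolding time_change_def by blast+
  show "strict_mono_on ?I (\<lambda>u. \<eta> j (\<theta> j u))"
  proof (rule strict_mono_onI)
    fix u u'
    assume u: "u \<in> ?I" "u' \<in> ?I" "u < u'"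
    have "\<theta> j u \<in> ?I" "\<theta> j u' \<in> ?I"
      using u(1,2) 1(3) by blast+
    then show "\<eta> j (\<theta> j u) < \<eta> j (\<theta> j u')"
      using strict_mono_onD[OF 2(1)] strict_mono_onD[OF 1(1) u] by blast
  qed
  show "continuous_on ?I (\<lambda>u. \<eta> j (\<theta> j u))"
    by (rule continuous_on_compose2[OF 2(2) 1(2)]) (simp add: 1(3))
  show "(\<lambda>u. \<eta> j (\<theta> j u)) ` ?I = ?I"
    using 1(3) 2(3) by (metis image_image)
qed

lemma time_change_inv:
  assumes "time_change a b \<theta>"
  obtains \<eta> where "time_change a b \<eta>"
    "\<And>j u. u \<in> {a$j..b$j} \<Longrightarrow> \<eta> j u \<in> {a$j..b$j} \<and> \<theta> j (\<eta> j u) = u"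
proof
  let ?\<eta> = "\<lambda>j. inv_into {a$j..b$j} (\<theta> j)"
  have 1: "strict_mono_on {a$j..b$j} (\<theta> j)" "continuous_on {a$j..b$j} (\<theta> j)"
    "\<theta> j ` {a$j..b$j} = {a$j..b$j}" for j
    using assms unfolding time_change_def by blast+
  have inj: "inj_on (\<theta> j) {a$j..b$j}" for j
    using 1(1) by (rule strict_mono_on_imp_inj_on)
  show 2: "?\<eta> j u \<in> {a$j..b$j} \<and> \<theta> j (?\<eta> j u) = u" if "u \<in> {a$j..b$j}" for j u
    using that 1(3)[of j] by (metis f_inv_into_f inv_into_into)
  show "time_change a b ?\<eta>"
    unfolding time_change_def
  proof (intro allI conjI)
    fix j
    show "strict_mono_on {a$j..b$j} (?\<eta> j)"
    proof (rule strict_mono_onI)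
      fix u u'
      assume u: "u \<in> {a$j..b$j}" "u' \<in> {a$j..b$j}" "u < u'"
      show "?\<eta> j u < ?\<eta> j u'"
      proof (rule ccontr)
        assume "\<not> ?\<eta> j u < ?\<eta> j u'"
        then have "?\<eta> j u' \<le> ?\<eta> j u"
          by simp
        from strict_mono_on_leD[OF 1(1) _ _ this] have "\<theta> j (?\<eta> j u') \<le> \<theta> j (?\<eta> j u)"
          using 2[OF u(1)] 2[OF u(2)] by blast
        then show False
          using 2[OF u(1)] 2[OF u(2)] u(3) by simp
      qed
    qed
    have "continuous_on (\<theta> j ` {a$j..b$j}) (?\<eta> j)"
      by (rule continuous_on_inv[OF 1(2)]) (use inj in auto)
    then show "continuous_on {a$j..b$j} (?\<eta> j)"
      using 1(3) by simp
    show "?\<eta> j ` {a$j..b$j} = {a$j..b$j}"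
      using inv_into_image_cancel[OF inj[of j] order_refl] 1(3) by simp
  qed
qed

lemma time_change_top:
  assumes "time_change a b \<theta>" "a$j \<le> b$j"
  shows "\<theta> j (b$j) = b$j"
proof -
  have 1: "strict_mono_on {a$j..b$j} (\<theta> j)" "\<theta> j ` {a$j..b$j} = {a$j..b$j}"
    using assms unfolding time_change_def by blast+
  obtain u where u: "u \<in> {a$j..b$j}" "\<theta> j u = b$j"
    using 1(2) assms(2) by (metis atLeastAtMost_iff imageE order_refl)
  have "\<theta> j u \<le> \<theta> j (b$j)"
    using strict_mono_on_leD[OF 1(1)] u(1) by auto
  moreover have "\<theta> j (b$j) \<le> b$j"
    using 1(2) assms(2) by auto
  ultimately show ?thesis
    using u by simp
qed

lemma skorohod_close_mono: "skorohod_close a b e f g \<Longrightarrow> e \<le> e' \<Longrightarrow> skorohod_close a b e' f g"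
  unfolding skorohod_close_def by (meson order_trans)

lemma skorohod_close_refl: "0 \<le> e \<Longrightarrow> skorohod_close a b e f f"
  unfolding skorohod_close_def by (rule exI[of _ "\<lambda>_ u. u"]) (simp add: time_change_id)

lemma skorohod_close_sym:
  fixes a b :: "real^'q::finite"
  assumes "skorohod_close a b e f g"
  shows "skorohod_close a b e g f"
proof -
  obtain \<theta> where \<theta>: "time_change a b \<theta>" "\<And>j u. u \<in> {a$j..b$j} \<Longrightarrow> \<bar>\<theta> j u - u\<bar> \<le> e"
    "\<And>t. t \<in> cbox a b \<Longrightarrow> \<bar>f t - g (warp \<theta> t)\<bar> \<le> e"
    using assms unfolding skorohod_close_def by blast
  obtain \<eta> where \<eta>: "time_change a b \<eta>"
    "\<And>j u. u \<in> {a$j..b$j} \<Longrightarrow> \<eta> j u \<in> {a$j..b$j} \<and> \<theta> j (\<eta> j u) = u"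
    using time_change_inv[OF \<theta>(1)] by blast
  have "\<bar>\<eta> j u - u\<bar> \<le> e" if "u \<in> {a$j..b$j}" for j u
    using \<theta>(2)[of "\<eta> j u" j] \<eta>(2)[OF that] by (simp add: abs_minus_commute)
  moreover have "\<bar>g t - f (warp \<eta> t)\<bar> \<le> e" if t: "t \<in> cbox a b" for t
  proof -
    have "warp \<theta> (warp \<eta> t) = t"
      using \<eta>(2) t unfolding mem_box_coord by (simp add: vec_eq_iff)
    then show ?thesis
      using \<theta>(3)[OF warp_in_cbox[OF \<eta>(1) t]] by (simp add: abs_minus_commute)
  qed
  ultimately show ?thesis
    unfolding skorohod_close_def using \<eta>(1) by blast
qed

lemma skorohod_close_trans:
  fixes a b :: "real^'q::finite"
  assumes "skorohod_close a b e f g" "skorohod_close a b e' g h"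
  shows "skorohod_close a b (e + e') f h"
proof -
  obtain \<theta> where \<theta>: "time_change a b \<theta>" "\<And>j u. u \<in> {a$j..b$j} \<Longrightarrow> \<bar>\<theta> j u - u\<bar> \<le> e"
    "\<And>t. t \<in> cbox a b \<Longrightarrow> \<bar>f t - g (warp \<theta> t)\<bar> \<le> e"
    using assms(1) unfolding skorohod_close_def by blast
  obtain \<eta> where \<eta>: "time_change a b \<eta>" "\<And>j u. u \<in> {a$j..b$j} \<Longrightarrow> \<bar>\<eta> j u - u\<bar> \<le> e'"
    "\<And>t. t \<in> cbox a b \<Longrightarrow> \<bar>g t - h (warp \<eta> t)\<bar> \<le> e'"
    using assms(2) unfolding skorohod_close_def by blast
  have "\<bar>\<eta> j (\<theta> j u) - u\<bar> \<le> e + e'" if "u \<in> {a$j..b$j}" for j u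
  proof -
    have "\<theta> j u \<in> {a$j..b$j}"
      using \<theta>(1) that unfolding time_change_def by blast
    from \<eta>(2)[OF this] \<theta>(2)[OF that] show ?thesis by linarith
  qed
  moreover have "\<bar>f t - h (warp (\<lambda>j u. \<eta> j (\<theta> j u)) t)\<bar> \<le> e + e'" if t: "t \<in> cbox a b" for t
    using \<theta>(3)[OF t] \<eta>(3)[OF warp_in_cbox[OF \<theta>(1) t]] by simp
  ultimately show ?thesis
    unfolding skorohod_close_def using time_change_comp[OF \<theta>(1) \<eta>(1)] by blast
qed

lemma skorohod_space_bounded:
  fixes a b :: "real^'q::finite"
  assumes "f \<in> skorohod_space a b"
  obtains K where "\<And>t. t \<in> cbox a b \<Longrightarrow> \<bar>f t\<bar> \<le> K"
proof -
  have "\<exists>d K. 0 < d \<and> (\<forall>s\<in>cbox a b \<inter> ball t d. \<bar>f s\<bar> \<le> K)" if t: "t \<in> cbox a b" for t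
  proof -
    have "\<exists>d K. 0 < d \<and> (\<forall>s\<in>quadrant a b R t. s \<noteq> t \<and> dist s t < d \<longrightarrow> \<bar>f s\<bar> \<le> K)" for R
    proof -
      obtain L where "(f \<longlongrightarrow> L) (at t within quadrant a b R t)"
        using assms t unfolding skorohod_space_def by blast
      then have "eventually (\<lambda>s. dist (f s) L < 1) (at t within quadrant a b R t)"
        using tendstoD zero_less_one by blast
      then obtain d where "0 < d" "\<forall>s\<in>quadrant a b R t. s \<noteq> t \<and> dist s t < d \<longrightarrow> dist (f s) L < 1"
        unfolding eventually_at by blast
      then have "\<bar>f s\<bar> \<le> \<bar>L\<bar> + 1" if "s \<in> quadrant a b R t" "s \<noteq> t" "dist s t < d" for s
        using that abs_triangle_ineq2[of "f s" L] unfolding dist_real_def by fastforce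
      then show ?thesis
        using \<open>0 < d\<close> by blast
    qed
    then obtain d K where dK: "\<And>R. 0 < d R"
      "\<And>R s. s \<in> quadrant a b R t \<Longrightarrow> s \<noteq> t \<Longrightarrow> dist s t < d R \<Longrightarrow> \<bar>f s\<bar> \<le> K R"
      by metis
    let ?d = "Min (range d)" and ?K = "max \<bar>f t\<bar> (Max (range K))"
    have "\<bar>f s\<bar> \<le> ?K" if s: "s \<in> cbox a b \<inter> ball t ?d" for s
    proof (cases "s = t")
      case False
      let ?R = "{p. s$p < t$p}"
      have "s \<in> quadrant a b ?R t"
        using s by (auto simp: quadrant_def)
      moreover have "dist s t < d ?R"
        using s by (auto simp: dist_commute)
      ultimately have "\<bar>f s\<bar> \<le> K ?R"
        using dK(2) False by blast
      also have "\<dots> \<le> Max (range K)"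
        by simp
      finally show ?thesis by simp
    qed simp
    moreover have "0 < ?d"
      using dK(1) by simp
    ultimately show ?thesis by blast
  qed
  then obtain d K where dK: "\<And>t. t \<in> cbox a b \<Longrightarrow> 0 < d t"
    "\<And>t s. t \<in> cbox a b \<Longrightarrow> s \<in> cbox a b \<Longrightarrow> s \<in> ball t (d t) \<Longrightarrow> \<bar>f s\<bar> \<le> K t"
    by (metis IntI)
  have "cbox a b \<subseteq> (\<Union>t\<in>cbox a b. ball t (d t))"
    using dK(1) by force
  then obtain T where T: "T \<subseteq> cbox a b" "finite T" "cbox a b \<subseteq> (\<Union>t\<in>T. ball t (d t))"
    using compactE_image[OF compact_cbox, of "cbox a b" "\<lambda>t. ball t (d t)" a b] by auto
  have "\<bar>f s\<bar> \<le> (\<Sum>t\<in>T. \<bar>K t\<bar>)" if s: "s \<in> cbox a b" for s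
  proof -
    obtain t where t: "t \<in> T" "s \<in> ball t (d t)"
      using T(3) s by blast
    then have "\<bar>f s\<bar> \<le> K t"
      using dK(2) T(1) s by blast
    also have "\<dots> \<le> \<bar>K t\<bar>" by simp
    also have "\<dots> \<le> (\<Sum>t\<in>T. \<bar>K t\<bar>)"
      using t(1) T(2) by (intro member_le_sum) auto
    finally show ?thesis .
  qed
  then show ?thesis
    using that by blast
qed

lemma skorohod_close_exists:
  fixes a b :: "real^'q::finite"
  assumes "f \<in> skorohod_space a b" "g \<in> skorohod_space a b"
  shows "\<exists>e>0. skorohod_close a b e f g"
proof -
  obtain K L where K: "\<And>t. t \<in> cbox a b \<Longrightarrow> \<bar>f t\<bar> \<le> K" and L: "\<And>t. t \<in> cbox a b \<Longrightarrow> \<bar>g t\<bar> \<le> L"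
    using assms skorohod_space_bounded by metis
  have "\<bar>f t - g t\<bar> \<le> \<bar>K\<bar> + \<bar>L\<bar> + 1" if "t \<in> cbox a b" for t
    using K[OF that] L[OF that] by linarith
  then have "skorohod_close a b (\<bar>K\<bar> + \<bar>L\<bar> + 1) f g"
    unfolding skorohod_close_def
    by (intro exI[of _ "\<lambda>_ u. u"]) (simp add: time_change_id)
  moreover have "0 < \<bar>K\<bar> + \<bar>L\<bar> + 1"
    by linarith
  ultimately show ?thesis by blast
qed

lemma skorohod_dist_less:
  fixes a b :: "real^'q::finite"
  assumes "f \<in> skorohod_space a b" "g \<in> skorohod_space a b"
  shows "skorohod_dist a b f g < e \<longleftrightarrow> (\<exists>e'. 0 < e' \<and> e' < e \<and> skorohod_close a b e' f g)"
proof -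
  have "{e. 0 < e \<and> skorohod_close a b e f g} \<noteq> {}"
    using skorohod_close_exists[OF assms] by blast
  moreover have "bdd_below {e. 0 < e \<and> skorohod_close a b e f g}"
    by (rule bdd_belowI[of _ 0]) auto
  ultimately show ?thesis
    unfolding skorohod_dist_def using assms by (simp, subst cInf_less_iff) auto
qed

lemma skorohod_dist_nonneg:
  fixes a b :: "real^'q::finite"
  assumes "f \<in> skorohod_space a b" "g \<in> skorohod_space a b"
  shows "0 \<le> skorohod_dist a b f g"
  using skorohod_dist_less[OF assms, of 0] by (meson less_asym not_le)

lemma skorohod_close_all_imp_eq:
  fixes a b :: "real^'q::finite"
  assumes fg: "f \<in> skorohod_space a b" "g \<in> skorohod_space a b"
    and close: "\<And>e. 0 < e \<Longrightarrow> skorohod_close a b e f g"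
  shows "f = g"
proof
  fix x
  show "f x = g x"
  proof (cases "x \<in> cbox a b")
    case False
    then show ?thesis
      using fg unfolding skorohod_space_def by (auto simp: extensional_def)
  next
    case x: True
    have near: "\<exists>d>0. \<forall>s\<in>quadrant a b {} x. dist s x < d \<longrightarrow> \<bar>h s - h x\<bar> < e"
      if h: "h \<in> skorohod_space a b" and "0 < e" for h e
    proof -
      have "(h \<longlongrightarrow> h x) (at x within quadrant a b {} x)"
        using h x unfolding skorohod_space_def by blast
      then have "eventually (\<lambda>s. dist (h s) (h x) < e) (at x within quadrant a b {} x)"
        using tendstoD \<open>0 < e\<close> by blast
      then obtain d where "0 < d"
        "\<forall>s\<in>quadrant a b {} x. s \<noteq> x \<and> dist s x < d \<longrightarrow> dist (h s) (h x) < e"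
        unfolding eventually_at by blast
      then show ?thesis
        using \<open>0 < e\<close> by (metis abs_zero diff_self dist_real_def)
    qed
    have "\<bar>f x - g x\<bar> \<le> e" if "0 < e" for e
    proof -
      from that have e3: "0 < e / 3" by simp
      obtain d1 d2 where d1: "0 < d1" "\<And>s. s \<in> quadrant a b {} x \<Longrightarrow> dist s x < d1 \<Longrightarrow> \<bar>f s - f x\<bar> < e/3"
        and d2: "0 < d2" "\<And>s. s \<in> quadrant a b {} x \<Longrightarrow> dist s x < d2 \<Longrightarrow> \<bar>g s - g x\<bar> < e/3"
        using near[OF fg(1) e3] near[OF fg(2) e3] by blast
      define \<eta> where "\<eta> = min d1 d2 / (4 * real CARD('q))"
      have \<eta>: "0 < \<eta>"
        using d1(1) d2(1) by (simp add: \<eta>_def)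
      have small: "dist s x < d1 \<and> dist s x < d2" if "\<And>j. \<bar>s$j - x$j\<bar> \<le> 2 * \<eta>" for s
      proof -
        have "dist s x \<le> (\<Sum>j\<in>UNIV. \<bar>(s - x)$j\<bar>)"
          unfolding dist_norm by (rule norm_le_l1_cart)
        also have "\<dots> \<le> (\<Sum>j\<in>(UNIV::'q set). 2 * \<eta>)"
          using that by (intro sum_mono) simp
        also have "\<dots> = min d1 d2 / 2"
          by (simp add: \<eta>_def field_simps)
        finally show ?thesis
          using d1(1) d2(1) by linarith
      qed
      obtain \<theta> where \<theta>: "time_change a b \<theta>" "\<And>j u. u \<in> {a$j..b$j} \<Longrightarrow> \<bar>\<theta> j u - u\<bar> \<le> min \<eta> (e/3)"
        "\<And>t. t \<in> cbox a b \<Longrightarrow> \<bar>f t - g (warp \<theta> t)\<bar> \<le> min \<eta> (e/3)"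
        using close[of "min \<eta> (e/3)"] \<eta> e3 unfolding skorohod_close_def by auto
      define y where "y = (\<chi> j. min (b$j) (x$j + \<eta>))"
      have xj: "a$j \<le> x$j" "x$j \<le> b$j" for j
        using x unfolding mem_box_coord by auto
      have y: "x$j \<le> y$j" "y$j \<le> b$j" "y$j \<le> x$j + \<eta>" "y$j = b$j \<or> y$j = x$j + \<eta>" for j
        using xj[of j] \<eta> by (auto simp: y_def min_def)
      have y_box: "y \<in> cbox a b"
        unfolding mem_box_coord using y xj by (meson atLeastAtMost_iff order_trans)
      have "y \<in> quadrant a b {} x"
        using y_box y by (simp add: quadrant_def)
      moreover have "dist y x < d1"
      proof (rule small[THEN conjunct1])
        fix j
        show "\<bar>y$j - x$j\<bar> \<le> 2 * \<eta>"
          using y(1)[of j] y(3)[of j] \<eta> by linarith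
      qed
      ultimately have 1: "\<bar>f y - f x\<bar> < e/3"
        by (rule d1(2))
      have yI: "y$j \<in> {a$j..b$j}" for j
        using y_box unfolding mem_box_coord by blast
      have ge: "x$j \<le> \<theta> j (y$j)" for j
      proof (cases "y$j = b$j")
        case True
        then show ?thesis
          using time_change_top[OF \<theta>(1), of j] xj[of j] by simp
      next
        case False
        then have "y$j = x$j + \<eta>"
          using y(4) by blast
        then show ?thesis
          using \<theta>(2)[OF yI[of j]] by linarith
      qed
      have "warp \<theta> y \<in> quadrant a b {} x"
        using warp_in_cbox[OF \<theta>(1) y_box] ge by (simp add: quadrant_def)
      moreover have "dist (warp \<theta> y) x < d2"
      proof (rule small[THEN conjunct2])
        fix j
        show "\<bar>warp \<theta> y $ j - x$j\<bar> \<le> 2 * \<eta>"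
          using \<theta>(2)[OF yI[of j]] ge[of j] y(3)[of j] by (simp add: abs_le_iff)
      qed
      ultimately have 2: "\<bar>g (warp \<theta> y) - g x\<bar> < e/3"
        by (rule d2(2))
      show ?thesis
        using 1 2 \<theta>(3)[OF y_box] by linarith
    qed
    then show ?thesis
      using field_le_epsilon[of "\<bar>f x - g x\<bar>" 0] by simp
  qed
qed

lemma Metric_space_skorohod:
  fixes a b :: "real^'q::finite"
  shows "Metric_space (skorohod_space a b) (skorohod_dist a b)"
proof
  fix f g :: "real^'q \<Rightarrow> real"
  show "0 \<le> skorohod_dist a b f g"
    using skorohod_dist_nonneg[of f a b g] by (cases "f \<in> skorohod_space a b \<and> g \<in> skorohod_space a b")
      (auto simp: skorohod_dist_def)
  have "skorohod_close a b e f g \<longleftrightarrow> skorohod_close a b e g f" for e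
    using skorohod_close_sym by blast
  then show "skorohod_dist a b f g = skorohod_dist a b g f"
    by (auto simp: skorohod_dist_def)
next
  fix f g
  assume fg: "f \<in> skorohod_space a b" "g \<in> skorohod_space a b"
  show "skorohod_dist a b f g = 0 \<longleftrightarrow> f = g"
  proof
    assume "skorohod_dist a b f g = 0"
    then have "skorohod_close a b e f g" if "0 < e" for e
      using that skorohod_dist_less[OF fg, of e] skorohod_close_mono by (metis less_imp_le)
    then show "f = g"
      by (rule skorohod_close_all_imp_eq[OF fg])
  next
    assume "f = g"
    have "skorohod_dist a b f g < e" if "0 < e" for e
      unfolding skorohod_dist_less[OF fg]
      using that \<open>f = g\<close> by (intro exI[of _ "e/2"]) (simp add: skorohod_close_refl)
    then have "\<not> 0 < skorohod_dist a b f g"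
      by blast
    then show "skorohod_dist a b f g = 0"
      using skorohod_dist_nonneg[OF fg] by linarith
  qed
next
  fix f g h
  assume D: "f \<in> skorohod_space a b" "g \<in> skorohod_space a b" "h \<in> skorohod_space a b"
  show "skorohod_dist a b f h \<le> skorohod_dist a b f g + skorohod_dist a b g h"
  proof (rule field_le_epsilon)
    fix e :: real
    assume "0 < e"
    then have "skorohod_dist a b f g < skorohod_dist a b f g + e/2"
      "skorohod_dist a b g h < skorohod_dist a b g h + e/2"
      by simp_all
    then obtain e1 e2 where
      "0 < e1" "e1 < skorohod_dist a b f g + e/2" "skorohod_close a b e1 f g"
      "0 < e2" "e2 < skorohod_dist a b g h + e/2" "skorohod_close a b e2 g h"
      unfolding skorohod_dist_less[OF D(1,2)] skorohod_dist_less[OF D(2,3)] by blast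
    note e12 = this
    have "0 < e1 + e2" "e1 + e2 < skorohod_dist a b f g + skorohod_dist a b g h + e"
      using e12(1,2,4,5) by linarith+
    moreover have "skorohod_close a b (e1 + e2) f h"
      using e12(3,6) by (rule skorohod_close_trans)
    ultimately have "skorohod_dist a b f h < skorohod_dist a b f g + skorohod_dist a b g h + e"
      unfolding skorohod_dist_less[OF D(1,3)] by blast
    then show "skorohod_dist a b f h \<le> skorohod_dist a b f g + skorohod_dist a b g h + e"
      by simp
  qed
qed

lemma limitin_skorohod:
  fixes a b :: "real^'q::finite"
  assumes F: "\<And>n. F n \<in> skorohod_space a b" and f: "f \<in> skorohod_space a b"
  shows "limitin (skorohod_topology a b) F f sequentially \<longleftrightarrow>
    (\<exists>\<theta>. (\<forall>n. time_change a b (\<theta> n)) \<and>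
       (\<forall>j. uniform_limit {a$j..b$j} (\<lambda>n. \<theta> n j) (\<lambda>u. u) sequentially) \<and>
       uniform_limit (cbox a b) (\<lambda>n t. F n t - f (warp (\<theta> n) t)) (\<lambda>_. 0) sequentially)"
    (is "?lim \<longleftrightarrow> (\<exists>\<theta>. ?P \<theta>)")
proof -
  interpret S: Metric_space "skorohod_space a b" "skorohod_dist a b"
    by (rule Metric_space_skorohod)
  have "?lim \<longleftrightarrow> (\<lambda>n. skorohod_dist a b (F n) f) \<longlonglongrightarrow> 0"
    unfolding skorohod_topology_def S.limitin_metric_dist_null using F f by simp
  also have "\<dots> \<longleftrightarrow> (\<exists>\<theta>. ?P \<theta>)"
  proof
    assume lim: "(\<lambda>n. skorohod_dist a b (F n) f) \<longlonglongrightarrow> 0"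
    define e where "e n = skorohod_dist a b (F n) f + inverse (real (Suc n))" for n
    have "skorohod_close a b (e n) (F n) f" for n
    proof -
      have "skorohod_dist a b (F n) f < e n"
        by (simp add: e_def)
      then show ?thesis
        unfolding skorohod_dist_less[OF F f] using skorohod_close_mono by (metis less_imp_le)
    qed
    then have "\<forall>n. \<exists>\<theta>. time_change a b \<theta> \<and> (\<forall>j. \<forall>u\<in>{a$j..b$j}. \<bar>\<theta> j u - u\<bar> \<le> e n) \<and>
        (\<forall>t\<in>cbox a b. \<bar>F n t - f (warp \<theta> t)\<bar> \<le> e n)"
      unfolding skorohod_close_def by simp
    from choice[OF this] obtain \<theta> where "\<forall>n. time_change a b (\<theta> n) \<and>
        (\<forall>j. \<forall>u\<in>{a$j..b$j}. \<bar>\<theta> n j u - u\<bar> \<le> e n) \<and>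
        (\<forall>t\<in>cbox a b. \<bar>F n t - f (warp (\<theta> n) t)\<bar> \<le> e n)" ..
    then have \<theta>: "\<And>n. time_change a b (\<theta> n)"
      "\<And>n j u. u \<in> {a$j..b$j} \<Longrightarrow> \<bar>\<theta> n j u - u\<bar> \<le> e n"
      "\<And>n t. t \<in> cbox a b \<Longrightarrow> \<bar>F n t - f (warp (\<theta> n) t)\<bar> \<le> e n"
      by simp_all
    have "e \<longlonglongrightarrow> 0"
      unfolding e_def using tendsto_add[OF lim LIMSEQ_inverse_real_of_nat] by simp
    then have ev: "eventually (\<lambda>n. e n < d) sequentially" if "0 < d" for d
      using that by (rule order_tendstoD(2))
    have "uniform_limit {a$j..b$j} (\<lambda>n. \<theta> n j) (\<lambda>u. u) sequentially" for j
      unfolding uniform_limit_iff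
    proof (intro allI impI)
      fix d :: real
      assume "0 < d"
      from ev[OF this] show "\<forall>\<^sub>F n in sequentially. \<forall>u\<in>{a$j..b$j}. dist (\<theta> n j u) u < d"
      proof eventually_elim
        case (elim n)
        show ?case
        proof
          fix u
          assume "u \<in> {a$j..b$j}"
          from le_less_trans[OF \<theta>(2)[OF this] elim] show "dist (\<theta> n j u) u < d"
            by (simp add: dist_real_def)
        qed
      qed
    qed
    moreover have "uniform_limit (cbox a b) (\<lambda>n t. F n t - f (warp (\<theta> n) t)) (\<lambda>_. 0) sequentially"
      unfolding uniform_limit_iff
    proof (intro allI impI)
      fix d :: real
      assume "0 < d"
      from ev[OF this] show
        "\<forall>\<^sub>F n in sequentially. \<forall>t\<in>cbox a b. dist (F n t - f (warp (\<theta> n) t)) 0 < d"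
      proof eventually_elim
        case (elim n)
        show ?case
        proof
          fix t
          assume "t \<in> cbox a b"
          from le_less_trans[OF \<theta>(3)[OF this] elim] show "dist (F n t - f (warp (\<theta> n) t)) 0 < d"
            by (simp add: dist_real_def)
        qed
      qed
    qed
    ultimately have "?P \<theta>"
      using \<theta>(1) by blast
    then show "\<exists>\<theta>. ?P \<theta>" by blast
  next
    assume "\<exists>\<theta>. ?P \<theta>"
    then obtain \<theta> where \<theta>: "\<And>n. time_change a b (\<theta> n)"
      "\<And>j. uniform_limit {a$j..b$j} (\<lambda>n. \<theta> n j) (\<lambda>u. u) sequentially"
      "uniform_limit (cbox a b) (\<lambda>n t. F n t - f (warp (\<theta> n) t)) (\<lambda>_. 0) sequentially"
      by blast
    show "(\<lambda>n. skorohod_dist a b (F n) f) \<longlonglongrightarrow> 0"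
    proof (rule order_tendstoI)
      fix d :: real
      assume "d < 0"
      then show "eventually (\<lambda>n. d < skorohod_dist a b (F n) f) sequentially"
        by (auto intro!: always_eventually simp: less_le_trans[OF _ S.nonneg])
    next
      fix d :: real
      assume d: "0 < d"
      have "eventually (\<lambda>n. \<forall>j. \<forall>u\<in>{a$j..b$j}. dist (\<theta> n j u) u < d/2) sequentially"
        using \<theta>(2) half_gt_zero[OF d] unfolding uniform_limit_iff by (intro eventually_all_finite) blast
      moreover have "eventually (\<lambda>n. \<forall>t\<in>cbox a b. dist (F n t - f (warp (\<theta> n) t)) 0 < d/2) sequentially"
        using \<theta>(3) half_gt_zero[OF d] unfolding uniform_limit_iff by blast
      ultimately show "eventually (\<lambda>n. skorohod_dist a b (F n) f < d) sequentially"
      proof eventually_elim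
        case (elim n)
        then have "skorohod_close a b (d/2) (F n) f"
          unfolding skorohod_close_def
          by (intro exI[of _ "\<theta> n"]) (use \<theta>(1) in \<open>auto simp: dist_real_def intro: less_imp_le\<close>)
        then show ?case
          unfolding skorohod_dist_less[OF F f] using d by (intro exI[of _ "d/2"]) simp
      qed
    qed
  qed
  finally show ?thesis .
qed


section \<open>Weak convergence of processes\<close>

text \<open>\<open>Y\<close> is a random element of the Skorohod space whose paths are a.s. those of the process \<open>X\<close>.
  Passing to \<open>Y\<close> is needed because some processes (Brownian motion, integrals with respect to it)
  have paths in the Skorohod space only almost surely.\<close>

definition skorohod_version ::
    "'w measure \<Rightarrow> real^'q \<Rightarrow> real^'q \<Rightarrow> (real^'q \<Rightarrow> 'w \<Rightarrow> real) \<Rightarrow> ('w \<Rightarrow> real^'q \<Rightarrow> real) \<Rightarrow> bool" where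
  "skorohod_version M a b X Y \<longleftrightarrow>
     Y \<in> M \<rightarrow>\<^sub>M skorohod_borel a b \<and> (AE \<omega> in M. \<forall>t\<in>cbox a b. Y \<omega> t = X t \<omega>)"

text \<open>Weak convergence, along the filter \<open>F\<close>, of the processes \<open>X n\<close> (on \<open>M\<close>) to \<open>Z\<close> (on \<open>N\<close>) in the
  Skorohod space on \<open>[a,b]\<close>.\<close>

definition converges_weakly ::
    "real^'q \<Rightarrow> real^'q \<Rightarrow> 'i filter \<Rightarrow> 'w measure \<Rightarrow> ('i \<Rightarrow> real^'q \<Rightarrow> 'w \<Rightarrow> real) \<Rightarrow>
     'v measure \<Rightarrow> (real^'q \<Rightarrow> 'v \<Rightarrow> real) \<Rightarrow> bool" where
  "converges_weakly a b F M X N Z \<longleftrightarrow>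
     (\<exists>X' Z'. (\<forall>n. skorohod_version M a b (X n) (X' n)) \<and> skorohod_version N a b Z Z' \<and>
        (\<forall>G. continuous_map (skorohod_topology a b) euclideanreal G \<longrightarrow>
             bounded (G ` skorohod_space a b) \<longrightarrow>
             ((\<lambda>n. \<integral>\<omega>. G (X' n \<omega>) \<partial>M) \<longlongrightarrow> (\<integral>\<omega>. G (Z' \<omega>) \<partial>N)) F))"


section \<open>Brownian motion and the noise\<close>

definition block :: "real^'q \<Rightarrow> real^'q \<Rightarrow> (real^'q) set" where
  "block s t = {x. \<forall>j. s$j < x$j \<and> x$j \<le> t$j}"

definition brownian_motion :: "'w measure \<Rightarrow> (real^'q::finite \<Rightarrow> 'w \<Rightarrow> real) \<Rightarrow> bool" where
  "brownian_motion N B \<longleftrightarrow>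
     (\<forall>t\<in>cbox 0 1. B t \<in> borel_measurable N) \<and>
     (AE \<omega> in N. continuous_on (cbox 0 1) (\<lambda>t. B t \<omega>)) \<and>
     (AE \<omega> in N. \<forall>t\<in>cbox 0 1. (\<exists>j. t$j = 0) \<longrightarrow> B t \<omega> = 0) \<and>
     (\<forall>s\<in>cbox 0 1. \<forall>t\<in>cbox 0 1. (\<forall>j. s$j < t$j) \<longrightarrow>
        distributed N lborel (\<lambda>\<omega>. alt_sum UNIV (\<lambda>x. B x \<omega>) s t)
          (normal_density 0 (sqrt (measure lborel (block s t))))) \<and>
     (\<forall>J \<subseteq> {(s, t). s \<in> cbox 0 1 \<and> t \<in> cbox 0 1 \<and> (\<forall>j. s$j < t$j)}.
        disjoint_family_on (\<lambda>(s, t). block s t) J \<longrightarrow>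
        prob_space.indep_vars N (\<lambda>_. borel) (\<lambda>(s, t) \<omega>. alt_sum UNIV (\<lambda>x. B x \<omega>) s t) J)"

definition weakly_stationary :: "'w measure \<Rightarrow> (int^'q \<Rightarrow> 'w \<Rightarrow> real) \<Rightarrow> bool" where
  "weakly_stationary M \<epsilon> \<longleftrightarrow>
     (\<forall>i. \<epsilon> i \<in> borel_measurable M \<and> integrable M (\<lambda>\<omega>. (\<epsilon> i \<omega>)\<^sup>2)) \<and>
     (\<forall>i k. (\<integral>\<omega>. \<epsilon> (i + k) \<omega> \<partial>M) = (\<integral>\<omega>. \<epsilon> i \<omega> \<partial>M)) \<and>
     (\<forall>i j k. (\<integral>\<omega>. (\<epsilon> (i + k) \<omega> - (\<integral>\<omega>'. \<epsilon> (i + k) \<omega>' \<partial>M)) * (\<epsilon> (j + k) \<omega> - (\<integral>\<omega>'. \<epsilon> (j + k) \<omega>' \<partial>M)) \<partial>M)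
            = (\<integral>\<omega>. (\<epsilon> i \<omega> - (\<integral>\<omega>'. \<epsilon> i \<omega>' \<partial>M)) * (\<epsilon> j \<omega> - (\<integral>\<omega>'. \<epsilon> j \<omega>' \<partial>M)) \<partial>M))"

text \<open>The limit regime \<open>min {n\<^sub>1, n\<^sub>2, n\<^sub>3} \<rightarrow> \<infinity>\<close>.\<close>

definition min_at_top :: "(nat^3) filter" where
  "min_at_top = filtercomap (\<lambda>n. Min (range (($) n))) at_top"

definition partial_sum :: "(int^3 \<Rightarrow> 'w \<Rightarrow> real) \<Rightarrow> nat^3 \<Rightarrow> real^3 \<Rightarrow> 'w \<Rightarrow> real" where
  "partial_sum \<epsilon> n v \<omega> =
     (\<Sum>i1 = 1..nat \<lfloor>real (n$1) * v$1\<rfloor>. \<Sum>i2 = 1..nat \<lfloor>real (n$2) * v$2\<rfloor>. \<Sum>i3 = 1..nat \<lfloor>real (n$3) * v$3\<rfloor>.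
        \<epsilon> (vector [int i1, int i2, int i3]) \<omega>) / sqrt (real (n$1) * real (n$2) * real (n$3))"

definition long_run_variance :: "'w measure \<Rightarrow> (int^3 \<Rightarrow> 'w \<Rightarrow> real) \<Rightarrow> real \<Rightarrow> bool" where
  "long_run_variance M \<epsilon> V \<longleftrightarrow>
     ((\<lambda>n. prob_space.variance M (partial_sum \<epsilon> n 1)) \<longlongrightarrow> V) min_at_top \<and>
     ((\<lambda>k. \<integral>\<omega>. \<epsilon> 0 \<omega> * \<epsilon> k \<omega> \<partial>M) has_sum V) UNIV"


section \<open>Observations, the detector statistic and its limit\<close>

definition sinc_kernel :: "real \<Rightarrow> real \<Rightarrow> real" where
  "sinc_kernel w t = (if t = 0 then w / pi else sin (w * t) / (pi * t))"

definition kernel :: "real^3 \<Rightarrow> real \<Rightarrow> real \<Rightarrow> real \<Rightarrow> real" where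
  "kernel \<Omega> t r2 r3 = sinc_kernel (\<Omega>$1) t * sinc_kernel (\<Omega>$2) r2 * sinc_kernel (\<Omega>$3) r3"

text \<open>\<open>\<tau> j m\<close> is the sampling period in direction \<open>j\<close> belonging to the sample size \<open>n\<^sub>j = m\<close>.\<close>

definition obs ::
    "(real \<Rightarrow> real \<Rightarrow> real \<Rightarrow> real) \<Rightarrow> (int^3 \<Rightarrow> 'w \<Rightarrow> real) \<Rightarrow> (3 \<Rightarrow> nat \<Rightarrow> real) \<Rightarrow> nat^3 \<Rightarrow>
     nat \<Rightarrow> nat \<Rightarrow> nat \<Rightarrow> 'w \<Rightarrow> real" where
  "obs f \<epsilon> \<tau> n i1 i2 i3 \<omega> =
     f (real i1 * \<tau> 1 (n$1)) (real i2 * \<tau> 2 (n$2)) (real i3 * \<tau> 3 (n$3))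
     + \<epsilon> (vector [int i1, int i2, int i3]) \<omega>"

definition obs_mean ::
    "real \<Rightarrow> nat^3 \<Rightarrow> (nat \<Rightarrow> nat \<Rightarrow> nat \<Rightarrow> 'w \<Rightarrow> real) \<Rightarrow> nat \<Rightarrow> nat \<Rightarrow> 'w \<Rightarrow> real" where
  "obs_mean s0 n y l2 l3 \<omega> =
     (\<Sum>l1 = 1..nat \<lfloor>real (n$1) * s0\<rfloor>. y l1 l2 l3 \<omega>) / of_int \<lfloor>real (n$1) * s0\<rfloor>"

text \<open>Points of the index box of the processes below are \<open>x = (s, t, r\<^sub>2, r\<^sub>3)\<close>.\<close>

definition F_stat ::
    "real^3 \<Rightarrow> (3 \<Rightarrow> nat \<Rightarrow> real) \<Rightarrow> real \<Rightarrow> nat^3 \<Rightarrow> (nat \<Rightarrow> nat \<Rightarrow> nat \<Rightarrow> 'w \<Rightarrow> real) \<Rightarrow>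
     real^4 \<Rightarrow> 'w \<Rightarrow> real" where
  "F_stat \<Omega> \<tau> s0 n y x \<omega> =
     sqrt (\<tau> 1 (n$1) * \<tau> 2 (n$2) * \<tau> 3 (n$3)) *
     (\<Sum>l1 = 1..nat \<lfloor>real (n$1) * x$1\<rfloor>. \<Sum>l2 = 1..n$2. \<Sum>l3 = 1..n$3.
        (y l1 l2 l3 \<omega> - obs_mean s0 n y l2 l3 \<omega>) *
        kernel \<Omega> (x$2 - real l1 * \<tau> 1 (n$1)) (x$3 - real l2 * \<tau> 2 (n$2)) (x$4 - real l3 * \<tau> 3 (n$3)))"

definition B_centered :: "real \<Rightarrow> (real^3 \<Rightarrow> 'w \<Rightarrow> real) \<Rightarrow> real^3 \<Rightarrow> 'w \<Rightarrow> real" where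
  "B_centered s0 B z \<omega> = B z \<omega> - z$1 / s0 * B (vector [s0, z$2, z$3]) \<omega>"

definition F_limit ::
    "real^3 \<Rightarrow> real^3 \<Rightarrow> real \<Rightarrow> real \<Rightarrow> (real^3 \<Rightarrow> 'w \<Rightarrow> real) \<Rightarrow> real^4 \<Rightarrow> 'w \<Rightarrow> real" where
  "F_limit \<Omega> \<tau>bar s0 \<sigma> B x \<omega> =
     sqrt (\<tau>bar$1 * \<tau>bar$2 * \<tau>bar$3) * \<sigma> *
     ibp_integral 0 (vector [x$1, 1, 1])
       (\<lambda>z. kernel \<Omega> (x$2 - \<tau>bar$1 * z$1) (x$3 - \<tau>bar$2 * z$2) (x$4 - \<tau>bar$3 * z$3))
       (\<lambda>z. B_centered s0 B z \<omega>)"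

end

theory Submission
  imports Defs "HOL-Real_Asymp.Real_Asymp"
begin

text \<open>
  Under the null hypothesis the signal is constant in time at the sampling points, so it cancels
  against the mean over the first \<open>\<lfloor>n\<^sub>1 s\<^sub>0\<rfloor>\<close> time slices, and the statistic is a weighted sum of centred
  noise. Summation by parts in all three directions at once (\<open>weighted_sum_by_parts\<close>, \<open>sum_faces\<close>)
  turns it into values of the centred partial sum process, weighted by increments of the kernel.
  The limit has the same form in the continuum: the integral with respect to \<open>B\<^sup>c\<close> is defined
  by moving the differential to the smooth kernel, and as \<open>B\<^sup>c\<close> vanishes on the lower faces of the box,
  exactly one integral over a face survives for every set \<open>v\<close> of directions (\<open>ibp_integral_prod\<close>).
  Statistic and limit are thus, up to constants and a small error, values of one functional of a path, \<open>ibp_faces\<close>,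
  which is continuous under uniform convergence of the path, of the kernel and of the upper end point.

  This yields a deterministic statement, \<open>F_stat_uniform_limit\<close>: whenever partial sum
  paths converge uniformly to a continuous path, the statistics built from them converge uniformly
  on the index box. Two further ingredients lead from paths to laws.

  First, the map from partial sums to statistics depends on \<open>n\<close>, and its limit need not
  be continuous at paths with jumps, as it evaluates the path at the fixed time \<open>s\<^sub>0\<close>. Brownian
  paths are almost surely continuous, and Skorohod convergence to a continuous path is uniform
  convergence. \<open>extended_continuous_mapping\<close> shows that convergence along sequences to almost every
  limit path is enough for weak convergence. It compares a bounded continuous test function with
  Lipschitz envelopes on the space of partial sum paths, so the two probability spaces never have
  to be coupled.

  Second, the limit process has to be a random element of the Skorohod space. The deterministic statement
  provides this as well: fed with the lattice increments of the Brownian path as noise, the statistics are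
  random step functions, hence measurable (\<open>measurable_F_stat\<close>), and they converge to the limit
  process for every outcome outside a null set.
\<close>

section \<open>Weak convergence under mappings that vary with the index\<close>

lemma (in Metric_space) limitin_sequentially_dist:
  assumes "\<And>k::nat. x k \<in> M" "y \<in> M" "(\<lambda>k. d (x k) y) \<longlonglongrightarrow> 0"
  shows "limitin mtopology x y sequentially"
  using assms by (simp add: limitin_metric_dist_null)

lemma (in Metric_space) continuous_map_Lipschitz_real:
  assumes "\<And>x y. x \<in> M \<Longrightarrow> y \<in> M \<Longrightarrow> g x \<le> g y + C * d x y"
  shows "continuous_map mtopology euclideanreal g"
  unfolding continuous_map_from_metric
proof (intro conjI ballI allI impI)
  fix a U
  assume a: "a \<in> M" and U: "openin euclideanreal U \<and> g a \<in> U"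
  then obtain e where e: "0 < e" "\<And>u. dist u (g a) < e \<Longrightarrow> u \<in> U"
    by (metis open_dist open_openin)
  have "g x \<in> U" if x: "x \<in> M" "d a x < e / (\<bar>C\<bar> + 1)" for x
  proof (rule e(2))
    have "\<bar>C\<bar> * d a x \<le> (\<bar>C\<bar> + 1) * d a x"
      by (intro mult_right_mono) auto
    also have "\<dots> < e"
      using x(2) by (simp add: field_simps)
    finally have "\<bar>C\<bar> * d a x < e" .
    moreover have "C * d a x \<le> \<bar>C\<bar> * d a x"
      by (intro mult_right_mono) auto
    ultimately show "dist (g x) (g a) < e"
      using assms[OF a x(1)] assms[OF x(1) a] by (simp add: dist_real_def commute[of x a])
  qed
  then show "\<exists>r>0. \<forall>x. x \<in> M \<and> d a x < r \<longrightarrow> g x \<in> U"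
    using e(1) by (intro exI[of _ "e / (\<bar>C\<bar> + 1)"]) (simp add: add_nonneg_pos)
qed auto

text \<open>The points that have a ball of radius larger than \<open>1 / (j + 1)\<close> inside \<open>U\<close> form an open set \<open>V j\<close>.
  A limit lies in \<open>U\<close> iff, for some \<open>j\<close>, the sequence eventually stays in \<open>V j\<close>; this is a countable
  combination of measurable events.\<close>

lemma (in Metric_space) measurable_mtopology_limit:
  assumes X: "\<And>k::nat. X k \<in> N \<rightarrow>\<^sub>M sigma M {U. openin mtopology U}"
    and Y: "\<And>w. w \<in> space N \<Longrightarrow> Y w \<in> M"
    and lim: "\<And>w. w \<in> space N \<Longrightarrow> (\<lambda>k. d (X k w) (Y w)) \<longlonglongrightarrow> 0"
  shows "Y \<in> N \<rightarrow>\<^sub>M sigma M {U. openin mtopology U}"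
proof (rule measurable_measure_of)
  show "{U. openin mtopology U} \<subseteq> Pow M"
    using openin_subset by fastforce
  show "Y \<in> space N \<rightarrow> M"
    using Y by blast
next
  fix U
  assume "U \<in> {U. openin mtopology U}"
  then have U: "openin mtopology U" by simp
  define V where "V j = {x \<in> M. \<exists>r>inverse (real (Suc j)). mball x r \<subseteq> U}" for j
  have V_sub: "V j \<subseteq> M" for j
    by (auto simp: V_def)
  have openV: "openin mtopology (V j)" for j
    unfolding openin_mtopology
  proof (intro conjI allI impI)
    fix x
    assume "x \<in> V j"
    then obtain r where r: "x \<in> M" "inverse (real (Suc j)) < r" "mball x r \<subseteq> U"
      unfolding V_def by blast
    define \<delta> where "\<delta> = (r - inverse (real (Suc j))) / 2"
    have "r - \<delta> - \<delta> = inverse (real (Suc j))" "0 < \<delta>"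
      using r(2) by (simp_all add: \<delta>_def)
    then have \<delta>: "0 < \<delta>" "inverse (real (Suc j)) < r - \<delta>"
      by linarith+
    have "mball x \<delta> \<subseteq> V j"
    proof
      fix y
      assume y: "y \<in> mball x \<delta>"
      then have "mball y (r - \<delta>) \<subseteq> mball x r"
        by (intro mball_subset) (auto simp: commute)
      then show "y \<in> V j"
        unfolding V_def using y r(3) \<delta>(2) by auto
    qed
    then show "\<exists>r>0. mball x r \<subseteq> V j"
      using \<delta>(1) by blast
  qed (use V_sub in auto)
  have X_in: "X k w \<in> M" if "w \<in> space N" for k w
    using measurable_space[OF X that] by (simp add: space_measure_of_conv)
  have "Y -` U \<inter> space N = (\<Union>j. \<Union>k0. \<Inter>k\<in>{k0..}. X k -` V j \<inter> space N)"
  proof (intro equalityI subsetI)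
    fix w
    assume w: "w \<in> Y -` U \<inter> space N"
    then obtain r where r: "0 < r" "mball (Y w) r \<subseteq> U"
      using U unfolding openin_mtopology by blast
    obtain j where j: "inverse (real (Suc j)) < r / 2"
      using reals_Archimedean[of "r / 2"] r(1) by auto
    have "eventually (\<lambda>k. d (X k w) (Y w) < r / 2) sequentially"
      using order_tendstoD(2)[OF lim, of w "r / 2"] w r(1) by simp
    then obtain k0 where k0: "\<And>k. k0 \<le> k \<Longrightarrow> d (X k w) (Y w) < r / 2"
      unfolding eventually_sequentially by blast
    have "X k w \<in> V j" if "k0 \<le> k" for k
    proof -
      have "mball (X k w) (r / 2) \<subseteq> mball (Y w) r"
        using k0[OF that] w Y X_in by (intro mball_subset) auto
      then show ?thesis
        unfolding V_def using j r(2) w X_in by blast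
    qed
    then show "w \<in> (\<Union>j. \<Union>k0. \<Inter>k\<in>{k0..}. X k -` V j \<inter> space N)"
      using w by blast
  next
    fix w
    assume "w \<in> (\<Union>j. \<Union>k0. \<Inter>k\<in>{k0..}. X k -` V j \<inter> space N)"
    then obtain j k0 where j: "\<And>k. k0 \<le> k \<Longrightarrow> X k w \<in> V j" and w: "w \<in> space N"
      by blast
    have "eventually (\<lambda>k. d (X k w) (Y w) < inverse (real (Suc j))) sequentially"
      by (rule order_tendstoD(2)[OF lim[OF w]]) simp
    then obtain k where k: "k0 \<le> k" "d (X k w) (Y w) < inverse (real (Suc j))"
      unfolding eventually_sequentially by (metis linear)
    then show "w \<in> Y -` U \<inter> space N"
      using j[OF k(1)] w Y[OF w] unfolding V_def in_mball by (auto simp: subset_eq)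
  qed
  also have "\<dots> \<in> sets N"
  proof -
    have sub: "{U. openin mtopology U} \<subseteq> Pow M"
      using openin_subset by fastforce
    have "V j \<in> sets (sigma M {U. openin mtopology U})" for j
      using openV sets_measure_of[OF sub] by (simp add: sigma_sets.Basic)
    then have "X k -` V j \<inter> space N \<in> sets N" for k j
      using X measurable_sets by blast
    then show ?thesis
      by (intro sets.countable_UN sets.countable_INT image_subsetI) auto
  qed
  finally show "Y -` U \<inter> space N \<in> sets N" .
qed

lemma measurable_mtopology_borel:
  assumes "X \<in> M \<rightarrow>\<^sub>M sigma (topspace T) {U. openin T U}" "continuous_map T euclideanreal g"
  shows "(\<lambda>w. g (X w)) \<in> borel_measurable M"
proof (rule measurable_compose[OF assms(1)])
  have sub: "{U. openin T U} \<subseteq> Pow (topspace T)"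
    using openin_subset by fastforce
  show "g \<in> borel_measurable (sigma (topspace T) {U. openin T U})"
  proof (rule borel_measurableI)
    fix S :: "real set"
    assume "open S"
    then have "openin T {x \<in> topspace T. g x \<in> S}"
      using assms(2) by (simp add: continuous_map_def)
    moreover have "g -` S \<inter> space (sigma (topspace T) {U. openin T U}) = {x \<in> topspace T. g x \<in> S}"
      by (auto simp: space_measure_of_conv)
    ultimately show "g -` S \<inter> space (sigma (topspace T) {U. openin T U})
        \<in> sets (sigma (topspace T) {U. openin T U})"
      using sub by auto
  qed
qed

lemma eventually_filtercomap_at_top_ge:
  fixes rank :: "'i \<Rightarrow> nat"
  shows "eventually (\<lambda>n. k \<le> rank n) (filtercomap rank at_top)"
  unfolding eventually_filtercomap using eventually_ge_at_top[of k] by blast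

text \<open>The envelope \<open>H k x\<close> is the infimum of \<open>g (X n w) + k * d x (S n w)\<close> over the good pairs \<open>(n, w)\<close>
  with rank at least \<open>k\<close>. It is \<open>k\<close>-Lipschitz in \<open>x\<close>, so the convergence assumed for \<open>S\<close> applies to it,
  and at \<open>x = S n w\<close> it lies below \<open>g (X n w)\<close>. As \<open>k\<close> grows, it reaches at least \<open>g (W z)\<close> at
  almost every \<open>Z z\<close>: otherwise almost minimal pairs would form a sequence along which \<open>S\<close> tends to
  \<open>Z z\<close>, while \<open>g\<close> of \<open>X\<close> stays away from \<open>g (W z)\<close>.\<close>

lemma extended_mapping_lower_bound:
  fixes rank :: "'i \<Rightarrow> nat"
  assumes "prob_space M" "prob_space N"
    and E: "Metric_space E d" and E': "Metric_space E' d'"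
    and S: "\<And>n. S n \<in> M \<rightarrow>\<^sub>M sigma E {U. openin (Metric_space.mtopology E d) U}"
    and X: "\<And>n. X n \<in> M \<rightarrow>\<^sub>M sigma E' {U. openin (Metric_space.mtopology E' d') U}"
    and Z: "Z \<in> N \<rightarrow>\<^sub>M sigma E {U. openin (Metric_space.mtopology E d) U}"
    and W: "W \<in> N \<rightarrow>\<^sub>M sigma E' {U. openin (Metric_space.mtopology E' d') U}"
    and conv: "\<And>g. continuous_map (Metric_space.mtopology E d) euclideanreal g \<Longrightarrow> bounded (g ` E) \<Longrightarrow>
      ((\<lambda>n. \<integral>w. g (S n w) \<partial>M) \<longlongrightarrow> (\<integral>w. g (Z w) \<partial>N)) (filtercomap rank at_top)"
    and good: "\<And>n. AE w in M. good n w"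
    and path: "AE z in N. \<forall>\<nu> w. (\<forall>k. k \<le> rank (\<nu> k) \<and> w k \<in> space M \<and> good (\<nu> k) (w k)) \<longrightarrow>
      (\<lambda>k. d (S (\<nu> k) (w k)) (Z z)) \<longlonglongrightarrow> 0 \<longrightarrow> (\<lambda>k. d' (X (\<nu> k) (w k)) (W z)) \<longlonglongrightarrow> 0"
    and g: "continuous_map (Metric_space.mtopology E' d') euclideanreal g" and K: "\<And>x. x \<in> E' \<Longrightarrow> \<bar>g x\<bar> \<le> K"
    and e: "0 < e"
  shows "eventually (\<lambda>n. (\<integral>z. g (W z) \<partial>N) - e < (\<integral>w. g (X n w) \<partial>M)) (filtercomap rank at_top)"
proof -
  interpret M: prob_space M by fact
  interpret N: prob_space N by fact
  interpret E: Metric_space E d by fact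
  interpret E': Metric_space E' d' by fact
  have S_in: "S n w \<in> E" if "w \<in> space M" for n w
    using measurable_space[OF S that] by (simp add: space_measure_of_conv)
  have X_in: "X n w \<in> E'" if "w \<in> space M" for n w
    using measurable_space[OF X that] by (simp add: space_measure_of_conv)
  have Z_in: "Z z \<in> E" if "z \<in> space N" for z
    using measurable_space[OF Z that] by (simp add: space_measure_of_conv)
  have W_in: "W z \<in> E'" if "z \<in> space N" for z
    using measurable_space[OF W that] by (simp add: space_measure_of_conv)
  \<comment> \<open>Inserting the bound \<open>K\<close> of \<open>g\<close> keeps the set nonempty and caps the envelope.\<close>
  define A where "A k x = insert K {g (X n w) + real k * d x (S n w) | n w.
    k \<le> rank n \<and> w \<in> space M \<and> good n w}" for k x
  define H where "H k x = Inf (A k x)" for k x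
  have A_lower: "-K \<le> a" if "a \<in> A k x" "x \<in> E" for a k x
  proof -
    have "0 \<le> K"
      using K[OF X_in] M.not_empty by (meson abs_ge_zero ex_in_conv order_trans)
    have "-K \<le> g (X n w) + real k * d x (S n w)" if "w \<in> space M" for n w
      using K[OF X_in[OF that], of n] E.nonneg[of x "S n w"] mult_nonneg_nonneg[of "real k" "d x (S n w)"]
      by linarith
    then show ?thesis
      using that \<open>0 \<le> K\<close> unfolding A_def by auto
  qed
  have A_bdd: "bdd_below (A k x)" if "x \<in> E" for k x
    using A_lower that by (intro bdd_belowI[of _ "-K"]) auto
  have H_lower: "-K \<le> H k x" if "x \<in> E" for k x
    unfolding H_def using A_lower that by (intro cInf_greatest) (auto simp: A_def)
  have H_upper: "H k x \<le> K" if "x \<in> E" for k x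
    unfolding H_def by (intro cInf_lower A_bdd that) (simp add: A_def)
  have H_Lip: "H k x \<le> H k y + real k * d x y" if xy: "x \<in> E" "y \<in> E" for k x y
  proof -
    have "H k x - real k * d x y \<le> a" if a: "a \<in> A k y" for a
    proof (cases "a = K")
      case True
      then show ?thesis
        using H_upper[OF xy(1), of k] mult_nonneg_nonneg[of "real k" "d x y"] E.nonneg[of x y] by linarith
    next
      case False
      then obtain n w where nw: "a = g (X n w) + real k * d y (S n w)" "k \<le> rank n" "w \<in> space M" "good n w"
        using a unfolding A_def by auto
      then have "H k x \<le> g (X n w) + real k * d x (S n w)"
        unfolding H_def using A_bdd[OF xy(1)] by (intro cInf_lower) (auto simp: A_def)
      moreover have "real k * d x (S n w) \<le> real k * (d x y + d y (S n w))"
        using E.triangle[OF xy S_in[OF nw(3)]] by (intro mult_left_mono) auto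
      ultimately show ?thesis
        unfolding nw(1) by (simp add: algebra_simps)
    qed
    then have "H k x - real k * d x y \<le> H k y"
      unfolding H_def[of k y] by (intro cInf_greatest) (auto simp: A_def)
    then show ?thesis by simp
  qed
  have H_cont: "continuous_map E.mtopology euclideanreal (H k)" for k
    by (rule E.continuous_map_Lipschitz_real) (rule H_Lip)
  have H_abs: "\<bar>H k x\<bar> \<le> K" if "x \<in> E" for k x
    using H_lower[OF that, of k] H_upper[OF that, of k] by linarith
  have H_bdd: "bounded (H k ` E)" for k
    unfolding bounded_iff using H_abs by auto
  have meas_S: "(\<lambda>w. H k (S n w)) \<in> borel_measurable M" for k n
    by (rule measurable_mtopology_borel[OF _ H_cont]) (use S in simp)
  have meas_Z: "(\<lambda>z. H k (Z z)) \<in> borel_measurable N" for k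
    by (rule measurable_mtopology_borel[OF _ H_cont]) (use Z in simp)
  have meas_X: "(\<lambda>w. g (X n w)) \<in> borel_measurable M" for n
    by (rule measurable_mtopology_borel[OF _ g]) (use X in simp)
  have meas_W: "(\<lambda>z. g (W z)) \<in> borel_measurable N"
    by (rule measurable_mtopology_borel[OF _ g]) (use W in simp)
  \<comment> \<open>At almost every limit point the envelopes recover at least the value of \<open>g\<close>.\<close>
  have lim: "AE z in N. (\<lambda>k. min (H k (Z z)) (g (W z))) \<longlonglongrightarrow> g (W z)"
    using path AE_space
  proof eventually_elim
    case (elim z)
    note z = elim(2)
    show ?case
      proof (rule LIMSEQ_I)
        fix \<delta> :: real
        assume \<delta>: "0 < \<delta>"
        have "\<exists>k0. \<forall>k\<ge>k0. g (W z) - \<delta> / 2 \<le> H k (Z z)"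
        proof (rule ccontr)
          assume "\<not> ?thesis"
          then have bad: "\<exists>k\<ge>k0. H k (Z z) < g (W z) - \<delta> / 2" for k0
            by (meson not_le)
          have "\<exists>n w. k0 \<le> rank n \<and> w \<in> space M \<and> good n w \<and>
              g (X n w) + real k0 * d (Z z) (S n w) < g (W z) - \<delta> / 2" for k0
          proof -
            obtain k where k: "k0 \<le> k" "H k (Z z) < g (W z) - \<delta> / 2"
              using bad by blast
            then obtain a where a: "a \<in> A k (Z z)" "a < g (W z) - \<delta> / 2"
              unfolding H_def using cInf_less_iff[OF _ A_bdd[OF Z_in[OF z]], of k] by (auto simp: A_def)
            have "a \<noteq> K"
              using a(2) K[OF W_in[OF z]] \<delta> by auto
            then obtain n w where nw: "a = g (X n w) + real k * d (Z z) (S n w)" "k \<le> rank n" "w \<in> space M" "good n w"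
              using a(1) unfolding A_def by auto
            have "real k0 * d (Z z) (S n w) \<le> real k * d (Z z) (S n w)"
              using k(1) by (intro mult_right_mono) auto
            then show ?thesis
              using nw k(1) a(2) by (intro exI[of _ n] exI[of _ w]) auto
          qed
          then obtain \<nu> w where \<nu>w: "\<And>k. k \<le> rank (\<nu> k)" "\<And>k. w k \<in> space M" "\<And>k. good (\<nu> k) (w k)"
            "\<And>k. g (X (\<nu> k) (w k)) + real k * d (Z z) (S (\<nu> k) (w k)) < g (W z) - \<delta> / 2"
            by metis
          have "d (S (\<nu> k) (w k)) (Z z) \<le> 2 * K * inverse (real k)" if "0 < k" for k
          proof -
            have "real k * d (Z z) (S (\<nu> k) (w k)) \<le> 2 * K"
              using \<nu>w(4)[of k] K[OF X_in[OF \<nu>w(2)], of "\<nu> k" k] K[OF W_in[OF z]] \<delta> by linarith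
            then show ?thesis
              using that by (simp add: E.commute field_simps)
          qed
          from this have "eventually (\<lambda>k. norm (d (S (\<nu> k) (w k)) (Z z)) \<le> 2 * K * inverse (real k)) sequentially"
            by (intro eventually_mono[OF eventually_gt_at_top[of 0]]) simp
          moreover have "(\<lambda>k. 2 * K * inverse (real k)) \<longlonglongrightarrow> 0"
            using tendsto_mult_right[OF lim_inverse_n, of "2 * K"] by (simp add: mult.commute)
          ultimately have "(\<lambda>k. d (S (\<nu> k) (w k)) (Z z)) \<longlonglongrightarrow> 0"
            by (rule Lim_null_comparison)
          then have "(\<lambda>k. d' (X (\<nu> k) (w k)) (W z)) \<longlonglongrightarrow> 0"
            using elim(1) \<nu>w(1-3) by blast
          then have "limitin E'.mtopology (\<lambda>k. X (\<nu> k) (w k)) (W z) sequentially"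
            using X_in \<nu>w(2) W_in[OF z] by (intro E'.limitin_sequentially_dist) auto
          from continuous_map_limit[OF g this]
          have "(\<lambda>k. g (X (\<nu> k) (w k))) \<longlonglongrightarrow> g (W z)"
            by (simp add: o_def)
          moreover have "g (X (\<nu> k) (w k)) \<le> g (W z) - \<delta> / 2" for k
            using \<nu>w(4)[of k] E.nonneg[of "Z z" "S (\<nu> k) (w k)"] mult_nonneg_nonneg[of "real k"] by (smt (verit) of_nat_0_le_iff)
          ultimately have "g (W z) \<le> g (W z) - \<delta> / 2"
            by (intro LIMSEQ_le_const2) auto
          then show False
            using \<delta> by simp
        qed
        then obtain k0 where "\<And>k. k0 \<le> k \<Longrightarrow> g (W z) - \<delta> / 2 \<le> H k (Z z)"
          by blast
        then show "\<exists>k0. \<forall>k\<ge>k0. norm (min (H k (Z z)) (g (W z)) - g (W z)) < \<delta>"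
          using \<delta> by (intro exI[of _ k0]) (force simp: min_def)
      qed
  qed
  have "(\<lambda>k. \<integral>z. min (H k (Z z)) (g (W z)) \<partial>N) \<longlonglongrightarrow> (\<integral>z. g (W z) \<partial>N)"
  proof (rule integral_dominated_convergence[where w = "\<lambda>_. K"])
    show "AE z in N. norm (min (H k (Z z)) (g (W z))) \<le> K" for k
      by (rule AE_I2) (use H_abs[OF Z_in] K[OF W_in] in \<open>auto simp: min_def\<close>)
  qed (use lim meas_Z meas_W in auto)
  then have "eventually (\<lambda>k. (\<integral>z. g (W z) \<partial>N) - e / 2 < (\<integral>z. min (H k (Z z)) (g (W z)) \<partial>N)) sequentially"
    using e by (intro order_tendstoD(1)) auto
  then obtain k where k: "(\<integral>z. g (W z) \<partial>N) - e / 2 < (\<integral>z. min (H k (Z z)) (g (W z)) \<partial>N)"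
    by (meson eventually_happens' sequentially_bot)
  have intZ: "integrable N (\<lambda>z. H k (Z z))" and intW: "integrable N (\<lambda>z. g (W z))"
    using meas_Z meas_W H_abs[OF Z_in] K[OF W_in]
    by (auto intro!: N.integrable_const_bound[where B = K] AE_I2)
  have "(\<integral>z. min (H k (Z z)) (g (W z)) \<partial>N) \<le> (\<integral>z. H k (Z z) \<partial>N)"
    using intZ intW by (intro integral_mono) auto
  with k have "(\<integral>z. g (W z) \<partial>N) - e / 2 < (\<integral>z. H k (Z z) \<partial>N)"
    by linarith
  then have "(\<integral>z. g (W z) \<partial>N) - e < (\<integral>z. H k (Z z) \<partial>N)"
    using e by linarith
  from order_tendstoD(1)[OF conv[OF H_cont H_bdd] this] eventually_filtercomap_at_top_ge[of k rank]
  show ?thesis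
  proof eventually_elim
    case (elim n)
    have "(\<integral>w. H k (S n w) \<partial>M) \<le> (\<integral>w. g (X n w) \<partial>M)"
    proof (rule integral_mono_AE)
      show "integrable M (\<lambda>w. H k (S n w))" "integrable M (\<lambda>w. g (X n w))"
        using meas_S meas_X H_abs[OF S_in] K[OF X_in]
        by (auto intro!: M.integrable_const_bound[where B = K] AE_I2)
      show "AE w in M. H k (S n w) \<le> g (X n w)"
        using good[of n] AE_space
      proof eventually_elim
        case (elim w)
        have "H k (S n w) \<le> g (X n w) + real k * d (S n w) (S n w)"
          unfolding H_def using A_bdd[OF S_in[OF elim(2)]] elim \<open>k \<le> rank n\<close>
          by (intro cInf_lower) (auto simp: A_def)
        then show ?case
          using S_in[OF elim(2)] by simp
      qed
    qed
    with elim(1) show ?case by linarith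
  qed
qed

text \<open>The hypothesis \<open>path\<close> stands for almost sure continuity of the mapping at the limit, where both the
  mapping and the argument vary with \<open>n\<close>. Applying the lower bound to \<open>- g\<close> gives the upper bound.\<close>

theorem extended_continuous_mapping:
  fixes rank :: "'i \<Rightarrow> nat"
  assumes M: "prob_space M" and N: "prob_space N"
    and E: "Metric_space E d" and E': "Metric_space E' d'"
    and S: "\<And>n. S n \<in> M \<rightarrow>\<^sub>M sigma E {U. openin (Metric_space.mtopology E d) U}"
    and X: "\<And>n. X n \<in> M \<rightarrow>\<^sub>M sigma E' {U. openin (Metric_space.mtopology E' d') U}"
    and Z: "Z \<in> N \<rightarrow>\<^sub>M sigma E {U. openin (Metric_space.mtopology E d) U}"
    and W: "W \<in> N \<rightarrow>\<^sub>M sigma E' {U. openin (Metric_space.mtopology E' d') U}"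
    and conv: "\<And>g. continuous_map (Metric_space.mtopology E d) euclideanreal g \<Longrightarrow> bounded (g ` E) \<Longrightarrow>
      ((\<lambda>n. \<integral>w. g (S n w) \<partial>M) \<longlongrightarrow> (\<integral>w. g (Z w) \<partial>N)) (filtercomap rank at_top)"
    and good: "\<And>n. AE w in M. good n w"
    and path: "AE z in N. \<forall>\<nu> w. (\<forall>k. k \<le> rank (\<nu> k) \<and> w k \<in> space M \<and> good (\<nu> k) (w k)) \<longrightarrow>
      (\<lambda>k. d (S (\<nu> k) (w k)) (Z z)) \<longlonglongrightarrow> 0 \<longrightarrow> (\<lambda>k. d' (X (\<nu> k) (w k)) (W z)) \<longlonglongrightarrow> 0"
    and g: "continuous_map (Metric_space.mtopology E' d') euclideanreal g" and bdd: "bounded (g ` E')"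
  shows "((\<lambda>n. \<integral>w. g (X n w) \<partial>M) \<longlongrightarrow> (\<integral>z. g (W z) \<partial>N)) (filtercomap rank at_top)"
proof -
  obtain K where K: "\<And>x. x \<in> E' \<Longrightarrow> \<bar>g x\<bar> \<le> K"
    using bdd unfolding bounded_iff by auto
  note bound = extended_mapping_lower_bound[OF M N E E' S X Z W conv good path]
  have neg: "continuous_map (Metric_space.mtopology E' d') euclideanreal (\<lambda>x. - g x)"
    using g by (rule continuous_map_minus)
  show ?thesis
  proof (rule order_tendstoI)
    fix a
    assume "a < (\<integral>z. g (W z) \<partial>N)"
    then show "eventually (\<lambda>n. a < (\<integral>w. g (X n w) \<partial>M)) (filtercomap rank at_top)"
      using bound[OF _ _ g, of K "(\<integral>z. g (W z) \<partial>N) - a"] K by simp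
  next
    fix a
    assume "(\<integral>z. g (W z) \<partial>N) < a"
    then show "eventually (\<lambda>n. (\<integral>w. g (X n w) \<partial>M) < a) (filtercomap rank at_top)"
      using bound[OF _ _ neg, of K "a - (\<integral>z. g (W z) \<partial>N)"] K by simp
  qed
qed

section \<open>Random step functions in the Skorohod space\<close>

lemma quadrant_subset: "quadrant a b R t \<subseteq> cbox a b"
  by (auto simp: quadrant_def)

lemma quadrant_nth:
  "s \<in> quadrant a b R t \<Longrightarrow> p \<in> R \<Longrightarrow> s$p < t$p"
  "s \<in> quadrant a b R t \<Longrightarrow> p \<notin> R \<Longrightarrow> t$p \<le> s$p"
  unfolding quadrant_def by (auto dest!: spec[of _ p])

text \<open>The regularity required of elements of the Skorohod space, for functions that may carry values
  outside the box.\<close>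

definition quadrant_regular :: "real^'q \<Rightarrow> real^'q \<Rightarrow> (real^'q \<Rightarrow> real) \<Rightarrow> bool" where
  "quadrant_regular a b g \<longleftrightarrow> (\<forall>t\<in>cbox a b.
     (\<forall>R. \<exists>L. (g \<longlongrightarrow> L) (at t within quadrant a b R t)) \<and> (g \<longlongrightarrow> g t) (at t within quadrant a b {} t))"

lemma restrict_in_skorohod_space:
  assumes "quadrant_regular a b g"
  shows "restrict g (cbox a b) \<in> skorohod_space a b"
proof -
  have "(restrict g (cbox a b) \<longlongrightarrow> L) (at t within quadrant a b R t)"
    if "(g \<longlongrightarrow> L) (at t within quadrant a b R t)" for L t R
    by (rule Lim_transform_eventually[OF that]) (use quadrant_subset[of a b R t] in \<open>auto simp: eventually_at_filter intro!: always_eventually\<close>)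
  then show ?thesis
    using assms unfolding skorohod_space_def quadrant_regular_def by (auto simp: extensional_def restrict_def) blast+
qed

lemma quadrant_regular_sum:
  assumes "\<And>i. i \<in> I \<Longrightarrow> quadrant_regular a b (g i)"
  shows "quadrant_regular a b (\<lambda>x. \<Sum>i\<in>I. c i * g i x)"
  unfolding quadrant_regular_def
proof (intro ballI conjI allI)
  fix t R
  assume t: "t \<in> cbox a b"
  have "\<forall>i\<in>I. \<exists>L. (g i \<longlongrightarrow> L) (at t within quadrant a b R t)"
    using assms t unfolding quadrant_regular_def by blast
  then obtain L where "\<And>i. i \<in> I \<Longrightarrow> (g i \<longlongrightarrow> L i) (at t within quadrant a b R t)"
    by metis
  then show "\<exists>L. ((\<lambda>x. \<Sum>i\<in>I. c i * g i x) \<longlongrightarrow> L) (at t within quadrant a b R t)"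
    by (intro exI[of _ "\<Sum>i\<in>I. c i * L i"] tendsto_sum tendsto_mult tendsto_const)
  show "((\<lambda>x. \<Sum>i\<in>I. c i * g i x) \<longlongrightarrow> (\<Sum>i\<in>I. c i * g i t)) (at t within quadrant a b {} t)"
    using assms t unfolding quadrant_regular_def by (intro tendsto_sum tendsto_mult tendsto_const) blast
qed

lemma quadrant_regular_continuous:
  assumes "continuous_on (cbox a b) g"
  shows "quadrant_regular a b g"
proof -
  have "(g \<longlongrightarrow> g t) (at t within quadrant a b R t)" if "t \<in> cbox a b" for t R
    using assms that tendsto_within_subset[OF _ quadrant_subset] unfolding continuous_on_def by blast
  then show ?thesis
    unfolding quadrant_regular_def by blast
qed

text \<open>A quadrant at \<open>t\<close> lies on one side of the hyperplane through \<open>t\<close> orthogonal to direction \<open>p\<close>, so the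
  jump condition is eventually constant along it. The half space where \<open>\<phi>\<close> is switched on
  contains its boundary, so the value at \<open>t\<close> agrees with the limit along the upper quadrant.\<close>

lemma quadrant_regular_step:
  fixes \<phi> :: "real^'q::finite \<Rightarrow> real"
  assumes "continuous_on (cbox a b) \<phi>"
  shows "quadrant_regular a b (\<lambda>x. if \<theta> \<le> x$p then \<phi> x else 0)"
  unfolding quadrant_regular_def
proof (intro ballI conjI allI)
  fix t R
  assume t: "t \<in> cbox a b"
  have \<phi>: "(\<phi> \<longlongrightarrow> \<phi> t) (at t within quadrant a b R t)" for R
    using assms t tendsto_within_subset[OF _ quadrant_subset] unfolding continuous_on_def by blast
  have coord: "((\<lambda>s. s$p) \<longlongrightarrow> t$p) (at t within quadrant a b R t)" for R
    by (intro tendsto_vec_nth tendsto_ident_at)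
  have in_quadrant: "eventually (\<lambda>s. s \<in> quadrant a b R t) (at t within quadrant a b R t)" for R
    by (simp add: eventually_at_filter)
  have case_on: "((\<lambda>x. if \<theta> \<le> x$p then \<phi> x else 0) \<longlongrightarrow> \<phi> t) (at t within quadrant a b R t)"
    if "eventually (\<lambda>s. \<theta> \<le> s$p) (at t within quadrant a b R t)" for R
  proof (rule Lim_transform_eventually[OF \<phi>])
    show "eventually (\<lambda>x. \<phi> x = (if \<theta> \<le> x$p then \<phi> x else 0)) (at t within quadrant a b R t)"
      using that by eventually_elim simp
  qed
  have case_off: "((\<lambda>x. if \<theta> \<le> x$p then \<phi> x else 0) \<longlongrightarrow> 0) (at t within quadrant a b R t)"
    if "eventually (\<lambda>s. s$p < \<theta>) (at t within quadrant a b R t)" for R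
  proof (rule tendsto_eventually)
    show "eventually (\<lambda>x. (if \<theta> \<le> x$p then \<phi> x else 0) = 0) (at t within quadrant a b R t)"
      using that by eventually_elim (simp add: not_le[symmetric])
  qed
  show "\<exists>L. ((\<lambda>x. if \<theta> \<le> x$p then \<phi> x else 0) \<longlongrightarrow> L) (at t within quadrant a b R t)"
  proof (cases "p \<in> R")
    case True
    show ?thesis
    proof (cases "\<theta> < t$p")
      case less: True
      from order_tendstoD(1)[OF coord less, of R]
      have "eventually (\<lambda>s. \<theta> \<le> s$p) (at t within quadrant a b R t)"
        by eventually_elim simp
      then show ?thesis
        using case_on by blast
    next
      case False
      have "eventually (\<lambda>s. s$p < \<theta>) (at t within quadrant a b R t)"
        using in_quadrant by eventually_elim (use True False quadrant_nth(1)[of _ a b R t p] in force)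
      then show ?thesis
        using case_off by blast
    qed
  next
    case False
    show ?thesis
    proof (cases "t$p < \<theta>")
      case less: True
      from order_tendstoD(2)[OF coord less, of R] show ?thesis
        using case_off by blast
    next
      case ge: False
      have "eventually (\<lambda>s. \<theta> \<le> s$p) (at t within quadrant a b R t)"
        using in_quadrant by eventually_elim (use False ge quadrant_nth(2)[of _ a b R t p] in force)
      then show ?thesis
        using case_on by blast
    qed
  qed
  show "((\<lambda>x. if \<theta> \<le> x$p then \<phi> x else 0) \<longlongrightarrow> (if \<theta> \<le> t$p then \<phi> t else 0)) (at t within quadrant a b {} t)"
  proof (cases "\<theta> \<le> t$p")
    case True
    have "eventually (\<lambda>s. \<theta> \<le> s$p) (at t within quadrant a b {} t)"
      using in_quadrant by eventually_elim (use True quadrant_nth(2)[of _ a b "{}" t p] in force)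
    then show ?thesis
      using case_on True by simp
  next
    case False
    then show ?thesis
      using case_off[of "{}"] order_tendstoD(2)[OF coord, of \<theta> "{}"] by simp
  qed
qed

lemma skorohod_dist_le_uniform:
  fixes a b :: "real^'q::finite"
  assumes "f \<in> skorohod_space a b" "g \<in> skorohod_space a b" "0 < e" "\<And>t. t \<in> cbox a b \<Longrightarrow> \<bar>f t - g t\<bar> \<le> e"
  shows "skorohod_dist a b f g \<le> e"
proof -
  have "skorohod_close a b e f g"
    unfolding skorohod_close_def using assms(3,4) by (intro exI[of _ "\<lambda>_ u. u"]) (simp add: time_change_id)
  then have "skorohod_dist a b f g < e'" if "e < e'" for e'
    using that assms(3) skorohod_dist_less[OF assms(1,2)] by blast
  then show ?thesis
    by (meson dense_ge less_imp_le)
qed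

lemma skorohod_dist_tendsto_uniform:
  fixes a b :: "real^'q::finite"
  assumes D: "\<And>k::nat. F k \<in> skorohod_space a b" "f \<in> skorohod_space a b"
    and lim: "uniform_limit (cbox a b) F f sequentially"
  shows "(\<lambda>k. skorohod_dist a b (F k) f) \<longlonglongrightarrow> 0"
proof (rule LIMSEQ_I)
  fix r :: real
  assume r: "0 < r"
  have "eventually (\<lambda>k. \<forall>t\<in>cbox a b. dist (F k t) (f t) < r / 2) sequentially"
    using lim half_gt_zero[OF r] unfolding uniform_limit_iff by blast
  then have "eventually (\<lambda>k. norm (skorohod_dist a b (F k) f - 0) < r) sequentially"
  proof eventually_elim
    case (elim k)
    have "skorohod_dist a b (F k) f \<le> r / 2"
      using elim r by (intro skorohod_dist_le_uniform D) (auto simp: dist_real_def less_imp_le)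
    then show ?case
      using skorohod_dist_nonneg[OF D(1)[of k] D(2)] r by simp
  qed
  then show "\<exists>k0. \<forall>k\<ge>k0. norm (skorohod_dist a b (F k) f - 0) < r"
    unfolding eventually_sequentially .
qed

text \<open>The time changes tend to the identity, and uniform continuity of the limit absorbs them.\<close>

lemma uniform_limit_skorohod:
  fixes a b :: "real^'q::finite"
  assumes D: "\<And>k::nat. F k \<in> skorohod_space a b" "f \<in> skorohod_space a b"
    and f: "continuous_on (cbox a b) f"
    and lim: "(\<lambda>k. skorohod_dist a b (F k) f) \<longlonglongrightarrow> 0"
  shows "uniform_limit (cbox a b) F f sequentially"
  unfolding uniform_limit_iff
proof (intro allI impI)
  fix e :: real
  assume e: "0 < e"
  have "uniformly_continuous_on (cbox a b) f"
    using f by (intro compact_uniformly_continuous) auto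
  then obtain d where d: "0 < d" "\<And>s t. s \<in> cbox a b \<Longrightarrow> t \<in> cbox a b \<Longrightarrow> dist t s < d \<Longrightarrow> dist (f t) (f s) < e / 2"
    unfolding uniformly_continuous_on_def using half_gt_zero[OF e] by metis
  define d' where "d' = min (e / 2) (d / (2 * real CARD('q)))"
  have d': "0 < d'"
    using e d(1) by (simp add: d'_def)
  have "eventually (\<lambda>k. skorohod_dist a b (F k) f < d') sequentially"
    using order_tendstoD(2)[OF lim d'] .
  then show "eventually (\<lambda>k. \<forall>t\<in>cbox a b. dist (F k t) (f t) < e) sequentially"
  proof eventually_elim
    case (elim k)
    then have "skorohod_close a b d' (F k) f"
      using skorohod_dist_less[OF D] skorohod_close_mono by (metis less_imp_le)
    then obtain \<theta> where \<theta>: "time_change a b \<theta>" "\<And>j u. u \<in> {a$j..b$j} \<Longrightarrow> \<bar>\<theta> j u - u\<bar> \<le> d'"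
      "\<And>t. t \<in> cbox a b \<Longrightarrow> \<bar>F k t - f (warp \<theta> t)\<bar> \<le> d'"
      unfolding skorohod_close_def by blast
    show ?case
    proof
      fix t
      assume t: "t \<in> cbox a b"
      have "dist (warp \<theta> t) t \<le> (\<Sum>j\<in>UNIV. \<bar>(warp \<theta> t - t)$j\<bar>)"
        unfolding dist_norm by (rule norm_le_l1_cart)
      also have "\<dots> \<le> (\<Sum>j\<in>(UNIV::'q set). d')"
        using \<theta>(2) t unfolding mem_box_coord by (intro sum_mono) simp
      also have "\<dots> \<le> (\<Sum>j\<in>(UNIV::'q set). d / (2 * real CARD('q)))"
        by (intro sum_mono) (simp add: d'_def)
      also have "\<dots> < d"
        using d(1) by simp
      finally have "dist (f (warp \<theta> t)) (f t) < e / 2"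
        by (intro d(2) t warp_in_cbox[OF \<theta>(1) t])
      moreover have "\<bar>F k t - f (warp \<theta> t)\<bar> \<le> e / 2"
        using \<theta>(3)[OF t] by (simp add: d'_def)
      ultimately show "dist (F k t) (f t) < e"
        using dist_triangle[of "F k t" "f t" "f (warp \<theta> t)"] by (simp add: dist_real_def)
    qed
  qed
qed

text \<open>The uniform distance dominates the Skorohod distance, so the path depends continuously on the vector
  of coefficients, which is a random element of a countable product of real lines.\<close>

lemma measurable_skorohod_sum:
  fixes a b :: "real^'q::finite" and c :: "'i::countable \<Rightarrow> 'w \<Rightarrow> real"
  assumes I: "finite I" and c: "\<And>i. i \<in> I \<Longrightarrow> c i \<in> borel_measurable M"
    and g: "\<And>i. i \<in> I \<Longrightarrow> quadrant_regular a b (g i)"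
  shows "(\<lambda>w. restrict (\<lambda>x. \<Sum>i\<in>I. c i w * g i x) (cbox a b)) \<in> M \<rightarrow>\<^sub>M skorohod_borel a b"
proof -
  interpret S: Metric_space "skorohod_space a b" "skorohod_dist a b"
    by (rule Metric_space_skorohod)
  define \<Psi> where "\<Psi> u = restrict (\<lambda>x. \<Sum>i\<in>I. u i * g i x) (cbox a b)" for u :: "'i \<Rightarrow> real"
  have \<Psi>_in: "\<Psi> u \<in> skorohod_space a b" for u
    unfolding \<Psi>_def using g by (intro restrict_in_skorohod_space quadrant_regular_sum)
  have "\<exists>K. \<forall>t\<in>cbox a b. \<bar>g i t\<bar> \<le> K" if "i \<in> I" for i
    using skorohod_space_bounded[OF restrict_in_skorohod_space[OF g[OF that]]] by (metis restrict_apply')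
  then obtain K where K: "\<And>i t. i \<in> I \<Longrightarrow> t \<in> cbox a b \<Longrightarrow> \<bar>g i t\<bar> \<le> K i"
    by metis
  have "\<Psi> \<in> borel \<rightarrow>\<^sub>M skorohod_borel a b"
    unfolding skorohod_borel_def
  proof (rule measurable_measure_of)
    show "{U. openin (skorohod_topology a b) U} \<subseteq> Pow (skorohod_space a b)"
      unfolding skorohod_topology_def using openin_subset by fastforce
    show "\<Psi> \<in> space borel \<rightarrow> skorohod_space a b"
      using \<Psi>_in by blast
    fix U
    assume "U \<in> {U. openin (skorohod_topology a b) U}"
    then have U: "openin S.mtopology U"
      by (simp add: skorohod_topology_def)
    have "open (\<Psi> -` U)"
      unfolding open_subopen[of "\<Psi> -` U"]
    proof
      fix u
      assume "u \<in> \<Psi> -` U"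
      then obtain r where r: "0 < r" "S.mball (\<Psi> u) r \<subseteq> U"
        using U unfolding S.openin_mtopology by blast
      let ?V = "{u' :: 'i \<Rightarrow> real. (\<Sum>i\<in>I. \<bar>u i - u' i\<bar> * \<bar>K i\<bar>) < r / 2}"
      have "open ?V"
        by (intro open_Collect_less continuous_intros continuous_on_product_coordinates)
      moreover have "u \<in> ?V"
        using r(1) by simp
      moreover have "?V \<subseteq> \<Psi> -` U"
      proof
        fix u'
        assume u': "u' \<in> ?V"
        have "skorohod_dist a b (\<Psi> u) (\<Psi> u') \<le> r / 2"
        proof (rule skorohod_dist_le_uniform[OF \<Psi>_in \<Psi>_in])
          show "0 < r / 2"
            using r(1) by simp
          fix t
          assume t: "t \<in> cbox a b"
          then have "\<bar>\<Psi> u t - \<Psi> u' t\<bar> = \<bar>\<Sum>i\<in>I. (u i - u' i) * g i t\<bar>"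
            by (simp add: \<Psi>_def sum_subtractf left_diff_distrib)
          also have "\<dots> \<le> (\<Sum>i\<in>I. \<bar>u i - u' i\<bar> * \<bar>K i\<bar>)"
          proof (rule order_trans[OF sum_abs], rule sum_mono)
            fix i
            assume "i \<in> I"
            from order_trans[OF K[OF this t] abs_ge_self]
            show "\<bar>(u i - u' i) * g i t\<bar> \<le> \<bar>u i - u' i\<bar> * \<bar>K i\<bar>"
              unfolding abs_mult by (rule mult_left_mono) simp
          qed
          finally show "\<bar>\<Psi> u t - \<Psi> u' t\<bar> \<le> r / 2"
            using u' by simp
        qed
        then show "u' \<in> \<Psi> -` U"
          using r \<Psi>_in unfolding S.mball_def by force
      qed
      ultimately show "\<exists>V. open V \<and> u \<in> V \<and> V \<subseteq> \<Psi> -` U"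
        by blast
    qed
    then show "\<Psi> -` U \<inter> space borel \<in> sets borel"
      by simp
  qed
  moreover have "(\<lambda>w i. if i \<in> I then c i w else 0) \<in> borel_measurable M"
  proof (rule measurable_coordinatewise_then_product)
    show "(\<lambda>w. if i \<in> I then c i w else 0) \<in> borel_measurable M" for i
      using c by (cases "i \<in> I") auto
  qed
  ultimately have "(\<lambda>w. \<Psi> (\<lambda>i. if i \<in> I then c i w else 0)) \<in> M \<rightarrow>\<^sub>M skorohod_borel a b"
    by (rule measurable_compose[rotated])
  moreover have "\<Psi> (\<lambda>i. if i \<in> I then c i w else 0) = restrict (\<lambda>x. \<Sum>i\<in>I. c i w * g i x) (cbox a b)" for w
    unfolding \<Psi>_def by (intro restrict_ext sum.cong) auto
  ultimately show ?thesis
    by simp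
qed

section \<open>The sinc kernel and its derivative\<close>

text \<open>The value at \<open>0\<close> is the one that makes the quotient continuous.\<close>

definition sinc_kernel_deriv :: "real \<Rightarrow> real \<Rightarrow> real" where
  "sinc_kernel_deriv w t = (if t = 0 then 0 else (w * t * cos (w * t) - sin (w * t)) / (pi * t\<^sup>2))"

lemma DERIV_sinc_kernel:
  assumes "0 < w"
  shows "(sinc_kernel w has_real_derivative sinc_kernel_deriv w t) (at t)"
proof (cases "t = 0")
  case True
  have "((\<lambda>h. (sin (w * h) - w * h) / h\<^sup>2) \<longlongrightarrow> 0) (at 0)"
    using assms by real_asymp
  from tendsto_mult_right[OF this, of "1 / pi"]
  have "((\<lambda>h. 1 / pi * ((sin (w * h) - w * h) / h\<^sup>2)) \<longlongrightarrow> 0) (at 0)"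
    by (simp add: mult.commute)
  then have "((\<lambda>h. (sinc_kernel w h - w / pi) / h) \<longlongrightarrow> 0) (at 0)"
    by (rule Lim_transform_eventually)
      (auto simp: sinc_kernel_def eventually_at_filter field_simps power2_eq_square)
  then show ?thesis
    using True by (simp add: DERIV_def sinc_kernel_deriv_def sinc_kernel_def)
next
  case False
  have "((\<lambda>t. sin (w * t) / (pi * t)) has_real_derivative sinc_kernel_deriv w t) (at t)"
    using False by (auto intro!: derivative_eq_intros simp: sinc_kernel_deriv_def power2_eq_square field_simps)
  then show ?thesis
    by (rule has_field_derivative_transform_within_open[of _ _ _ "- {0}"])
      (use False in \<open>auto simp: sinc_kernel_def\<close>)
qed

lemma isCont_sinc_kernel_deriv:
  assumes "0 < w"
  shows "isCont (sinc_kernel_deriv w) t"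
proof (cases "t = 0")
  case True
  have "((\<lambda>t. (w * t * cos (w * t) - sin (w * t)) / (pi * t\<^sup>2)) \<longlongrightarrow> 0) (at 0)"
    using assms by real_asymp
  then have "(sinc_kernel_deriv w \<longlongrightarrow> 0) (at 0)"
    by (rule Lim_transform_eventually) (auto simp: sinc_kernel_deriv_def eventually_at_filter)
  then show ?thesis
    using True by (simp add: isCont_def sinc_kernel_deriv_def)
next
  case False
  have "isCont (\<lambda>t. (w * t * cos (w * t) - sin (w * t)) / (pi * t\<^sup>2)) t"
    using False by (intro continuous_intros) auto
  moreover have "eventually (\<lambda>s. s \<noteq> 0) (nhds t)"
    using False by (simp add: t1_space_nhds)
  then have eq: "eventually (\<lambda>s. (w * s * cos (w * s) - sin (w * s)) / (pi * s\<^sup>2) = sinc_kernel_deriv w s) (nhds t)"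
    by (rule eventually_mono) (simp add: sinc_kernel_deriv_def)
  ultimately show ?thesis
    using isCont_cong[OF eq] by simp
qed

lemma isCont_sinc_kernel: "0 < w \<Longrightarrow> isCont (sinc_kernel w) t"
  using DERIV_sinc_kernel DERIV_isCont by blast

section \<open>Integrals over faces of a box\<close>

definition face :: "'q set \<Rightarrow> real^'q \<Rightarrow> ('q \<Rightarrow> real) \<Rightarrow> real^'q" where
  "face v b z = (\<chi> j. if j \<in> v then z j else b$j)"

text \<open>The variables in \<open>v\<close> run through the box below \<open>b\<close> and the others are frozen at \<open>b\<close>. Integration
  over the product of lines indexed by \<open>v\<close> treats the faces of all dimensions alike; for \<open>v = {}\<close> the
  measure is a point mass and the integral is \<open>h b\<close>.\<close>

definition face_integral ::
    "'q::finite set \<Rightarrow> real^'q \<Rightarrow> (real^'q \<Rightarrow> real) \<Rightarrow> ('q \<Rightarrow> real \<Rightarrow> real) \<Rightarrow> real" where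
  "face_integral v b h u =
     (\<integral>z. h (face v b z) * (\<Prod>j\<in>v. indicator {0..<b$j} (z j) * u j (z j)) \<partial>PiM v (\<lambda>_. lborel))"

interpretation lborels: product_sigma_finite "\<lambda>_::'q. lborel :: real measure"
  by standard

lemma sum_indicator_partition:
  fixes p :: "nat \<Rightarrow> real"
  assumes "\<And>i. i < m \<Longrightarrow> p i \<le> p (Suc i)"
  shows "(\<Sum>i<m. indicator {p i..<p (Suc i)} z) = (indicator {p 0..<p m} z :: real)"
  using assms
proof (induction m)
  case (Suc m)
  have le: "p i \<le> p (Suc i)" if "i \<le> m" for i
    using Suc.prems that by simp
  have "p 0 \<le> p k" if "k \<le> m" for k
    using that
  proof (induction k)
    case (Suc k)
    then show ?case
      using le[of k] by simp
  qed simp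
  then have "p 0 \<le> p m" "p m \<le> p (Suc m)"
    using Suc.prems by auto
  moreover have "(\<Sum>i<m. indicator {p i..<p (Suc i)} z) = (indicator {p 0..<p m} z :: real)"
    using Suc by simp
  ultimately show ?case
    unfolding sum.lessThan_Suc by (auto split: split_indicator)
qed simp

lemma
  fixes F f :: "real \<Rightarrow> real"
  assumes "x \<le> y" and F: "\<And>z. (F has_real_derivative f z) (at z)" and f: "\<And>z. isCont f z"
  shows integrable_FTC_Ico: "integrable lborel (\<lambda>z. indicator {x..<y} z * f z)"
    and integral_FTC_Ico: "(\<integral>z. indicator {x..<y} z * f z \<partial>lborel) = F y - F x"
proof -
  have [measurable]: "f \<in> borel_measurable borel"
    using f by (intro borel_measurable_continuous_onI continuous_at_imp_continuous_on) auto
  have 1: "has_bochner_integral lborel (\<lambda>z. f z * indicator {x..y} z) (F y - F x)"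
    using assms by (intro has_bochner_integral_FTC_Icc_real) auto
  have "AE z in lborel. f z * indicator {x..y} z = indicator {x..<y} z * f z"
    using AE_lborel_singleton[of y] by eventually_elim (auto simp: indicator_def)
  from has_bochner_integral_cong_AE[THEN iffD1, OF _ _ this 1]
  have "has_bochner_integral lborel (\<lambda>z. indicator {x..<y} z * f z) (F y - F x)"
    by simp
  then show "integrable lborel (\<lambda>z. indicator {x..<y} z * f z)"
    "(\<integral>z. indicator {x..<y} z * f z \<partial>lborel) = F y - F x"
    by (simp_all add: has_bochner_integral_iff)
qed

lemma measurable_face [measurable]:
  "face v (b :: real^'q::finite) \<in> borel_measurable (PiM v (\<lambda>_. lborel :: real measure))"
proof (subst borel_measurable_euclidean_space, intro ballI)
  fix i :: "real^'q"
  assume "i \<in> Basis"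
  then obtain j where i: "i = axis j 1"
    by (auto simp: Basis_vec_def)
  have "(\<lambda>z. if j \<in> v then z j else b$j) \<in> borel_measurable (PiM v (\<lambda>_. lborel :: real measure))"
    by (cases "j \<in> v") (auto intro: measurable_component_singleton simp: measurable_lborel1[symmetric] simp del: measurable_lborel1)
  then show "(\<lambda>z. face v b z \<bullet> i) \<in> borel_measurable (PiM v (\<lambda>_. lborel))"
    by (simp add: i inner_axis face_def)
qed

lemma face_in_box:
  assumes "b \<in> cbox 0 1" "\<And>j. j \<in> v \<Longrightarrow> 0 \<le> z j \<and> z j \<le> 1"
  shows "face v b z \<in> cbox 0 1"
  using assms by (auto simp: mem_box_cart face_def)

text \<open>Paths are controlled on the unit box only. Cutting \<open>h\<close> off outside the box makes it measurable on
  the whole space, and the indicators in the weight hide the difference.\<close>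

lemma face_integrand_eq:
  fixes h :: "real^'q::finite \<Rightarrow> real"
  assumes "b \<in> cbox 0 1"
  shows "h (face v b z) * (\<Prod>j\<in>v. indicator {0..<b$j} (z j) * u j (z j)) =
    (indicator (cbox 0 1) (face v b z) *\<^sub>R h (face v b z)) * (\<Prod>j\<in>v. indicator {0..<b$j} (z j) * u j (z j))"
proof (cases "\<forall>j\<in>v. z j \<in> {0..<b$j}")
  case True
  then have "0 \<le> z j \<and> z j \<le> 1" if "j \<in> v" for j
    using True[rule_format, OF that] assms order_trans[of "z j" "b$j" 1] by (simp add: mem_box_cart)
  then show ?thesis
    using face_in_box[OF assms, of v z] by simp
next
  case False
  then have "(\<Prod>j\<in>v. indicator {0..<b$j} (z j) * u j (z j)) = 0"
    by (intro prod_zero) (force simp: indicator_def)+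
  then show ?thesis by simp
qed

lemma measurable_face_integrand:
  fixes h :: "real^'q::finite \<Rightarrow> real"
  assumes "b \<in> cbox 0 1" "continuous_on (cbox 0 1) h" "\<And>j. u j \<in> borel_measurable borel"
  shows "(\<lambda>z. h (face v b z) * (\<Prod>j\<in>v. indicator {0..<b$j} (z j) * u j (z j)))
    \<in> borel_measurable (PiM v (\<lambda>_. lborel))"
proof -
  have [measurable]: "(\<lambda>x. indicator (cbox 0 1) x *\<^sub>R h x) \<in> borel_measurable borel"
    using assms(2) by (intro borel_measurable_continuous_on_indicator) auto
  have [measurable]: "(\<lambda>z. indicator {0..<b$j} (z j) * u j (z j)) \<in> borel_measurable (PiM v (\<lambda>_. lborel :: real measure))"
    if "j \<in> v" for j
  proof -
    have "(\<lambda>t. indicator {0..<b$j} t * u j t) \<in> borel_measurable lborel"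
      using assms(3) by measurable
    from measurable_compose[OF measurable_component_singleton[OF that] this] show ?thesis by simp
  qed
  have [measurable]: "(\<lambda>z. indicator (cbox 0 1) (face v b z) *\<^sub>R h (face v b z))
      \<in> borel_measurable (PiM v (\<lambda>_. lborel))"
    by (rule measurable_compose[OF measurable_face]) fact
  have "(\<lambda>z. (indicator (cbox 0 1) (face v b z) *\<^sub>R h (face v b z)) *
      (\<Prod>j\<in>v. indicator {0..<b$j} (z j) * u j (z j))) \<in> borel_measurable (PiM v (\<lambda>_. lborel))"
    by measurable
  then show ?thesis
    by (subst face_integrand_eq[OF assms(1)])
qed

lemma integrable_prod_indicator:
  fixes c :: "'q::finite \<Rightarrow> real"
  shows "integrable (PiM v (\<lambda>_. lborel)) (\<lambda>z. \<Prod>j\<in>v. indicator {0..<c j} (z j) * (K :: real))"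
    and "(\<And>j. 0 \<le> c j) \<Longrightarrow>
      (\<integral>z. (\<Prod>j\<in>v. indicator {0..<c j} (z j) * K) \<partial>PiM v (\<lambda>_. lborel)) = (\<Prod>j\<in>v. c j * K)"
proof -
  have int: "integrable lborel (\<lambda>t :: real. indicator {0..<c j} t * K)" for j
    by (intro integrable_mult_left integrable_real_indicator) (cases "0 \<le> c j"; simp)+
  show "integrable (PiM v (\<lambda>_. lborel)) (\<lambda>z. \<Prod>j\<in>v. indicator {0..<c j} (z j) * (K :: real))"
    using int by (intro lborels.product_integrable_prod) auto
  show "(\<integral>z. (\<Prod>j\<in>v. indicator {0..<c j} (z j) * K) \<partial>PiM v (\<lambda>_. lborel)) = (\<Prod>j\<in>v. c j * K)"
    if "\<And>j. 0 \<le> c j"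
    using int by (subst lborels.product_integral_prod) (use that in auto)
qed

lemma abs_prod_indicator_le:
  fixes u :: "'q \<Rightarrow> real \<Rightarrow> real" and z c :: "'q \<Rightarrow> real"
  assumes "\<And>j t. j \<in> v \<Longrightarrow> 0 \<le> t \<Longrightarrow> t \<le> 1 \<Longrightarrow> \<bar>u j t\<bar> \<le> K" "\<And>j. c j \<le> 1"
  shows "\<bar>\<Prod>j\<in>v. indicator {0..<c j} (z j) * u j (z j)\<bar> \<le> (\<Prod>j\<in>v. indicator {0..<c j} (z j) * K)"
  unfolding abs_prod
proof (rule prod_mono)
  fix j
  assume "j \<in> v"
  then show "0 \<le> \<bar>indicator {0..<c j} (z j) * u j (z j)\<bar> \<and>
    \<bar>indicator {0..<c j} (z j) * u j (z j)\<bar> \<le> indicator {0..<c j} (z j) * K"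
    using assms(1)[of j "z j"] assms(2)[of j] by (auto simp: indicator_def)
qed

lemma integrable_face_integrand:
  fixes h :: "real^'q::finite \<Rightarrow> real"
  assumes "b \<in> cbox 0 1" "continuous_on (cbox 0 1) h" "\<And>j. u j \<in> borel_measurable borel"
    and u: "\<And>j t. j \<in> v \<Longrightarrow> 0 \<le> t \<Longrightarrow> t \<le> 1 \<Longrightarrow> \<bar>u j t\<bar> \<le> K"
  shows "integrable (PiM v (\<lambda>_. lborel)) (\<lambda>z. h (face v b z) * (\<Prod>j\<in>v. indicator {0..<b$j} (z j) * u j (z j)))"
proof -
  have "bounded (h ` cbox 0 1)"
    using assms(2) by (intro compact_imp_bounded compact_continuous_image) auto
  then obtain L where L: "\<And>x. x \<in> cbox 0 1 \<Longrightarrow> \<bar>h x\<bar> \<le> L"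
    unfolding bounded_iff by auto
  have "integrable (PiM v (\<lambda>_. lborel)) (\<lambda>z. \<bar>L\<bar> * (\<Prod>j\<in>v. indicator {0..<b$j} (z j) * K))"
    by (intro integrable_mult_right integrable_prod_indicator(1))
  then show ?thesis
  proof (rule Bochner_Integration.integrable_bound[OF _ measurable_face_integrand[OF assms(1-3)] AE_I2])
    fix z
    have b: "b$j \<le> 1" for j
      using assms(1) by (simp add: mem_box_cart)
    have "\<bar>indicator (cbox 0 1) (face v b z) *\<^sub>R h (face v b z)\<bar> \<le> \<bar>L\<bar>"
      using L[of "face v b z"] by (auto simp: indicator_def)
    then have "\<bar>h (face v b z) * (\<Prod>j\<in>v. indicator {0..<b$j} (z j) * u j (z j))\<bar>
        \<le> \<bar>L\<bar> * (\<Prod>j\<in>v. indicator {0..<b$j} (z j) * K)"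
      unfolding face_integrand_eq[OF assms(1), of h v z u] abs_mult
      using abs_prod_indicator_le[of v u K "($) b" z] u b by (intro mult_mono) auto
    then show "norm (h (face v b z) * (\<Prod>j\<in>v. indicator {0..<b$j} (z j) * u j (z j)))
        \<le> norm (\<bar>L\<bar> * (\<Prod>j\<in>v. indicator {0..<b$j} (z j) * K))"
      by simp
  qed
qed

text \<open>The increments of \<open>\<alpha>\<close> are integrals of \<open>u\<close> over the cells, so a Riemann--Stieltjes sum is the integral
  of a step function. If the step function is within \<open>\<omega>\<close> of \<open>h\<close> on every cell, sum and integral
  differ by at most \<open>\<omega>\<close> times a bound for the total variation. This one estimate
  serves both for the existence of Riemann--Stieltjes integrals and for the lattice sums of the
  statistic, where \<open>T\<close> consists of partial sums.\<close>

lemma abs_riemann_sum_minus_face_integral_le: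
  fixes h :: "real^'q::finite \<Rightarrow> real" and \<alpha> u :: "'q \<Rightarrow> real \<Rightarrow> real"
  assumes b: "b \<in> cbox 0 1" and h: "continuous_on (cbox 0 1) h"
    and D: "\<And>j t. (\<alpha> j has_real_derivative u j t) (at t)" and cont: "\<And>j t. isCont (u j) t"
    and u: "\<And>j t. 0 \<le> t \<Longrightarrow> t \<le> 1 \<Longrightarrow> \<bar>u j t\<bar> \<le> K" and K: "0 \<le> K" and \<omega>: "0 \<le> \<omega>"
    and p: "\<And>j. j \<in> v \<Longrightarrow> p j 0 = 0 \<and> p j (m j) = b$j \<and> (\<forall>i<m j. p j i \<le> p j (Suc i))"
    and T: "\<And>k z. k \<in> cells v m \<Longrightarrow> (\<And>j. j \<in> v \<Longrightarrow> p j (k j) \<le> z j \<and> z j < p j (Suc (k j))) \<Longrightarrow>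
      \<bar>T k - h (face v b z)\<bar> \<le> \<omega>"
  shows "\<bar>(\<Sum>k\<in>cells v m. T k * (\<Prod>j\<in>v. \<alpha> j (p j (Suc (k j))) - \<alpha> j (p j (k j)))) - face_integral v b h u\<bar>
    \<le> \<omega> * K ^ card v"
proof -
  let ?P = "PiM v (\<lambda>_. lborel :: real measure)"
  define I where "I k z = (\<Prod>j\<in>v. indicator {p j (k j)..<p j (Suc (k j))} (z j) :: real)" for k z
  define U where "U z = (\<Prod>j\<in>v. u j (z j))" for z
  have b01: "0 \<le> b$j" "b$j \<le> 1" for j
    using b by (auto simp: mem_box_cart)
  have step: "p j (k j) \<le> p j (Suc (k j))" if "k \<in> cells v m" "j \<in> v" for k j
    using p[OF that(2)] that by (auto simp: cells_def PiE_iff)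
  have int: "integrable ?P (\<lambda>z. I k z * U z)"
    and integral: "(\<integral>z. I k z * U z \<partial>?P) = (\<Prod>j\<in>v. \<alpha> j (p j (Suc (k j))) - \<alpha> j (p j (k j)))"
    if k: "k \<in> cells v m" for k
  proof -
    have *: "(\<lambda>z. I k z * U z) = (\<lambda>z. \<Prod>j\<in>v. indicator {p j (k j)..<p j (Suc (k j))} (z j) * u j (z j))"
      unfolding I_def U_def by (simp add: prod.distrib)
    show "integrable ?P (\<lambda>z. I k z * U z)"
      unfolding * by (intro lborels.product_integrable_prod integrable_FTC_Ico[OF step[OF k] D cont]) simp
    show "(\<integral>z. I k z * U z \<partial>?P) = (\<Prod>j\<in>v. \<alpha> j (p j (Suc (k j))) - \<alpha> j (p j (k j)))"
      unfolding *
      by (subst lborels.product_integral_prod)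
        (auto intro!: integrable_FTC_Ico[OF step[OF k] D cont] prod.cong integral_FTC_Ico[OF step[OF k] D cont])
  qed
  have fin: "finite (cells v m)"
    unfolding cells_def by (intro finite_PiE) auto
  have I_sum: "(\<Sum>k\<in>cells v m. I k z) = (\<Prod>j\<in>v. indicator {0..<b$j} (z j))" for z
  proof -
    have "(\<Sum>k\<in>cells v m. I k z) = (\<Prod>j\<in>v. \<Sum>i<m j. indicator {p j i..<p j (Suc i)} (z j))"
      unfolding cells_def I_def by (rule prod_sum_PiE[symmetric]) auto
    also have "\<dots> = (\<Prod>j\<in>v. indicator {0..<b$j} (z j))"
      using p sum_indicator_partition by (intro prod.cong) auto
    finally show ?thesis .
  qed
  have int_T: "integrable ?P (\<lambda>z. \<Sum>k\<in>cells v m. T k * (I k z * U z))"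
    using int by (intro Bochner_Integration.integrable_sum integrable_mult_right) auto
  have int_h: "integrable ?P (\<lambda>z. h (face v b z) * (\<Prod>j\<in>v. indicator {0..<b$j} (z j) * u j (z j)))"
    using cont u by (intro integrable_face_integrand[OF b h, where K = K] borel_measurable_continuous_onI
      continuous_at_imp_continuous_on) auto
  have "(\<Sum>k\<in>cells v m. T k * (\<Prod>j\<in>v. \<alpha> j (p j (Suc (k j))) - \<alpha> j (p j (k j)))) =
      (\<integral>z. (\<Sum>k\<in>cells v m. T k * (I k z * U z)) \<partial>?P)"
    using int integral by (subst Bochner_Integration.integral_sum) auto
  then have "(\<Sum>k\<in>cells v m. T k * (\<Prod>j\<in>v. \<alpha> j (p j (Suc (k j))) - \<alpha> j (p j (k j)))) - face_integral v b h u =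
      (\<integral>z. (\<Sum>k\<in>cells v m. T k * (I k z * U z)) - h (face v b z) * (\<Prod>j\<in>v. indicator {0..<b$j} (z j) * u j (z j)) \<partial>?P)"
    unfolding face_integral_def using int_T int_h by simp
  also have "\<bar>\<dots>\<bar> \<le> (\<integral>z. \<omega> * (\<Prod>j\<in>v. indicator {0..<b$j} (z j) * K) \<partial>?P)"
  proof (rule order_trans[OF integral_abs_bound], rule integral_mono)
    show "integrable ?P (\<lambda>z. \<omega> * (\<Prod>j\<in>v. indicator {0..<b$j} (z j) * K))"
      by (intro integrable_mult_right integrable_prod_indicator(1))
    fix z
    have "(\<Sum>k\<in>cells v m. T k * (I k z * U z)) - h (face v b z) * (\<Prod>j\<in>v. indicator {0..<b$j} (z j) * u j (z j))
        = (\<Sum>k\<in>cells v m. (T k - h (face v b z)) * I k z) * U z"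
      unfolding prod.distrib I_sum[symmetric] U_def[symmetric]
      by (simp add: sum_distrib_right sum_distrib_left sum_subtractf algebra_simps)
    also have "\<bar>\<dots>\<bar> \<le> (\<Sum>k\<in>cells v m. \<omega> * I k z) * \<bar>U z\<bar>"
    proof -
      have "\<bar>(T k - h (face v b z)) * I k z\<bar> \<le> \<omega> * I k z" if "k \<in> cells v m" for k
      proof (cases "\<forall>j\<in>v. p j (k j) \<le> z j \<and> z j < p j (Suc (k j))")
        case True
        then have "I k z = 1"
          unfolding I_def by (intro prod.neutral) auto
        then show ?thesis
          using T[OF that, of z] True by simp
      next
        case False
        then have "I k z = 0"
          unfolding I_def by (intro prod_zero) (auto simp: indicator_def)
        then show ?thesis by simp
      qed
      then have "\<bar>\<Sum>k\<in>cells v m. (T k - h (face v b z)) * I k z\<bar> \<le> (\<Sum>k\<in>cells v m. \<omega> * I k z)"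
        by (intro order_trans[OF sum_abs] sum_mono)
      then show ?thesis
        unfolding abs_mult by (rule mult_right_mono) simp
    qed
    also have "\<dots> = \<omega> * \<bar>\<Prod>j\<in>v. indicator {0..<b$j} (z j) * u j (z j)\<bar>"
      unfolding sum_distrib_left[symmetric] I_sum prod.distrib U_def[symmetric]
      by (simp add: abs_mult abs_prod)
    also have "\<dots> \<le> \<omega> * (\<Prod>j\<in>v. indicator {0..<b$j} (z j) * K)"
      using abs_prod_indicator_le[of v u K "($) b" z] u b01 \<omega> by (intro mult_left_mono) auto
    finally show "\<bar>(\<Sum>k\<in>cells v m. T k * (I k z * U z)) - h (face v b z) * (\<Prod>j\<in>v. indicator {0..<b$j} (z j) * u j (z j))\<bar>
      \<le> \<omega> * (\<Prod>j\<in>v. indicator {0..<b$j} (z j) * K)" .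
  qed (use int_T int_h in auto)
  also have "\<dots> = \<omega> * (\<Prod>j\<in>v. b$j * K)"
    using b01 by (simp add: integrable_prod_indicator(2))
  also have "\<dots> \<le> \<omega> * (\<Prod>j\<in>v. K)"
    using b01 K \<omega> by (intro mult_left_mono prod_mono) (auto intro: mult_left_le_one_le)
  finally show ?thesis by simp
qed

lemma AE_PiM_lborel_neq:
  assumes "j \<in> v"
  shows "AE z in PiM (v :: 'q::finite set) (\<lambda>_. lborel). z j \<noteq> (c :: real)"
proof (rule AE_I)
  let ?A = "\<lambda>i. if i = j then {c} else (UNIV :: real set)"
  show "{z \<in> space (PiM v (\<lambda>_. lborel)). \<not> z j \<noteq> c} \<subseteq> PiE v ?A"
    by (auto simp: space_PiM PiE_iff extensional_def)
  have "emeasure (PiM v (\<lambda>_. lborel)) (PiE v ?A) = (\<Prod>i\<in>v. emeasure lborel (?A i))"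
    by (intro lborels.emeasure_PiM) auto
  also have "\<dots> = 0"
    using assms by (intro prod_zero) auto
  finally show "emeasure (PiM v (\<lambda>_. lborel)) (PiE v ?A) = 0" .
  show "PiE v ?A \<in> sets (PiM v (\<lambda>_. lborel))"
    by (intro sets_PiM_I_finite) auto
qed

text \<open>Dominated convergence. The indicator of \<open>[0, b\<^sub>j)\<close> converges except where \<open>z\<^sub>j\<close> equals the limit of
  \<open>b\<^sub>j\<close>, which is a null set.\<close>

lemma face_integral_tendsto:
  fixes h :: "real^'q::finite \<Rightarrow> real" and b :: "nat \<Rightarrow> real^'q"
  assumes b: "\<And>m. b m \<in> cbox 0 1" "b \<longlonglongrightarrow> b'" and h: "continuous_on (cbox 0 1) h"
    and cont: "\<And>m j. u m j \<in> borel_measurable borel" "\<And>j. u' j \<in> borel_measurable borel"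
    and u: "\<And>m j t. 0 \<le> t \<Longrightarrow> t \<le> 1 \<Longrightarrow> \<bar>u m j t\<bar> \<le> K"
    and lim: "\<And>j t. 0 \<le> t \<Longrightarrow> t \<le> 1 \<Longrightarrow> (\<lambda>m. u m j t) \<longlonglongrightarrow> u' j t"
  shows "(\<lambda>m. face_integral v (b m) h (u m)) \<longlonglongrightarrow> face_integral v b' h u'"
proof -
  let ?P = "PiM v (\<lambda>_. lborel :: real measure)"
  have b': "b' \<in> cbox 0 1"
    using closed_sequentially[OF closed_cbox b] .
  have "bounded (h ` cbox 0 1)"
    using h by (intro compact_imp_bounded compact_continuous_image) auto
  then obtain L where L: "\<And>x. x \<in> cbox 0 1 \<Longrightarrow> \<bar>h x\<bar> \<le> L"
    unfolding bounded_iff by auto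
  have K: "0 \<le> K"
    using order_trans[OF abs_ge_zero u[of 0]] by simp
  show ?thesis
    unfolding face_integral_def
  proof (rule integral_dominated_convergence)
    show "integrable ?P (\<lambda>z. \<bar>L\<bar> * (\<Prod>j\<in>v. indicator {0..<1} (z j) * K))"
      by (intro integrable_mult_right integrable_prod_indicator(1))
    show "(\<lambda>z. h (face v b' z) * (\<Prod>j\<in>v. indicator {0..<b'$j} (z j) * u' j (z j))) \<in> borel_measurable ?P"
      by (intro measurable_face_integrand b' h cont)
    show "(\<lambda>z. h (face v (b m) z) * (\<Prod>j\<in>v. indicator {0..<b m$j} (z j) * u m j (z j))) \<in> borel_measurable ?P" for m
      by (intro measurable_face_integrand b h cont)
    show "AE z in ?P. norm (h (face v (b m) z) * (\<Prod>j\<in>v. indicator {0..<b m$j} (z j) * u m j (z j)))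
        \<le> \<bar>L\<bar> * (\<Prod>j\<in>v. indicator {0..<1} (z j) * K)" for m
    proof (rule AE_I2)
      fix z
      have bm: "b m$j \<le> 1" for j
        using b(1)[of m] by (simp add: mem_box_cart)
      have 1: "\<bar>\<Prod>j\<in>v. indicator {0..<b m$j} (z j) * u m j (z j)\<bar> \<le> (\<Prod>j\<in>v. indicator {0..<1} (z j) * K)"
      proof (rule order_trans[OF abs_prod_indicator_le[of v "u m" K "($) (b m)" z]])
        show "(\<Prod>j\<in>v. indicator {0..<b m$j} (z j) * K) \<le> (\<Prod>j\<in>v. indicator {0..<1} (z j) * K)"
        proof (rule prod_mono)
          fix j
          show "0 \<le> indicator {0..<b m$j} (z j) * K \<and> indicator {0..<b m$j} (z j) * K \<le> indicator {0..<1} (z j) * K"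
            using K bm[of j] by (auto simp: indicator_def)
        qed
      qed (use u bm in auto)
      have "\<bar>indicator (cbox 0 1) (face v (b m) z) *\<^sub>R h (face v (b m) z)\<bar> \<le> \<bar>L\<bar>"
        using L[of "face v (b m) z"] by (auto simp: indicator_def)
      then show "norm (h (face v (b m) z) * (\<Prod>j\<in>v. indicator {0..<b m$j} (z j) * u m j (z j)))
          \<le> \<bar>L\<bar> * (\<Prod>j\<in>v. indicator {0..<1} (z j) * K)"
        unfolding face_integrand_eq[OF b(1), of h v m z "u m"] real_norm_def abs_mult
        using 1 by (intro mult_mono) auto
    qed
    have "AE z in ?P. \<forall>j\<in>v. z j \<noteq> b'$j"
      by (intro AE_finite_allI AE_PiM_lborel_neq) auto
    then show "AE z in ?P. (\<lambda>m. h (face v (b m) z) * (\<Prod>j\<in>v. indicator {0..<b m$j} (z j) * u m j (z j)))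
        \<longlonglongrightarrow> h (face v b' z) * (\<Prod>j\<in>v. indicator {0..<b'$j} (z j) * u' j (z j))"
    proof eventually_elim
      case (elim z)
      show ?case
      proof (cases "\<forall>j\<in>v. 0 \<le> z j \<and> z j \<le> 1")
        case True
        have "(\<lambda>m. face v (b m) z) \<longlonglongrightarrow> face v b' z"
          unfolding face_def
          by (intro vec_tendstoI) (use b(2) in \<open>auto intro: tendsto_vec_nth\<close>)
        then have "(\<lambda>m. h (face v (b m) z)) \<longlonglongrightarrow> h (face v b' z)"
          using True b(1) b' by (intro continuous_on_tendsto_compose[OF h] always_eventually) (auto intro: face_in_box)
        moreover have "(\<lambda>m. indicator {0..<b m$j} (z j) * u m j (z j)) \<longlonglongrightarrow> indicator {0..<b'$j} (z j) * u' j (z j)"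
          if j: "j \<in> v" for j
        proof (intro tendsto_mult)
          show "(\<lambda>m. u m j (z j)) \<longlonglongrightarrow> u' j (z j)"
            using True j lim by blast
          have bj: "(\<lambda>m. b m$j) \<longlonglongrightarrow> b'$j"
            using b(2) by (rule tendsto_vec_nth)
          show "(\<lambda>m. indicator {0..<b m$j} (z j)) \<longlonglongrightarrow> (indicator {0..<b'$j} (z j) :: real)"
          proof (cases "z j < b'$j")
            case less: True
            from order_tendstoD(1)[OF bj this]
            have "eventually (\<lambda>m. indicator {0..<b m$j} (z j) = (indicator {0..<b'$j} (z j) :: real)) sequentially"
              by eventually_elim (use less in \<open>auto simp: indicator_def\<close>)
            then show ?thesis
              by (rule tendsto_eventually)
          next
            case False
            then have "b'$j < z j"
              using elim j by force
            from order_tendstoD(2)[OF bj this]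
            have "eventually (\<lambda>m. indicator {0..<b m$j} (z j) = (indicator {0..<b'$j} (z j) :: real)) sequentially"
              by eventually_elim (use False in \<open>auto simp: indicator_def\<close>)
            then show ?thesis
              by (rule tendsto_eventually)
          qed
        qed
        ultimately show ?thesis
          by (rule tendsto_mult[OF _ tendsto_prod])
      next
        case False
        then obtain j where j: "j \<in> v" "\<not> (0 \<le> z j \<and> z j \<le> 1)" by blast
        have zero: "(\<Prod>j\<in>v. indicator {0..<c$j} (z j) * w j (z j)) = (0::real)" if "c \<in> cbox 0 1" for c :: "real^'q" and w
        proof (rule prod_zero)
          have "c$j \<le> 1"
            using that by (simp add: mem_box_cart)
          then have "indicator {0..<c$j} (z j) * w j (z j) = 0"
            using j(2) by (auto simp: indicator_def)
          then show "\<exists>j\<in>v. indicator {0..<c$j} (z j) * w j (z j) = 0"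
            using j(1) by blast
        qed simp
        show ?thesis
          unfolding zero[OF b(1)] zero[OF b'] by simp
      qed
    qed
  qed
qed

section \<open>Riemann--Stieltjes integrals against product functions\<close>

lemma continuous_on_box_modulus:
  fixes h :: "real^'q::finite \<Rightarrow> real"
  assumes "continuous_on (cbox 0 1) h" "0 < e"
  obtains d where "0 < d" "\<And>x y. x \<in> cbox 0 1 \<Longrightarrow> y \<in> cbox 0 1 \<Longrightarrow> (\<And>j. \<bar>x$j - y$j\<bar> < d) \<Longrightarrow> \<bar>h x - h y\<bar> < e"
proof -
  have "uniformly_continuous_on (cbox 0 1) h"
    using assms(1) by (intro compact_uniformly_continuous) auto
  then obtain d where d: "0 < d" "\<And>x y. x \<in> cbox 0 1 \<Longrightarrow> y \<in> cbox 0 1 \<Longrightarrow> dist y x < d \<Longrightarrow> dist (h y) (h x) < e"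
    unfolding uniformly_continuous_on_def using assms(2) by metis
  have "\<bar>h x - h y\<bar> < e"
    if xy: "x \<in> cbox 0 1" "y \<in> cbox 0 1" "\<And>j. \<bar>x$j - y$j\<bar> < d / real CARD('q)" for x y
  proof -
    have "dist x y \<le> (\<Sum>j\<in>UNIV. \<bar>(x - y)$j\<bar>)"
      unfolding dist_norm by (rule norm_le_l1_cart)
    also have "\<dots> < (\<Sum>j\<in>(UNIV::'q set). d / real CARD('q))"
      using xy(3) by (intro sum_strict_mono) auto
    also have "\<dots> = d" by simp
    finally show ?thesis
      using d(2)[OF xy(2,1)] by (simp add: dist_real_def)
  qed
  then show ?thesis
    using d(1) by (intro that[of "d / real CARD('q)"]) auto
qed

lemma partition_point_bounds:
  assumes "\<And>i. i < m \<Longrightarrow> p i < (p (Suc i) :: real)" "i \<le> m"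
  shows "p 0 \<le> p i \<and> p i \<le> p m"
proof
  have *: "p k \<le> p l" if "k \<le> l" "l \<le> m" for k l
    using that
  proof (induction l)
    case (Suc l)
    show ?case
    proof (cases "k = Suc l")
      case False
      then show ?thesis
        using Suc assms(1)[of l] by simp
    qed simp
  qed simp
  show "p 0 \<le> p i" "p i \<le> p m"
    using *[of 0 i] *[of i m] assms(2) by auto
qed

lemma cbox_0_subset: "b \<in> cbox 0 1 \<Longrightarrow> cbox 0 b \<subseteq> cbox 0 (1 :: real^'q::finite)"
  unfolding subset_iff mem_box_cart by (meson order_trans)

lemma cell_subset_box:
  fixes a b :: "real^'q::finite"
  assumes p: "product_partition v a b m p" and k: "k \<in> cells v m" and le: "\<And>j. j \<notin> v \<Longrightarrow> a$j \<le> b$j"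
  shows "cbox (cell_lower v b p k) (cell_upper v b p k) \<subseteq> cbox a b"
proof -
  have "a$j \<le> cell_lower v b p k $ j \<and> cell_upper v b p k $ j \<le> b$j" for j
  proof (cases "j \<in> v")
    case True
    then have "k j < m j"
      using k by (auto simp: cells_def PiE_iff)
    then show ?thesis
      using partition_point_bounds[of "m j" "p j" "k j"] partition_point_bounds[of "m j" "p j" "Suc (k j)"] p True
      by (auto simp: product_partition_def cell_lower_def cell_upper_def)
  next
    case False
    then show ?thesis
      using le by (simp add: cell_lower_def cell_upper_def)
  qed
  then show ?thesis
    unfolding subset_iff mem_box_cart by (meson order_trans)
qed

lemma has_rs_integral_unique:
  fixes a b :: "real^'q::finite"
  assumes I: "has_rs_integral v a b h g I" and J: "has_rs_integral v a b h g J"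
    and ab: "\<And>j. j \<in> v \<Longrightarrow> a$j < b$j"
  shows "I = J"
proof (rule ccontr)
  assume "I \<noteq> J"
  then have e: "0 < \<bar>I - J\<bar> / 2" by simp
  from I[unfolded has_rs_integral_def, THEN spec, THEN mp, OF e] obtain d1 where d1: "0 < d1"
    and approx1: "\<forall>m p \<xi>. product_partition v a b m p \<longrightarrow> (\<forall>j\<in>v. \<forall>i<m j. p j (Suc i) - p j i < d1) \<longrightarrow>
      (\<forall>k\<in>cells v m. \<xi> k \<in> cbox (cell_lower v b p k) (cell_upper v b p k)) \<longrightarrow>
      \<bar>(\<Sum>k\<in>cells v m. h (\<xi> k) * alt_sum v g (cell_lower v b p k) (cell_upper v b p k)) - I\<bar> < \<bar>I - J\<bar> / 2"
    by (elim exE conjE)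
  from J[unfolded has_rs_integral_def, THEN spec, THEN mp, OF e] obtain d2 where d2: "0 < d2"
    and approx2: "\<forall>m p \<xi>. product_partition v a b m p \<longrightarrow> (\<forall>j\<in>v. \<forall>i<m j. p j (Suc i) - p j i < d2) \<longrightarrow>
      (\<forall>k\<in>cells v m. \<xi> k \<in> cbox (cell_lower v b p k) (cell_upper v b p k)) \<longrightarrow>
      \<bar>(\<Sum>k\<in>cells v m. h (\<xi> k) * alt_sum v g (cell_lower v b p k) (cell_upper v b p k)) - J\<bar> < \<bar>I - J\<bar> / 2"
    by (elim exE conjE)
  \<comment> \<open>One equidistant partition is fine enough for both values.\<close>
  define L where "L = (\<Sum>j\<in>UNIV. \<bar>b$j - a$j\<bar>)"
  obtain r :: nat where r: "L / min d1 d2 < real r"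
    using reals_Archimedean2 by blast
  have "0 \<le> L"
    unfolding L_def by (intro sum_nonneg) simp
  then have r0: "0 < real r"
    using r d1(1) d2(1) by (intro le_less_trans[OF _ r] divide_nonneg_pos) auto
  define p where "p j i = a$j + (b$j - a$j) * real i / real r" for j i
  have gap: "p j (Suc i) - p j i = (b$j - a$j) / real r" for j i
    using r0 by (simp add: p_def field_simps)
  have fine: "p j (Suc i) - p j i < min d1 d2" for j i
  proof -
    have "b$j - a$j \<le> L"
      unfolding L_def by (rule order_trans[OF abs_ge_self]) (rule member_le_sum, auto)
    also have "L < real r * min d1 d2"
      using r d1(1) d2(1) by (simp add: pos_divide_less_eq)
    finally show ?thesis
      unfolding gap pos_divide_less_eq[OF r0] by (simp only: mult.commute)
  qed
  have part: "product_partition v a b (\<lambda>_. r) p"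
    unfolding product_partition_def
  proof (intro ballI conjI allI impI)
    fix j i
    assume "j \<in> v"
    then have "0 < (b$j - a$j) / real r"
      using ab r0 by simp
    then show "p j i < p j (Suc i)"
      using gap[of j i] by linarith
    show "p j 0 = a$j" "p j r = b$j"
      using r0 by (auto simp: p_def)
  qed
  have lower: "\<forall>k\<in>cells v (\<lambda>_. r). cell_lower v b p k \<in> cbox (cell_lower v b p k) (cell_upper v b p k)"
  proof
    fix k
    have "p j (k j) \<le> p j (Suc (k j))" if "j \<in> v" for j
      using gap[of j "k j"] ab[OF that] r0 by (smt (verit) divide_pos_pos)
    then show "cell_lower v b p k \<in> cbox (cell_lower v b p k) (cell_upper v b p k)"
      by (auto simp: mem_box_cart cell_lower_def cell_upper_def)
  qed
  let ?S = "\<Sum>k\<in>cells v (\<lambda>_. r). h (cell_lower v b p k) * alt_sum v g (cell_lower v b p k) (cell_upper v b p k)"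
  have "\<bar>?S - I\<bar> < \<bar>I - J\<bar> / 2"
    by (rule approx1[THEN spec, THEN spec, THEN spec, THEN mp, THEN mp, THEN mp, OF part _ lower]) (use fine in simp)
  moreover have "\<bar>?S - J\<bar> < \<bar>I - J\<bar> / 2"
    by (rule approx2[THEN spec, THEN spec, THEN spec, THEN mp, THEN mp, THEN mp, OF part _ lower]) (use fine in simp)
  moreover have "\<bar>I - J\<bar> \<le> \<bar>?S - J\<bar> + \<bar>?S - I\<bar>"
    using abs_triangle_ineq4[of "?S - J" "?S - I"] by simp
  moreover have False if "x < z / 2" "y < z / 2" "z \<le> y + x" for x y z :: real
    using that by linarith
  ultimately show False
    by blast
qed

lemma rs_integral_eqI:
  fixes a b :: "real^'q::finite"
  assumes "has_rs_integral v a b h g I" "\<And>j. j \<in> v \<Longrightarrow> a$j < b$j"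
  shows "rs_integral v a b h g = I"
  unfolding rs_integral_def using assms has_rs_integral_unique by blast

text \<open>An alternating sum over corners of a product function is an expanded product of differences.\<close>

lemma alt_sum_prod:
  fixes \<alpha> :: "'q::finite \<Rightarrow> real \<Rightarrow> real"
  assumes "\<And>j. j \<notin> v \<Longrightarrow> y$j = b$j"
  shows "alt_sum v (\<lambda>z. \<Prod>j\<in>UNIV. \<alpha> j (z$j)) x y =
    (\<Prod>j\<in>v. \<alpha> j (y$j) - \<alpha> j (x$j)) * (\<Prod>j\<in>-v. \<alpha> j (b$j))"
proof -
  have "(\<Prod>j\<in>UNIV. \<alpha> j (glue w x y $ j)) =
      (\<Prod>j\<in>w. \<alpha> j (x$j)) * (\<Prod>j\<in>v - w. \<alpha> j (y$j)) * (\<Prod>j\<in>-v. \<alpha> j (b$j))" if "w \<subseteq> v" for w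
  proof -
    have "UNIV = w \<union> ((v - w) \<union> -v)" "w \<inter> ((v - w) \<union> -v) = {}" "(v - w) \<inter> -v = {}"
      using that by auto
    then have "(\<Prod>j\<in>UNIV. \<alpha> j (glue w x y $ j)) =
      (\<Prod>j\<in>w. \<alpha> j (glue w x y $ j)) * ((\<Prod>j\<in>v - w. \<alpha> j (glue w x y $ j)) * (\<Prod>j\<in>-v. \<alpha> j (glue w x y $ j)))"
      by (metis (no_types, lifting) finite prod.union_disjoint)
    moreover have "(\<Prod>j\<in>-v. \<alpha> j (glue w x y $ j)) = (\<Prod>j\<in>-v. \<alpha> j (b$j))"
      using that assms by (intro prod.cong) (auto simp: glue_def)
    ultimately show ?thesis
      by (simp add: glue_def)
  qed
  then show ?thesis
    unfolding alt_sum_def prod_diff_conv_sum[OF finite] sum_distrib_right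
    by (intro sum.cong) auto
qed

text \<open>The mesh is chosen from the modulus of continuity of \<open>h\<close>, and the estimate for Riemann sums gives
  existence and value of the integral at the same time.\<close>

lemma has_rs_integral_prod:
  fixes h :: "real^'q::finite \<Rightarrow> real" and \<alpha> u :: "'q \<Rightarrow> real \<Rightarrow> real"
  assumes b: "b \<in> cbox 0 1" and h: "continuous_on (cbox 0 1) h"
    and D: "\<And>j t. (\<alpha> j has_real_derivative u j t) (at t)" and cont: "\<And>j t. isCont (u j) t"
  shows "has_rs_integral v 0 b h (\<lambda>z. \<Prod>j\<in>UNIV. \<alpha> j (z$j)) (face_integral v b h u * (\<Prod>j\<in>-v. \<alpha> j (b$j)))"
  unfolding has_rs_integral_def
proof (intro allI impI)
  fix e :: real
  assume e: "0 < e"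
  define C where "C = \<bar>\<Prod>j\<in>-v. \<alpha> j (b$j)\<bar>"
  have "\<exists>K. \<forall>t\<in>{0..1}. \<bar>u j t\<bar> \<le> K" for j
  proof -
    have "bounded (u j ` {0..1})"
      using cont by (intro compact_imp_bounded compact_continuous_image continuous_at_imp_continuous_on) auto
    then show ?thesis
      unfolding bounded_iff by auto
  qed
  then obtain K' where K': "\<And>j t. 0 \<le> t \<Longrightarrow> t \<le> 1 \<Longrightarrow> \<bar>u j t\<bar> \<le> K' j"
    by (metis atLeastAtMost_iff)
  define K where "K = (\<Sum>j\<in>UNIV. \<bar>K' j\<bar>)"
  have K: "\<bar>u j t\<bar> \<le> K" if "0 \<le> t" "t \<le> 1" for j t
  proof -
    have "K' j \<le> K"
      unfolding K_def by (rule order_trans[OF abs_ge_self]) (rule member_le_sum, auto)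
    then show ?thesis
      using K'[OF that, of j] by linarith
  qed
  have K0: "0 \<le> K"
    unfolding K_def by (intro sum_nonneg) simp
  define \<omega> where "\<omega> = e / (K ^ card v * C + 1)"
  have KC: "0 \<le> K ^ card v * C"
    using K0 by (simp add: C_def)
  have \<omega>: "0 < \<omega>"
    unfolding \<omega>_def using e KC by (intro divide_pos_pos) auto
  obtain d where d: "0 < d" "\<And>x y. x \<in> cbox 0 1 \<Longrightarrow> y \<in> cbox 0 1 \<Longrightarrow> (\<And>j. \<bar>x$j - y$j\<bar> < d) \<Longrightarrow> \<bar>h x - h y\<bar> < \<omega>"
    using continuous_on_box_modulus[OF h \<omega>] by blast
  show "\<exists>d>0. \<forall>m p \<xi>. product_partition v 0 b m p \<longrightarrow>
      (\<forall>j\<in>v. \<forall>i<m j. p j (Suc i) - p j i < d) \<longrightarrow>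
      (\<forall>k\<in>cells v m. \<xi> k \<in> cbox (cell_lower v b p k) (cell_upper v b p k)) \<longrightarrow>
      \<bar>(\<Sum>k\<in>cells v m. h (\<xi> k) * alt_sum v (\<lambda>z. \<Prod>j\<in>UNIV. \<alpha> j (z$j)) (cell_lower v b p k) (cell_upper v b p k))
        - face_integral v b h u * (\<Prod>j\<in>-v. \<alpha> j (b$j))\<bar> < e"
  proof (intro exI[of _ d] conjI d(1) allI impI)
    fix m p \<xi>
    assume p: "product_partition v 0 b m p" and mesh: "\<forall>j\<in>v. \<forall>i<m j. p j (Suc i) - p j i < d"
      and \<xi>: "\<forall>k\<in>cells v m. \<xi> k \<in> cbox (cell_lower v b p k) (cell_upper v b p k)"
    have b0: "0 $ j \<le> b$j" for j
      using b by (simp add: mem_box_cart)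
    have sub: "cbox (cell_lower v b p k) (cell_upper v b p k) \<subseteq> cbox 0 1" if "k \<in> cells v m" for k
      using cell_subset_box[OF p that b0] cbox_0_subset[OF b] by blast
    have close: "\<bar>h (\<xi> k) - h (face v b z)\<bar> \<le> \<omega>"
      if k: "k \<in> cells v m" and z: "\<And>j. j \<in> v \<Longrightarrow> p j (k j) \<le> z j \<and> z j < p j (Suc (k j))" for k z
    proof (rule less_imp_le, rule d(2))
      have F: "face v b z \<in> cbox (cell_lower v b p k) (cell_upper v b p k)"
        using z by (auto simp: mem_box_cart cell_lower_def cell_upper_def face_def less_imp_le)
      show "face v b z \<in> cbox 0 1" "\<xi> k \<in> cbox 0 1"
        using sub[OF k] F \<xi> k by blast+
      fix j
      have "cell_lower v b p k $ j \<le> \<xi> k $ j \<and> \<xi> k $ j \<le> cell_upper v b p k $ j"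
        "cell_lower v b p k $ j \<le> face v b z $ j \<and> face v b z $ j \<le> cell_upper v b p k $ j"
        using \<xi> k F by (auto simp: mem_box_cart)
      moreover have "cell_upper v b p k $ j - cell_lower v b p k $ j < d"
        using mesh k d(1) by (auto simp: cell_lower_def cell_upper_def cells_def PiE_iff)
      ultimately show "\<bar>\<xi> k $ j - face v b z $ j\<bar> < d"
        by linarith
    qed
    have "\<bar>(\<Sum>k\<in>cells v m. h (\<xi> k) * (\<Prod>j\<in>v. \<alpha> j (p j (Suc (k j))) - \<alpha> j (p j (k j)))) - face_integral v b h u\<bar>
        \<le> \<omega> * K ^ card v"
    proof (rule abs_riemann_sum_minus_face_integral_le[OF b h D cont K K0 less_imp_le[OF \<omega>] _ close])
      show "p j 0 = 0 \<and> p j (m j) = b$j \<and> (\<forall>i<m j. p j i \<le> p j (Suc i))" if "j \<in> v" for j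
        using p that by (simp add: product_partition_def less_imp_le)
    qed
    then have "\<bar>(\<Sum>k\<in>cells v m. h (\<xi> k) * (\<Prod>j\<in>v. \<alpha> j (p j (Suc (k j))) - \<alpha> j (p j (k j)))) - face_integral v b h u\<bar> * C
        \<le> \<omega> * K ^ card v * C"
      by (rule mult_right_mono) (simp add: C_def)
    also have "\<dots> < e"
      unfolding \<omega>_def using KC e by (simp add: field_simps)
    also have "\<bar>(\<Sum>k\<in>cells v m. h (\<xi> k) * (\<Prod>j\<in>v. \<alpha> j (p j (Suc (k j))) - \<alpha> j (p j (k j)))) - face_integral v b h u\<bar> * C
      = \<bar>(\<Sum>k\<in>cells v m. h (\<xi> k) * alt_sum v (\<lambda>z. \<Prod>j\<in>UNIV. \<alpha> j (z$j)) (cell_lower v b p k) (cell_upper v b p k))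
        - face_integral v b h u * (\<Prod>j\<in>-v. \<alpha> j (b$j))\<bar>"
    proof -
      have "alt_sum v (\<lambda>z. \<Prod>j\<in>UNIV. \<alpha> j (z$j)) (cell_lower v b p k) (cell_upper v b p k) =
        (\<Prod>j\<in>v. \<alpha> j (p j (Suc (k j))) - \<alpha> j (p j (k j))) * (\<Prod>j\<in>-v. \<alpha> j (b$j))" for k
        by (subst alt_sum_prod[where b = b]) (auto simp: cell_lower_def cell_upper_def)
      then show ?thesis
        unfolding C_def abs_mult[symmetric] by (simp add: left_diff_distrib sum_distrib_right mult.assoc)
    qed
    finally show "\<bar>(\<Sum>k\<in>cells v m. h (\<xi> k) * alt_sum v (\<lambda>z. \<Prod>j\<in>UNIV. \<alpha> j (z$j)) (cell_lower v b p k) (cell_upper v b p k))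
        - face_integral v b h u * (\<Prod>j\<in>-v. \<alpha> j (b$j))\<bar> < e" .
  qed
qed

text \<open>Integration by parts against the product of the \<open>\<alpha> j\<close>: the summand for \<open>v\<close> carries the differential
  in the directions of \<open>v\<close> and boundary values in the others.\<close>

definition ibp_faces ::
    "real^'q::finite \<Rightarrow> (real^'q \<Rightarrow> real) \<Rightarrow> ('q \<Rightarrow> real \<Rightarrow> real) \<Rightarrow> ('q \<Rightarrow> real \<Rightarrow> real) \<Rightarrow> real" where
  "ibp_faces b h \<alpha> u =
     (\<Sum>v\<in>UNIV. (-1) ^ card v * (face_integral v b h u * (\<Prod>j\<in>-v. \<alpha> j (b$j))))"

text \<open>As \<open>h\<close> vanishes on the lower faces, every term frozen at \<open>0\<close> in some direction drops out. The boundary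
  term becomes the summand for the empty set, and the integral over the whole box the one for \<open>UNIV\<close>.\<close>

lemma ibp_integral_prod:
  fixes h :: "real^'q::finite \<Rightarrow> real" and \<alpha> u :: "'q \<Rightarrow> real \<Rightarrow> real"
  assumes b: "b \<in> cbox 0 1" "\<And>j. 0 < b$j" and h: "continuous_on (cbox 0 1) h"
    and h0: "\<And>z j. z \<in> cbox 0 1 \<Longrightarrow> z$j = 0 \<Longrightarrow> h z = 0"
    and D: "\<And>j t. (\<alpha> j has_real_derivative u j t) (at t)" and cont: "\<And>j t. isCont (u j) t"
  shows "ibp_integral 0 b (\<lambda>z. \<Prod>j\<in>UNIV. \<alpha> j (z$j)) h = ibp_faces b h \<alpha> u"
proof -
  let ?g = "\<lambda>z :: real^'q. \<Prod>j\<in>UNIV. \<alpha> j (z$j)"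
  let ?R = "\<lambda>v. face_integral v b h u * (\<Prod>j\<in>-v. \<alpha> j (b$j))"
  have rs: "rs_integral v 0 b h ?g = ?R v" for v
    using b by (intro rs_integral_eqI has_rs_integral_prod h D cont) auto
  have glue_box: "glue w 0 b \<in> cbox 0 1" for w
    using b(1) by (auto simp: mem_box_cart glue_def)
  have rs0: "rs_integral v 0 (glue w 0 b) h ?g = 0" if w: "w \<subseteq> -v" "w \<noteq> {}" for v w
  proof (rule rs_integral_eqI)
    obtain j where j: "j \<in> w" "j \<notin> v"
      using w by blast
    show "has_rs_integral v 0 (glue w 0 b) h ?g 0"
      unfolding has_rs_integral_def
    proof (intro allI impI exI[of _ 1] conjI)
      fix e :: real and m p \<xi>
      assume e: "0 < e" and p: "product_partition v 0 (glue w 0 b) m p"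
        and \<xi>: "\<forall>k\<in>cells v m. \<xi> k \<in> cbox (cell_lower v (glue w 0 b) p k) (cell_upper v (glue w 0 b) p k)"
      have "h (\<xi> k) = 0" if k: "k \<in> cells v m" for k
      proof (rule h0)
        have "cbox (cell_lower v (glue w 0 b) p k) (cell_upper v (glue w 0 b) p k) \<subseteq> cbox 0 (glue w 0 b)"
          using glue_box[of w] by (intro cell_subset_box[OF p k]) (simp add: mem_box_cart)
        also have "\<dots> \<subseteq> cbox 0 1"
          by (rule cbox_0_subset[OF glue_box])
        finally show "\<xi> k \<in> cbox 0 1"
          using \<xi> k by blast
        have "\<xi> k \<in> cbox (cell_lower v (glue w 0 b) p k) (cell_upper v (glue w 0 b) p k)"
          using \<xi> k by blast
        then have "cell_lower v (glue w 0 b) p k $ j \<le> \<xi> k $ j \<and> \<xi> k $ j \<le> cell_upper v (glue w 0 b) p k $ j"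
          by (simp add: mem_box_cart)
        then show "\<xi> k $ j = 0"
          using j by (simp add: cell_lower_def cell_upper_def glue_def)
      qed
      then show "\<bar>(\<Sum>k\<in>cells v m. h (\<xi> k) * alt_sum v ?g (cell_lower v (glue w 0 b) p k)
          (cell_upper v (glue w 0 b) p k)) - 0\<bar> < e"
        using e by simp
    qed simp
    show "0 $ j < glue w 0 b $ j" if "j \<in> v" for j
      using that w b(2) by (auto simp: glue_def)
  qed
  have "(\<Sum>w\<in>Pow (-v). (-1) ^ card w * rs_integral v 0 (glue w 0 b) h ?g) = ?R v" for v
  proof -
    have "(\<Sum>w\<in>Pow (-v). (-1) ^ card w * rs_integral v 0 (glue w 0 b) h ?g) =
        (\<Sum>w\<in>{{}}. (-1) ^ card w * rs_integral v 0 (glue w 0 b) h ?g)"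
      by (rule sum.mono_neutral_right) (auto simp: rs0)
    moreover have "glue {} 0 b = b"
      by (simp add: glue_def)
    ultimately show ?thesis
      by (simp add: rs)
  qed
  moreover have "alt_sum UNIV (\<lambda>x. h x * ?g x) 0 b = ?R {}"
  proof -
    have zero: "h (glue w 0 b) = 0" if w: "w \<noteq> {}" for w
    proof -
      obtain j where "j \<in> w"
        using w by blast
      then show ?thesis
        by (intro h0[of _ j] glue_box) (simp add: glue_def)
    qed
    have "alt_sum UNIV (\<lambda>x. h x * ?g x) 0 b = (\<Sum>w\<in>{{}}. (-1) ^ card w * (h (glue w 0 b) * ?g (glue w 0 b)))"
      unfolding alt_sum_def by (rule sum.mono_neutral_right) (auto simp: zero)
    also have "\<dots> = h b * ?g b"
      by (simp add: glue_def)
    finally have "alt_sum UNIV (\<lambda>x. h x * ?g x) 0 b = h b * ?g b" .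
    moreover have "face_integral {} b h u = h b"
      by (simp add: face_integral_def face_def measure_def space_PiM)
    ultimately show ?thesis by simp
  qed
  ultimately have "ibp_integral 0 b ?g h = ?R {} + (-1) ^ CARD('q) * ?R UNIV
      + (\<Sum>v | 1 \<le> card v \<and> card v \<le> CARD('q) - 1. (-1) ^ card v * ?R v)"
    unfolding ibp_integral_def by (simp add: rs)
  also have "\<dots> = (\<Sum>v\<in>insert {} (insert UNIV {v. 1 \<le> card v \<and> card v \<le> CARD('q) - 1}). (-1) ^ card v * ?R v)"
    by (subst sum.insert) (auto simp: card_gt_0_iff not_le)
  also have "insert {} (insert UNIV {v. 1 \<le> card v \<and> card v \<le> CARD('q) - 1}) = (UNIV :: 'q set set)"
  proof -
    have "v = {} \<or> v = UNIV \<or> (1 \<le> card v \<and> card v \<le> CARD('q) - 1)" for v :: "'q set"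
    proof -
      have "card v < CARD('q)" if "v \<noteq> UNIV"
        using that by (intro psubset_card_mono) auto
      then show ?thesis
        by (cases "v = UNIV"; cases "v = {}") (simp_all add: card_gt_0_iff Suc_le_eq)
    qed
    then show ?thesis by blast
  qed
  finally show ?thesis
    unfolding ibp_faces_def .
qed

section \<open>Lattice sums and summation by parts\<close>

lemma sum_tails_telescope:
  fixes a :: "nat \<Rightarrow> real"
  assumes "l \<le> L"
  shows "(\<Sum>k\<in>{l..L}. if k < L then a k - a (Suc k) else a L) = a l"
proof -
  have "(\<Sum>k\<in>{l..<L}. a k - a (Suc k)) = a l - a L"
    using sum_Suc_diff'[of l L "\<lambda>k. - a k"] assms by simp
  moreover have "{l..L} = insert L {l..<L}"
    using assms by auto
  ultimately show ?thesis by simp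
qed

text \<open>Every weight \<open>a j (l j)\<close> is a telescoping sum of the later decrements of \<open>a j\<close>, ending with the
  boundary value at \<open>L j\<close>. Exchanging the order of summation collects the partial sums of \<open>e\<close>.\<close>

lemma weighted_sum_by_parts:
  fixes a :: "'q::finite \<Rightarrow> nat \<Rightarrow> real" and e :: "('q \<Rightarrow> nat) \<Rightarrow> real"
  shows "(\<Sum>l\<in>PiE UNIV (\<lambda>j. {1..L j}). e l * (\<Prod>j\<in>UNIV. a j (l j))) =
    (\<Sum>k\<in>PiE UNIV (\<lambda>j. {..L j}). (\<Sum>l\<in>PiE UNIV (\<lambda>j. {1..k j}). e l) *
      (\<Prod>j\<in>UNIV. if k j < L j then a j (k j) - a j (Suc (k j)) else a j (L j)))"
proof -
  define C where "C j k = (if k < L j then a j k - a j (Suc k) else a j (L j))" for j k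
  let ?A = "PiE UNIV (\<lambda>j. {1..L j})" and ?B = "PiE UNIV (\<lambda>j. {..L j})"
  have "(\<Prod>j\<in>UNIV. a j (l j)) = (\<Sum>k | k \<in> ?B \<and> (\<forall>j. l j \<le> k j). \<Prod>j\<in>UNIV. C j (k j))" if "l \<in> ?A" for l
  proof -
    have "(\<Prod>j\<in>UNIV. a j (l j)) = (\<Prod>j\<in>UNIV. \<Sum>k\<in>{l j..L j}. C j k)"
      using that unfolding C_def by (intro prod.cong refl sum_tails_telescope[symmetric]) (auto simp: PiE_iff)
    also have "\<dots> = (\<Sum>k\<in>PiE UNIV (\<lambda>j. {l j..L j}). \<Prod>j\<in>UNIV. C j (k j))"
      by (rule prod_sum_PiE) auto
    also have "PiE UNIV (\<lambda>j. {l j..L j}) = {k. k \<in> ?B \<and> (\<forall>j. l j \<le> k j)}"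
      by (auto simp: PiE_iff)
    finally show ?thesis .
  qed
  then have "(\<Sum>l\<in>?A. e l * (\<Prod>j\<in>UNIV. a j (l j))) =
      (\<Sum>l\<in>?A. \<Sum>k | k \<in> ?B \<and> (\<forall>j. l j \<le> k j). e l * (\<Prod>j\<in>UNIV. C j (k j)))"
    by (simp add: sum_distrib_left)
  also have "\<dots> = (\<Sum>k\<in>?B. \<Sum>l | l \<in> ?A \<and> (\<forall>j. l j \<le> k j). e l * (\<Prod>j\<in>UNIV. C j (k j)))"
    by (rule sum.swap_restrict) (auto intro!: finite_PiE)
  also have "\<dots> = (\<Sum>k\<in>?B. (\<Sum>l\<in>PiE UNIV (\<lambda>j. {1..k j}). e l) * (\<Prod>j\<in>UNIV. C j (k j)))"
    unfolding sum_distrib_right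
  proof (intro sum.cong refl)
    fix k
    assume "k \<in> ?B"
    then have "x \<le> L j" if "x \<le> k j" for x j
      using that by (auto simp: PiE_iff intro: order_trans)
    then show "{l. l \<in> ?A \<and> (\<forall>j. l j \<le> k j)} = PiE UNIV (\<lambda>j. {1..k j})"
      by (auto simp: PiE_iff)
  qed
  finally show ?thesis
    unfolding C_def .
qed

text \<open>The lattice points are sorted by the set \<open>v\<close> of directions in which they stay below the upper end.\<close>

lemma sum_faces:
  fixes a :: "'q::finite \<Rightarrow> nat \<Rightarrow> real" and T :: "('q \<Rightarrow> nat) \<Rightarrow> real"
  shows "(\<Sum>k\<in>PiE UNIV (\<lambda>j. {..L j}). T k *
      (\<Prod>j\<in>UNIV. if k j < L j then a j (k j) - a j (Suc (k j)) else a j (L j))) =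
    (\<Sum>v\<in>UNIV. (-1) ^ card v * ((\<Sum>k\<in>cells v L. T (\<lambda>j. if j \<in> v then k j else L j) *
      (\<Prod>j\<in>v. a j (Suc (k j)) - a j (k j))) * (\<Prod>j\<in>-v. a j (L j))))"
proof -
  define P where "P k = (\<Prod>j\<in>UNIV. if k j < L j then a j (k j) - a j (Suc (k j)) else a j (L j))" for k
  let ?B = "PiE UNIV (\<lambda>j. {..L j})"
  have "(\<Sum>k\<in>?B. T k * P k) = (\<Sum>v\<in>UNIV. \<Sum>k | k \<in> ?B \<and> {j. k j < L j} = v. T k * P k)"
    by (rule sum.group[symmetric]) (auto intro!: finite_PiE)
  also have "\<dots> = (\<Sum>v\<in>UNIV. (-1) ^ card v * ((\<Sum>k\<in>cells v L. T (\<lambda>j. if j \<in> v then k j else L j) *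
      (\<Prod>j\<in>v. a j (Suc (k j)) - a j (k j))) * (\<Prod>j\<in>-v. a j (L j))))"
  proof (intro sum.cong refl)
    fix v :: "'q set"
    have "(\<Sum>k | k \<in> ?B \<and> {j. k j < L j} = v. T k * P k) =
      (\<Sum>k\<in>cells v L. T (\<lambda>j. if j \<in> v then k j else L j) *
        ((-1) ^ card v * (\<Prod>j\<in>v. a j (Suc (k j)) - a j (k j)) * (\<Prod>j\<in>-v. a j (L j))))"
    proof (rule sum.reindex_bij_witness[where
          i = "\<lambda>k j. if j \<in> v then k j else L j" and j = "\<lambda>k. restrict k v"])
      fix k
      assume k: "k \<in> {k. k \<in> ?B \<and> {j. k j < L j} = v}"
      then have out: "k j = L j" if "j \<notin> v" for j
      proof -
        have "k j \<le> L j" "\<not> k j < L j"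
          using k that by (auto simp: PiE_iff)
        then show ?thesis by simp
      qed
      have inn: "k j < L j" if "j \<in> v" for j
        using that k by auto
      show "(\<lambda>j. if j \<in> v then restrict k v j else L j) = k"
        using out by auto
      show "restrict k v \<in> cells v L"
        using inn by (auto simp: cells_def)
      have "P k = (\<Prod>j\<in>v. - (a j (Suc (k j)) - a j (k j))) * (\<Prod>j\<in>-v. a j (L j))"
      proof -
        have "P k = (\<Prod>j\<in>-v. if k j < L j then a j (k j) - a j (Suc (k j)) else a j (L j)) *
            (\<Prod>j\<in>v. if k j < L j then a j (k j) - a j (Suc (k j)) else a j (L j))"
          unfolding P_def Compl_eq_Diff_UNIV by (rule prod.subset_diff) auto
        also have "(\<Prod>j\<in>-v. if k j < L j then a j (k j) - a j (Suc (k j)) else a j (L j)) = (\<Prod>j\<in>-v. a j (L j))"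
          using out by (intro prod.cong) auto
        also have "(\<Prod>j\<in>v. if k j < L j then a j (k j) - a j (Suc (k j)) else a j (L j)) =
            (\<Prod>j\<in>v. - (a j (Suc (k j)) - a j (k j)))"
          using inn by (intro prod.cong) auto
        finally show ?thesis
          by (simp only: mult.commute)
      qed
      then have "P k = (-1) ^ card v * (\<Prod>j\<in>v. a j (Suc (k j)) - a j (k j)) * (\<Prod>j\<in>-v. a j (L j))"
        by (simp only: prod_uminus)
      moreover have "(\<lambda>j. if j \<in> v then restrict k v j else L j) = k"
        using out by auto
      ultimately show "T (\<lambda>j. if j \<in> v then restrict k v j else L j) *
          ((-1) ^ card v * (\<Prod>j\<in>v. a j (Suc (restrict k v j)) - a j (restrict k v j)) * (\<Prod>j\<in>-v. a j (L j))) = T k * P k"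
        by simp
    next
      fix k
      assume k: "k \<in> cells v L"
      then show "restrict (\<lambda>j. if j \<in> v then k j else L j) v = k"
        by (auto simp: cells_def PiE_iff extensional_def restrict_def)
      show "(\<lambda>j. if j \<in> v then k j else L j) \<in> {k. k \<in> ?B \<and> {j. k j < L j} = v}"
        using k by (auto simp: cells_def PiE_iff less_imp_le)
    qed
    then show "(\<Sum>k | k \<in> ?B \<and> {j. k j < L j} = v. T k * P k) =
        (-1) ^ card v * ((\<Sum>k\<in>cells v L. T (\<lambda>j. if j \<in> v then k j else L j) *
          (\<Prod>j\<in>v. a j (Suc (k j)) - a j (k j))) * (\<Prod>j\<in>-v. a j (L j)))"
      by (simp add: sum_distrib_left sum_distrib_right mult_ac)
  qed
  finally show ?thesis
    unfolding P_def .
qed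

text \<open>The discrete and the continuous integration by parts agree face by face, up to the oscillation of
  \<open>T\<close> around \<open>h\<close> at distance one lattice step.\<close>

lemma lattice_sum_minus_ibp_faces_le:
  fixes h :: "real^'q::finite \<Rightarrow> real" and \<alpha> u :: "'q \<Rightarrow> real \<Rightarrow> real" and n L :: "'q \<Rightarrow> nat"
  assumes h: "continuous_on (cbox 0 1) h"
    and D: "\<And>j t. (\<alpha> j has_real_derivative u j t) (at t)" and cont: "\<And>j t. isCont (u j) t"
    and \<alpha>: "\<And>j t. 0 \<le> t \<Longrightarrow> t \<le> 1 \<Longrightarrow> \<bar>\<alpha> j t\<bar> \<le> K"
    and u: "\<And>j t. 0 \<le> t \<Longrightarrow> t \<le> 1 \<Longrightarrow> \<bar>u j t\<bar> \<le> K" and K: "0 \<le> K" and \<omega>: "0 \<le> \<omega>"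
    and n: "\<And>j. 0 < n j" and L: "\<And>j. L j \<le> n j"
    and T: "\<And>k z. (\<And>j. k j \<le> n j) \<Longrightarrow> z \<in> cbox 0 1 \<Longrightarrow> (\<And>j. \<bar>real (k j) / real (n j) - z$j\<bar> \<le> 1 / real (n j)) \<Longrightarrow>
      \<bar>T k - h z\<bar> \<le> \<omega>"
  shows "\<bar>(\<Sum>k\<in>PiE UNIV (\<lambda>j. {..L j}). T k * (\<Prod>j\<in>UNIV. if k j < L j
        then \<alpha> j (real (k j) / real (n j)) - \<alpha> j (real (Suc (k j)) / real (n j)) else \<alpha> j (real (L j) / real (n j))))
      - ibp_faces (\<chi> j. real (L j) / real (n j)) h \<alpha> u\<bar> \<le> \<omega> * (\<Sum>v\<in>(UNIV::'q set set). K ^ card v * K ^ card (-v))"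
proof -
  define b :: "real^'q" where "b = (\<chi> j. real (L j) / real (n j))"
  have b: "b \<in> cbox 0 1"
    using L n by (simp add: b_def mem_box_cart)
  let ?S = "\<lambda>v. \<Sum>k\<in>cells v L. T (\<lambda>j. if j \<in> v then k j else L j) *
    (\<Prod>j\<in>v. \<alpha> j (real (Suc (k j)) / real (n j)) - \<alpha> j (real (k j) / real (n j)))"
  have est: "\<bar>?S v - face_integral v b h u\<bar> \<le> \<omega> * K ^ card v" for v
  proof (rule abs_riemann_sum_minus_face_integral_le[OF b h D cont u K \<omega>,
        where p = "\<lambda>j i. real i / real (n j)" and m = L])
    show "real 0 / real (n j) = 0 \<and> real (L j) / real (n j) = b$j \<and>
        (\<forall>i<L j. real i / real (n j) \<le> real (Suc i) / real (n j))" if "j \<in> v" for j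
      using n[of j] by (auto simp: b_def divide_right_mono)
  next
    fix k z
    assume k: "k \<in> cells v L" and z: "\<And>j. j \<in> v \<Longrightarrow> real (k j) / real (n j) \<le> z j \<and> z j < real (Suc (k j)) / real (n j)"
    have kL: "Suc (k j) \<le> L j" if "j \<in> v" for j
      using k that by (auto simp: cells_def PiE_iff Suc_le_eq)
    show "\<bar>T (\<lambda>j. if j \<in> v then k j else L j) - h (face v b z)\<bar> \<le> \<omega>"
    proof (rule T)
      show "(if j \<in> v then k j else L j) \<le> n j" for j
        using kL[of j] L[of j] by auto
      show "face v b z \<in> cbox 0 1"
      proof (rule face_in_box[OF b])
        fix j
        assume j: "j \<in> v"
        have "real (Suc (k j)) / real (n j) \<le> 1"
          using kL[OF j] L[of j] n[of j] by (simp add: divide_le_eq_1)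
        moreover have "0 \<le> real (k j) / real (n j)"
          by simp
        ultimately show "0 \<le> z j \<and> z j \<le> 1"
          using z[OF j] by linarith
      qed
      show "\<bar>real (if j \<in> v then k j else L j) / real (n j) - face v b z $ j\<bar> \<le> 1 / real (n j)" for j
      proof (cases "j \<in> v")
        case True
        have "real (Suc (k j)) / real (n j) = real (k j) / real (n j) + 1 / real (n j)"
          by (simp add: add_divide_distrib)
        then show ?thesis
          using z[OF True] True by (simp add: face_def)
      qed (simp add: face_def b_def)
    qed
  qed
  have \<alpha>b: "\<bar>\<Prod>j\<in>-v. \<alpha> j (b$j)\<bar> \<le> K ^ card (-v)" for v
  proof -
    have "\<bar>\<Prod>j\<in>-v. \<alpha> j (b$j)\<bar> \<le> (\<Prod>j\<in>-v. K)"
      unfolding abs_prod using b \<alpha> by (intro prod_mono) (auto simp: mem_box_cart)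
    then show ?thesis by simp
  qed
  have "\<bar>(\<Sum>v\<in>UNIV. (-1) ^ card v * (?S v * (\<Prod>j\<in>-v. \<alpha> j (b$j)))) - ibp_faces b h \<alpha> u\<bar> =
      \<bar>\<Sum>v\<in>UNIV. (-1) ^ card v * ((?S v - face_integral v b h u) * (\<Prod>j\<in>-v. \<alpha> j (b$j)))\<bar>"
    unfolding ibp_faces_def by (simp add: sum_subtractf[symmetric] algebra_simps)
  also have "\<dots> \<le> (\<Sum>v\<in>(UNIV::'q set set). \<omega> * (K ^ card v * K ^ card (-v)))"
  proof (rule order_trans[OF sum_abs], rule sum_mono)
    fix v :: "'q set"
    have "\<bar>?S v - face_integral v b h u\<bar> * \<bar>\<Prod>j\<in>-v. \<alpha> j (b$j)\<bar> \<le> (\<omega> * K ^ card v) * K ^ card (-v)"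
      using est[of v] \<alpha>b[of v] K \<omega> by (intro mult_mono) auto
    then show "\<bar>(-1) ^ card v * ((?S v - face_integral v b h u) * (\<Prod>j\<in>-v. \<alpha> j (b$j)))\<bar> \<le> \<omega> * (K ^ card v * K ^ card (-v))"
      by (simp add: abs_mult power_abs mult.assoc)
  qed
  finally have "\<bar>(\<Sum>v\<in>UNIV. (-1) ^ card v * (?S v * (\<Prod>j\<in>-v. \<alpha> j (b$j)))) - ibp_faces b h \<alpha> u\<bar>
      \<le> \<omega> * (\<Sum>v\<in>(UNIV::'q set set). K ^ card v * K ^ card (-v))"
    by (simp only: sum_distrib_left)
  then show ?thesis
    unfolding sum_faces[where a = "\<lambda>j i. \<alpha> j (real i / real (n j))"] b_def by simp
qed

text \<open>The functional for the kernel of the detector, read at position \<open>y\<close> with time scales \<open>c\<close>; these are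
  \<open>n\<^sub>j \<tau>\<^sub>j\<close> for the statistic and their limits for the limit process.\<close>

definition sinc_faces :: "real^'q::finite \<Rightarrow> real^'q \<Rightarrow> real^'q \<Rightarrow> real^'q \<Rightarrow> (real^'q \<Rightarrow> real) \<Rightarrow> real" where
  "sinc_faces \<Omega> y c b h = ibp_faces b h (\<lambda>j t. sinc_kernel (\<Omega>$j) (y$j - c$j * t))
     (\<lambda>j t. - (c$j) * sinc_kernel_deriv (\<Omega>$j) (y$j - c$j * t))"

lemma DERIV_sinc_shift:
  assumes "0 < w"
  shows "((\<lambda>t. sinc_kernel w (y - c * t)) has_real_derivative - c * sinc_kernel_deriv w (y - c * t)) (at t)"
proof -
  have "((\<lambda>t. y - c * t) has_real_derivative - c) (at t)"
    by (auto intro!: derivative_eq_intros)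
  from DERIV_chain2[OF DERIV_sinc_kernel[OF assms] this] show ?thesis
    by (simp add: mult.commute)
qed

lemma isCont_sinc_deriv_shift:
  "0 < w \<Longrightarrow> isCont (\<lambda>t. - c * sinc_kernel_deriv w (y - c * t)) t"
  by (intro continuous_intros isCont_o2[OF _ isCont_sinc_kernel_deriv])

lemma sinc_shift_bounds:
  fixes y c :: "nat \<Rightarrow> real^'q::finite"
  assumes \<Omega>: "\<And>j. 0 < \<Omega>$j" and y: "y \<longlonglongrightarrow> y'" and c: "c \<longlonglongrightarrow> c'"
  obtains K where "0 \<le> K"
    "\<And>m j t. 0 \<le> t \<Longrightarrow> t \<le> 1 \<Longrightarrow> \<bar>sinc_kernel (\<Omega>$j) (y m$j - c m$j * t)\<bar> \<le> K"
    "\<And>m j t. 0 \<le> t \<Longrightarrow> t \<le> 1 \<Longrightarrow> \<bar>- (c m$j) * sinc_kernel_deriv (\<Omega>$j) (y m$j - c m$j * t)\<bar> \<le> K"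
proof -
  obtain Y C where Y: "\<And>m. norm (y m) \<le> Y" and C: "\<And>m. norm (c m) \<le> C"
    using convergent_imp_Bseq[of y] convergent_imp_Bseq[of c] y c
    unfolding convergent_def Bseq_def by blast
  have C0: "0 \<le> C"
    using order_trans[OF norm_ge_zero C[of 0]] .
  have arg: "y m$j - c m$j * t \<in> {-(Y + C)..Y + C}" if "0 \<le> t" "t \<le> 1" for m j t
  proof -
    have "\<bar>c m$j * t\<bar> \<le> \<bar>c m$j\<bar>"
      using that by (simp add: abs_mult mult_left_le)
    then show ?thesis
      using component_le_norm_cart[of "y m" j] component_le_norm_cart[of "c m" j] Y[of m] C[of m]
      unfolding abs_le_iff atLeastAtMost_iff by linarith
  qed
  have "\<exists>A. \<forall>t\<in>{-(Y + C)..Y + C}. \<bar>f t\<bar> \<le> A" if "\<And>t. isCont f t" for f :: "real \<Rightarrow> real"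
  proof -
    have "bounded (f ` {-(Y + C)..Y + C})"
      using that by (intro compact_imp_bounded compact_continuous_image continuous_at_imp_continuous_on) auto
    then show ?thesis
      unfolding bounded_iff by auto
  qed
  then have "\<forall>j. \<exists>A. \<forall>t\<in>{-(Y + C)..Y + C}. \<bar>sinc_kernel (\<Omega>$j) t\<bar> \<le> A"
    "\<forall>j. \<exists>A. \<forall>t\<in>{-(Y + C)..Y + C}. \<bar>sinc_kernel_deriv (\<Omega>$j) t\<bar> \<le> A"
    using isCont_sinc_kernel[OF \<Omega>] isCont_sinc_kernel_deriv[OF \<Omega>] by blast+
  then obtain A A' where A: "\<And>j t. t \<in> {-(Y + C)..Y + C} \<Longrightarrow> \<bar>sinc_kernel (\<Omega>$j) t\<bar> \<le> A j"
    and A': "\<And>j t. t \<in> {-(Y + C)..Y + C} \<Longrightarrow> \<bar>sinc_kernel_deriv (\<Omega>$j) t\<bar> \<le> A' j"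
    by metis
  define K where "K = (\<Sum>j\<in>UNIV. \<bar>A j\<bar>) + C * (\<Sum>j\<in>UNIV. \<bar>A' j\<bar>)"
  have nonneg: "0 \<le> (\<Sum>j\<in>UNIV. \<bar>A j\<bar>)" "0 \<le> C * (\<Sum>j\<in>UNIV. \<bar>A' j\<bar>)"
    using C0 by (auto intro!: sum_nonneg mult_nonneg_nonneg)
  show thesis
  proof (rule that)
    show "0 \<le> K"
      using nonneg by (simp add: K_def)
    fix m j and t :: real
    assume t: "0 \<le> t" "t \<le> 1"
    have le: "f j \<le> (\<Sum>j\<in>UNIV. \<bar>f j\<bar>)" for f :: "'q \<Rightarrow> real"
      by (rule order_trans[OF abs_ge_self]) (rule member_le_sum, auto)
    show "\<bar>sinc_kernel (\<Omega>$j) (y m$j - c m$j * t)\<bar> \<le> K"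
      using A[OF arg[OF t, of m j], of j] le[of A] nonneg unfolding K_def by linarith
    have "\<bar>c m$j\<bar> * \<bar>sinc_kernel_deriv (\<Omega>$j) (y m$j - c m$j * t)\<bar> \<le> C * (\<Sum>j\<in>UNIV. \<bar>A' j\<bar>)"
      using component_le_norm_cart[of "c m" j] C[of m] A'[OF arg[OF t, of m j], of j] le[of A'] C0
      by (intro mult_mono) auto
    then show "\<bar>- (c m$j) * sinc_kernel_deriv (\<Omega>$j) (y m$j - c m$j * t)\<bar> \<le> K"
      using nonneg unfolding K_def abs_mult abs_minus_cancel by linarith
  qed
qed

lemma sinc_faces_tendsto:
  fixes h :: "real^'q::finite \<Rightarrow> real" and b y c :: "nat \<Rightarrow> real^'q"
  assumes \<Omega>: "\<And>j. 0 < \<Omega>$j" and h: "continuous_on (cbox 0 1) h"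
    and b: "\<And>m. b m \<in> cbox 0 1" "b \<longlonglongrightarrow> b'" and y: "y \<longlonglongrightarrow> y'" and c: "c \<longlonglongrightarrow> c'"
  shows "(\<lambda>m. sinc_faces \<Omega> (y m) (c m) (b m) h) \<longlonglongrightarrow> sinc_faces \<Omega> y' c' b' h"
proof -
  obtain K where "0 \<le> K"
    and "\<And>m j t. 0 \<le> t \<Longrightarrow> t \<le> 1 \<Longrightarrow> \<bar>sinc_kernel (\<Omega>$j) (y m$j - c m$j * t)\<bar> \<le> K"
    and K: "\<And>m j t. 0 \<le> t \<Longrightarrow> t \<le> 1 \<Longrightarrow> \<bar>- (c m$j) * sinc_kernel_deriv (\<Omega>$j) (y m$j - c m$j * t)\<bar> \<le> K"
    by (rule sinc_shift_bounds[OF \<Omega> y c]; rule that; assumption)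
  have borel: "(\<lambda>t. - c * sinc_kernel_deriv (\<Omega>$j) (y - c * t)) \<in> borel_measurable borel" for j c y
    by (intro borel_measurable_continuous_onI continuous_at_imp_continuous_on ballI isCont_sinc_deriv_shift \<Omega>)
  have shift: "(\<lambda>m. y m$j - c m$j * t) \<longlonglongrightarrow> y'$j - c'$j * t" for j t
    using y c by (intro tendsto_intros)
  show ?thesis
    unfolding sinc_faces_def ibp_faces_def
    by (intro tendsto_intros tendsto_sum tendsto_prod face_integral_tendsto[OF b h borel borel K]
        isCont_tendsto_compose[OF isCont_sinc_kernel[OF \<Omega>]]
        isCont_tendsto_compose[OF isCont_sinc_kernel_deriv[OF \<Omega>]] shift y c b)
qed

section \<open>The detector statistic along a convergent sequence of noise paths\<close>

lemma vector_4:
  "(vector [a, b, c, d] :: ('a::zero)^4) $ 1 = a"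
  "(vector [a, b, c, d] :: ('a::zero)^4) $ 2 = b"
  "(vector [a, b, c, d] :: ('a::zero)^4) $ 3 = c"
  "(vector [a, b, c, d] :: ('a::zero)^4) $ 4 = d"
  unfolding vector_def by simp_all

lemma prod_UNIV_3: "prod f (UNIV :: 3 set) = f 1 * f 2 * f 3"
  unfolding UNIV_3 by (simp add: ac_simps)

lemma sum_PiE_3:
  fixes A :: "3 \<Rightarrow> nat set"
  shows "(\<Sum>l\<in>PiE UNIV A. f l) = (\<Sum>x\<in>A 1. \<Sum>y\<in>A 2. \<Sum>z\<in>A 3. f (($) (vector [x, y, z])))"
proof -
  have "(\<Sum>l\<in>PiE UNIV A. f l) = (\<Sum>(x, y, z)\<in>A 1 \<times> A 2 \<times> A 3. f (($) (vector [x, y, z])))"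
  proof (rule sum.reindex_bij_witness[where i = "\<lambda>(x, y, z). ($) (vector [x, y, z])" and j = "\<lambda>l. (l 1, l 2, l 3)"])
    show eta: "(case (l 1, l 2, l 3) of (x, y, z) \<Rightarrow> ($) (vector [x, y, z])) = l" for l :: "3 \<Rightarrow> nat"
      by (auto simp: fun_eq_iff forall_3)
    show "(case (l 1, l 2, l 3) of (x, y, z) \<Rightarrow> f (($) (vector [x, y, z]))) = f l" for l
      using eta[of l] by simp
  qed (auto simp: PiE_iff forall_3)
  then show ?thesis
    by (simp add: sum.cartesian_product)
qed

text \<open>Centring the observations removes the signal and centres the noise. The partial sums of the centred
  noise over the first \<open>k 1\<close> slices are the partial sums of the noise minus the fraction \<open>k 1 / P\<close> of
  the ones at time \<open>s0\<close>, the discrete counterpart of the passage from \<open>B\<close> to \<open>B\<^sup>c\<close>.\<close>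

lemma F_stat_eq_lattice_sum:
  fixes n :: "nat^3" and e :: "int^3 \<Rightarrow> 'w \<Rightarrow> real"
  assumes n: "\<And>j. 0 < n$j" and s0: "0 < s0" "s0 \<le> 1" and P: "P = nat \<lfloor>real (n$1) * s0\<rfloor>" "0 < P"
    and f: "\<And>i1 k1 i2 i3. i1 \<in> {1..n$1} \<Longrightarrow> k1 \<in> {1..n$1} \<Longrightarrow> i2 \<in> {1..n$2} \<Longrightarrow> i3 \<in> {1..n$3} \<Longrightarrow>
      f (real i1 * \<tau> 1 (n$1)) (real i2 * \<tau> 2 (n$2)) (real i3 * \<tau> 3 (n$3)) =
      f (real k1 * \<tau> 1 (n$1)) (real i2 * \<tau> 2 (n$2)) (real i3 * \<tau> 3 (n$3))"
    and x: "x$1 \<le> 1"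
    and L: "L = (\<lambda>j. if j = 1 then nat \<lfloor>real (n$1) * x$1\<rfloor> else n$j)"
    and \<alpha>: "\<alpha> = (\<lambda>j t. sinc_kernel (\<Omega>$j) (vector [x$2, x$3, x$4] $ j - real (n$j) * \<tau> j (n$j) * t))"
    and T: "T = (\<lambda>k. partial_sum e n (\<chi> j. real (k j) / real (n$j)) w -
      real (k 1) / real P * partial_sum e n (\<chi> j. if j = 1 then s0 else real (k j) / real (n$j)) w)"
  shows "F_stat \<Omega> \<tau> s0 n (obs f e \<tau> n) x w = sqrt (\<Prod>j\<in>UNIV. real (n$j) * \<tau> j (n$j)) *
    (\<Sum>k\<in>PiE UNIV (\<lambda>j. {..L j}). T k * (\<Prod>j\<in>UNIV. if k j < L j
      then \<alpha> j (real (k j) / real (n$j)) - \<alpha> j (real (Suc (k j)) / real (n$j)) else \<alpha> j (real (L j) / real (n$j))))"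
proof -
  define S where "S k1 k2 k3 = (\<Sum>i1 = 1..k1. \<Sum>i2 = 1..k2. \<Sum>i3 = 1..k3. e (vector [int i1, int i2, int i3]) w)"
    for k1 k2 k3 :: nat
  define \<mu> where "\<mu> l2 l3 = (\<Sum>i = 1..P. e (vector [int i, int l2, int l3]) w) / real P" for l2 l3 :: nat
  define E where "E l = e (vector [int (l 1), int (l 2), int (l 3)]) w - \<mu> (l 2) (l 3)" for l :: "3 \<Rightarrow> nat"
  define N where "N = real (n$1) * real (n$2) * real (n$3)"
  have N: "0 < N"
    using n by (simp add: N_def)
  have floor_le: "nat \<lfloor>real (n$1) * t\<rfloor> \<le> n$1" if "t \<le> 1" for t
  proof -
    have "real (n$1) * t \<le> real (n$1) * 1"
      using that by (intro mult_left_mono) auto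
    then show ?thesis
      by linarith
  qed
  have Pn: "P \<le> n$1"
    unfolding P(1) by (rule floor_le[OF s0(2)])
  have P_floor: "of_int \<lfloor>real (n$1) * s0\<rfloor> = real P"
    using P by simp
  \<comment> \<open>The signal is constant in time on the sampling grid and drops out of the centred observations.\<close>
  have centred: "obs f e \<tau> n l1 l2 l3 w - obs_mean s0 n (obs f e \<tau> n) l2 l3 w = E (($) (vector [l1, l2, l3]))"
    if l: "l1 \<in> {1..n$1}" "l2 \<in> {1..n$2}" "l3 \<in> {1..n$3}" for l1 l2 l3
  proof -
    let ?f = "f (real l1 * \<tau> 1 (n$1)) (real l2 * \<tau> 2 (n$2)) (real l3 * \<tau> 3 (n$3))"
    have "(\<Sum>i = 1..P. obs f e \<tau> n i l2 l3 w) = (\<Sum>i = 1..P. ?f + e (vector [int i, int l2, int l3]) w)"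
    proof (intro sum.cong refl)
      fix i
      assume "i \<in> {1..P}"
      then have "i \<in> {1..n$1}"
        using Pn by auto
      from f[OF this l] show "obs f e \<tau> n i l2 l3 w = ?f + e (vector [int i, int l2, int l3]) w"
        by (simp add: obs_def)
    qed
    also have "\<dots> = real P * ?f + real P * \<mu> l2 l3"
      using P(2) by (simp add: sum.distrib \<mu>_def)
    finally have "obs_mean s0 n (obs f e \<tau> n) l2 l3 w = ?f + \<mu> l2 l3"
      unfolding obs_mean_def P_floor P(1)[symmetric] using P(2) by (simp add: add_divide_distrib)
    then show ?thesis
      by (simp add: obs_def E_def)
  qed
  have L1: "L 1 = nat \<lfloor>real (n$1) * x$1\<rfloor>" "L 2 = n$2" "L 3 = n$3"
    by (simp_all add: L)
  have "(\<Sum>l1 = 1..L 1. \<Sum>l2 = 1..n$2. \<Sum>l3 = 1..n$3.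
        (obs f e \<tau> n l1 l2 l3 w - obs_mean s0 n (obs f e \<tau> n) l2 l3 w) *
        kernel \<Omega> (x$2 - real l1 * \<tau> 1 (n$1)) (x$3 - real l2 * \<tau> 2 (n$2)) (x$4 - real l3 * \<tau> 3 (n$3))) =
      (\<Sum>l1 = 1..L 1. \<Sum>l2 = 1..n$2. \<Sum>l3 = 1..n$3. E (($) (vector [l1, l2, l3])) *
        (\<Prod>j\<in>UNIV. \<alpha> j (real (vector [l1, l2, l3] $ j) / real (n$j))))"
  proof (intro sum.cong refl arg_cong2[where f = "(*)"])
    fix l1 l2 l3
    assume l: "l1 \<in> {1..L 1}" "l2 \<in> {1..n$2}" "l3 \<in> {1..n$3}"
    then have "l1 \<in> {1..n$1}"
      using floor_le[OF x] by (auto simp: L1)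
    then show "obs f e \<tau> n l1 l2 l3 w - obs_mean s0 n (obs f e \<tau> n) l2 l3 w = E (($) (vector [l1, l2, l3]))"
      using l by (intro centred)
    show "kernel \<Omega> (x$2 - real l1 * \<tau> 1 (n$1)) (x$3 - real l2 * \<tau> 2 (n$2)) (x$4 - real l3 * \<tau> 3 (n$3)) =
        (\<Prod>j\<in>UNIV. \<alpha> j (real (vector [l1, l2, l3] $ j) / real (n$j)))"
      using n[of 1] n[of 2] n[of 3] by (simp add: prod_UNIV_3 kernel_def \<alpha> mult.commute)
  qed
  also have "\<dots> = (\<Sum>l\<in>PiE UNIV (\<lambda>j. {1..L j}). E l * (\<Prod>j\<in>UNIV. \<alpha> j (real (l j) / real (n$j))))"
    by (simp add: sum_PiE_3 L1)
  also have "\<dots> = (\<Sum>k\<in>PiE UNIV (\<lambda>j. {..L j}). (\<Sum>l\<in>PiE UNIV (\<lambda>j. {1..k j}). E l) * (\<Prod>j\<in>UNIV. if k j < L j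
      then \<alpha> j (real (k j) / real (n$j)) - \<alpha> j (real (Suc (k j)) / real (n$j)) else \<alpha> j (real (L j) / real (n$j))))"
    by (rule weighted_sum_by_parts[where a = "\<lambda>j i. \<alpha> j (real i / real (n$j))"])
  also have "\<dots> = (\<Sum>k\<in>PiE UNIV (\<lambda>j. {..L j}). (sqrt N * T k) * (\<Prod>j\<in>UNIV. if k j < L j
      then \<alpha> j (real (k j) / real (n$j)) - \<alpha> j (real (Suc (k j)) / real (n$j)) else \<alpha> j (real (L j) / real (n$j))))"
  proof (intro sum.cong refl arg_cong2[where f = "(*)"])
    fix k :: "3 \<Rightarrow> nat"
    have "(\<Sum>l\<in>PiE UNIV (\<lambda>j. {1..k j}). E l) =
        S (k 1) (k 2) (k 3) - (\<Sum>l1 = 1..k 1. \<Sum>l2 = 1..k 2. \<Sum>l3 = 1..k 3. \<mu> l2 l3)"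
      by (simp add: sum_PiE_3 E_def S_def sum_subtractf)
    also have "(\<Sum>l1 = 1..k 1. \<Sum>l2 = 1..k 2. \<Sum>l3 = 1..k 3. \<mu> l2 l3) = real (k 1) * (\<Sum>l2 = 1..k 2. \<Sum>l3 = 1..k 3. \<mu> l2 l3)"
      by simp
    also have "(\<Sum>l2 = 1..k 2. \<Sum>l3 = 1..k 3. \<mu> l2 l3) = S P (k 2) (k 3) / real P"
    proof -
      have "(\<Sum>l2 = 1..k 2. \<Sum>l3 = 1..k 3. \<Sum>i = 1..P. e (vector [int i, int l2, int l3]) w) = S P (k 2) (k 3)"
      proof -
        have "(\<Sum>l2 = 1..k 2. \<Sum>l3 = 1..k 3. \<Sum>i = 1..P. e (vector [int i, int l2, int l3]) w) =
            (\<Sum>l2 = 1..k 2. \<Sum>i = 1..P. \<Sum>l3 = 1..k 3. e (vector [int i, int l2, int l3]) w)"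
          by (intro sum.cong refl sum.swap)
        also have "\<dots> = S P (k 2) (k 3)"
          unfolding S_def by (rule sum.swap)
        finally show ?thesis .
      qed
      then show ?thesis
        unfolding \<mu>_def by (simp add: sum_divide_distrib[symmetric])
    qed
    also have "S (k 1) (k 2) (k 3) - real (k 1) * (S P (k 2) (k 3) / real P) = sqrt N * T k"
    proof -
      have fl: "nat \<lfloor>real (n$j) * (real i / real (n$j))\<rfloor> = i" for i j
        using n[of j] by simp
      have "partial_sum e n (\<chi> j. real (k j) / real (n$j)) w = S (k 1) (k 2) (k 3) / sqrt N"
        unfolding partial_sum_def S_def N_def vec_lambda_beta fl ..
      moreover have "partial_sum e n (\<chi> j. if j = 1 then s0 else real (k j) / real (n$j)) w = S P (k 2) (k 3) / sqrt N"
        unfolding partial_sum_def S_def N_def vec_lambda_beta P(1) by (simp add: fl)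
      ultimately show ?thesis
        unfolding T using N by (simp add: field_simps)
    qed
    finally show "(\<Sum>l\<in>PiE UNIV (\<lambda>j. {1..k j}). E l) = sqrt N * T k" .
  qed
  finally have sums: "(\<Sum>l1 = 1..L 1. \<Sum>l2 = 1..n$2. \<Sum>l3 = 1..n$3.
        (obs f e \<tau> n l1 l2 l3 w - obs_mean s0 n (obs f e \<tau> n) l2 l3 w) *
        kernel \<Omega> (x$2 - real l1 * \<tau> 1 (n$1)) (x$3 - real l2 * \<tau> 2 (n$2)) (x$4 - real l3 * \<tau> 3 (n$3))) =
      sqrt N * (\<Sum>k\<in>PiE UNIV (\<lambda>j. {..L j}). T k * (\<Prod>j\<in>UNIV. if k j < L j
      then \<alpha> j (real (k j) / real (n$j)) - \<alpha> j (real (Suc (k j)) / real (n$j)) else \<alpha> j (real (L j) / real (n$j))))"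
    by (simp only: sum_distrib_left mult.assoc)
  have "sqrt (\<tau> 1 (n$1) * \<tau> 2 (n$2) * \<tau> 3 (n$3)) * sqrt N = sqrt (\<Prod>j\<in>UNIV. real (n$j) * \<tau> j (n$j))"
    unfolding N_def prod_UNIV_3 real_sqrt_mult[symmetric] by (simp add: mult_ac)
  then show ?thesis
    unfolding F_stat_def L1(1)[symmetric] sums by (simp only: mult.assoc[symmetric])
qed

lemma floor_ratio_tendsto:
  fixes n :: "nat \<Rightarrow> nat" and x :: "nat \<Rightarrow> real"
  assumes "filterlim n at_top sequentially" "x \<longlonglongrightarrow> x'" "\<And>m. 0 \<le> x m"
  shows "(\<lambda>m. real (nat \<lfloor>real (n m) * x m\<rfloor>) / real (n m)) \<longlonglongrightarrow> x'"
proof -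
  have inv: "(\<lambda>m. 1 / real (n m)) \<longlonglongrightarrow> 0"
    using filterlim_compose[OF lim_1_over_n assms(1)] by simp
  have "eventually (\<lambda>m. norm (real (nat \<lfloor>real (n m) * x m\<rfloor>) / real (n m) - x m) \<le> 1 / real (n m)) sequentially"
    using filterlim_at_top[THEN iffD1, OF assms(1), rule_format, of 1]
  proof eventually_elim
    case (elim m)
    have "0 \<le> real (n m) * x m"
      using assms(3) by simp
    then have "\<bar>real (nat \<lfloor>real (n m) * x m\<rfloor>) - real (n m) * x m\<bar> \<le> 1"
      by linarith
    then have "\<bar>real (nat \<lfloor>real (n m) * x m\<rfloor>) - real (n m) * x m\<bar> / real (n m) \<le> 1 / real (n m)"
      by (rule divide_right_mono) simp
    also have "\<bar>real (nat \<lfloor>real (n m) * x m\<rfloor>) - real (n m) * x m\<bar> / real (n m) =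
        \<bar>real (nat \<lfloor>real (n m) * x m\<rfloor>) / real (n m) - x m\<bar>"
    proof -
      have "real (nat \<lfloor>real (n m) * x m\<rfloor>) / real (n m) - x m =
          (real (nat \<lfloor>real (n m) * x m\<rfloor>) - real (n m) * x m) / real (n m)"
        using elim by (simp add: diff_divide_distrib)
      then show ?thesis
        by (simp add: abs_divide)
    qed
    finally show ?case by simp
  qed
  from tendsto_add[OF Lim_null_comparison[OF this inv] assms(2)] show ?thesis
    by simp
qed

text \<open>The passage from \<open>B\<close> to \<open>B\<^sup>c\<close> as an operation on a single path.\<close>

definition centered :: "real \<Rightarrow> (real^3 \<Rightarrow> real) \<Rightarrow> real^3 \<Rightarrow> real" where
  "centered s0 h z = h z - z$1 / s0 * h (vector [s0, z$2, z$3])"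

lemma continuous_on_centered:
  assumes "continuous_on (cbox 0 1) h" "0 \<le> s0" "s0 \<le> 1"
  shows "continuous_on (cbox 0 1) (centered s0 h)"
proof -
  have "continuous_on (cbox 0 1) (\<lambda>z :: real^3. h (\<chi> j. if j = 1 then s0 else z$j))"
  proof (rule continuous_on_compose2[OF assms(1)])
    show "continuous_on (cbox 0 1) (\<lambda>z :: real^3. \<chi> j. if j = 1 then s0 else z$j)"
    proof (rule continuous_on_vec_lambda)
      fix j :: 3
      show "continuous_on (cbox 0 1) (\<lambda>z :: real^3. if j = 1 then s0 else z$j)"
        by (cases "j = 1") (simp_all add: continuous_on_component)
    qed
    show "(\<lambda>z :: real^3. \<chi> j. if j = 1 then s0 else z$j) ` cbox 0 1 \<subseteq> cbox 0 1"
      using assms(2,3) by (auto simp: mem_box_cart)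
  qed
  moreover have "(\<chi> j. if j = 1 then s0 else z$j) = vector [s0, z$2, z$3]" for z :: "real^3"
    by (simp add: vec_eq_iff forall_3)
  ultimately have "continuous_on (cbox 0 1) (\<lambda>z :: real^3. h (vector [s0, z$2, z$3]))"
    by simp
  then show ?thesis
    unfolding centered_def[abs_def] divide_inverse using assms(1) by (intro continuous_intros)
qed

lemma centered_zero:
  assumes "\<And>z j. z \<in> cbox 0 1 \<Longrightarrow> z$j = 0 \<Longrightarrow> h z = 0" "z \<in> cbox 0 1" "z$j = 0" "0 \<le> s0" "s0 \<le> 1"
  shows "centered s0 h z = 0"
proof -
  have "vector [s0, z$2, z$3] \<in> cbox 0 (1 :: real^3)"
    using assms(2,4,5) by (simp add: mem_box_cart forall_3)
  moreover have "j = 1 \<or> vector [s0, z$2, z$3] $ j = (0 :: real)"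
    using assms(3) exhaust_3[of j] by auto
  ultimately have "j = 1 \<or> h (vector [s0, z$2, z$3]) = 0"
    using assms(1) by blast
  then show ?thesis
    unfolding centered_def using assms(1)[OF assms(2,3)] assms(3) by auto
qed

text \<open>The fraction \<open>k 1 / \<lfloor>\<nu>\<^sub>1 s0\<rfloor>\<close> is close to \<open>z\<^sub>1 / s0\<close>, and the partial sums are close to \<open>h\<close>, both at the
  lattice point and at its projection to time \<open>s0\<close>.\<close>

lemma centered_partial_sums_close:
  fixes \<nu> :: "nat \<Rightarrow> nat^3"
  assumes s0: "0 < s0" "s0 < 1" and \<nu>: "\<And>j. filterlim (\<lambda>m. \<nu> m$j) at_top sequentially"
    and h: "continuous_on (cbox 0 1) h" and S: "uniform_limit (cbox 0 1) S h sequentially"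
    and \<omega>: "0 < \<omega>"
  shows "eventually (\<lambda>m. \<forall>k z. (\<forall>j. k j \<le> \<nu> m$j) \<longrightarrow> z \<in> cbox 0 1 \<longrightarrow>
      (\<forall>j. \<bar>real (k j) / real (\<nu> m$j) - z$j\<bar> \<le> 1 / real (\<nu> m$j)) \<longrightarrow>
      \<bar>S m (\<chi> j. real (k j) / real (\<nu> m$j)) - real (k 1) / real (nat \<lfloor>real (\<nu> m$1) * s0\<rfloor>) *
        S m (\<chi> j. if j = 1 then s0 else real (k j) / real (\<nu> m$j)) - centered s0 h z\<bar> \<le> \<omega>) sequentially"
proof -
  \<comment> \<open>\<open>\<rho> m\<close> converts fractions of \<open>\<nu>\<^sub>1\<close> into fractions of \<open>\<lfloor>\<nu>\<^sub>1 s0\<rfloor>\<close>.\<close>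
  define \<rho> where "\<rho> m = inverse (real (nat \<lfloor>real (\<nu> m$1) * s0\<rfloor>) / real (\<nu> m$1))" for m
  have \<rho>: "\<rho> \<longlonglongrightarrow> inverse s0"
    unfolding \<rho>_def using s0 by (intro tendsto_inverse floor_ratio_tendsto[OF \<nu> tendsto_const]) auto
  have inv: "(\<lambda>m. 1 / real (\<nu> m$j)) \<longlonglongrightarrow> 0" for j
    using filterlim_compose[OF lim_1_over_n \<nu>[of j]] by simp
  have "bounded (h ` cbox 0 1)"
    using h by (intro compact_imp_bounded compact_continuous_image) auto
  then obtain M where M: "\<And>z. z \<in> cbox 0 1 \<Longrightarrow> \<bar>h z\<bar> \<le> M"
    unfolding bounded_iff by auto
  \<comment> \<open>Each of the two approximations costs \<open>2 * \<eta>\<close>, the second one with factor \<open>\<rho> m\<close>, so their sum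
    tends to \<open>\<omega> / 2\<close>.\<close>
  define \<eta> where "\<eta> = \<omega> / (4 * (1 + inverse s0))"
  have \<eta>: "0 < \<eta>"
    unfolding \<eta>_def using s0 \<omega> by (intro divide_pos_pos mult_pos_pos add_pos_pos) auto
  obtain d where d: "0 < d" "\<And>x y. x \<in> cbox 0 1 \<Longrightarrow> y \<in> cbox 0 1 \<Longrightarrow> (\<And>j. \<bar>x$j - y$j\<bar> < d) \<Longrightarrow> \<bar>h x - h y\<bar> < \<eta>"
    using continuous_on_box_modulus[OF h \<eta>] by blast
  have "(\<lambda>m. 2 * \<eta> + 2 * \<eta> * \<rho> m + M * (\<rho> m * (1 / real (\<nu> m$1)) + \<bar>\<rho> m - inverse s0\<bar>))
      \<longlonglongrightarrow> 2 * \<eta> + 2 * \<eta> * inverse s0 + M * (inverse s0 * 0 + \<bar>inverse s0 - inverse s0\<bar>)"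
    by (intro tendsto_intros \<rho> inv)
  moreover have "2 * \<eta> + 2 * \<eta> * inverse s0 + M * (inverse s0 * 0 + \<bar>inverse s0 - inverse s0\<bar>) < \<omega>"
  proof -
    have "2 * \<eta> * (1 + inverse s0) = \<omega> / 2"
    proof -
      have "2 * (\<omega> / (4 * r)) * r = \<omega> / 2" if "0 < r" for r
        using that by (simp add: field_simps)
      from this[of "1 + inverse s0"] show ?thesis
        unfolding \<eta>_def using s0(1) by (simp add: add_pos_pos)
    qed
    then show ?thesis
      using \<omega> by (simp add: distrib_left)
  qed
  ultimately have small: "eventually (\<lambda>m. 2 * \<eta> + 2 * \<eta> * \<rho> m + M * (\<rho> m * (1 / real (\<nu> m$1)) + \<bar>\<rho> m - inverse s0\<bar>) < \<omega>) sequentially"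
    by (rule order_tendstoD(2))
  have "eventually (\<lambda>m. \<forall>v\<in>cbox 0 1. dist (S m v) (h v) < \<eta>) sequentially"
    using S \<eta> unfolding uniform_limit_iff by blast
  moreover have "eventually (\<lambda>m. \<forall>j. 1 / real (\<nu> m$j) < d) sequentially"
    by (intro eventually_all_finite order_tendstoD(2)[OF inv d(1)])
  moreover have "eventually (\<lambda>m. \<forall>j. 0 < \<nu> m$j) sequentially"
    unfolding less_eq_Suc_le by (intro eventually_all_finite filterlim_at_top[THEN iffD1, OF \<nu>, rule_format])
  ultimately show ?thesis
    using small
  proof eventually_elim
    case (elim m)
    show ?case
    proof (intro allI impI)
      fix k :: "3 \<Rightarrow> nat" and z :: "real^3"
      assume k: "\<forall>j. k j \<le> \<nu> m$j" and z: "z \<in> cbox 0 1"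
        and kz: "\<forall>j. \<bar>real (k j) / real (\<nu> m$j) - z$j\<bar> \<le> 1 / real (\<nu> m$j)"
      define p :: "real^3" where "p = (\<chi> j. real (k j) / real (\<nu> m$j))"
      define p0 :: "real^3" where "p0 = (\<chi> j. if j = 1 then s0 else real (k j) / real (\<nu> m$j))"
      define z0 :: "real^3" where "z0 = vector [s0, z$2, z$3]"
      have z01: "0 \<le> z$j" "z$j \<le> 1" for j
        using z by (auto simp: mem_box_cart)
      have ratio: "real (k j) / real (\<nu> m$j) \<le> 1" for j
        using k elim(3) by (simp add: divide_le_eq_1)
      have boxes: "p \<in> cbox 0 1" "p0 \<in> cbox 0 1" "z0 \<in> cbox 0 1"
        using ratio s0 z01 by (auto simp: p_def p0_def z0_def mem_box_cart forall_3)
      have near: "\<bar>real (k j) / real (\<nu> m$j) - z$j\<bar> < d" for j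
        using kz elim(2) by (meson le_less_trans)
      have "\<bar>h p - h z\<bar> < \<eta>"
        using near by (intro d(2) boxes z) (simp add: p_def)
      moreover have "\<bar>S m p - h p\<bar> < \<eta>"
        using elim(1) boxes(1) by (simp add: dist_real_def)
      ultimately have 1: "\<bar>S m p - h z\<bar> \<le> 2 * \<eta>"
        by linarith
      have "\<bar>p0$j - z0$j\<bar> < d" for j
        using near[of j] d(1) exhaust_3[of j] by (auto simp: p0_def z0_def)
      then have "\<bar>h p0 - h z0\<bar> < \<eta>"
        by (intro d(2) boxes)
      moreover have "\<bar>S m p0 - h p0\<bar> < \<eta>"
        using elim(1) boxes(2) by (simp add: dist_real_def)
      ultimately have 2: "\<bar>S m p0 - h z0\<bar> \<le> 2 * \<eta>"
        by linarith
      have \<rho>0: "0 \<le> \<rho> m"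
        by (simp add: \<rho>_def)
      have M0: "0 \<le> M"
        using order_trans[OF abs_ge_zero M[OF z]] .
      have p1: "0 \<le> p$1" "p$1 \<le> 1" "\<bar>p$1 - z$1\<bar> \<le> 1 / real (\<nu> m$1)"
        using ratio kz by (simp_all add: p_def)
      have frac: "real (k 1) / real (nat \<lfloor>real (\<nu> m$1) * s0\<rfloor>) = p$1 * \<rho> m"
        using elim(3) by (simp add: p_def \<rho>_def)
      have "p$1 * \<rho> m * S m p0 - z$1 * inverse s0 * h z0 =
          p$1 * \<rho> m * (S m p0 - h z0) + h z0 * (\<rho> m * (p$1 - z$1) + z$1 * (\<rho> m - inverse s0))"
        by (simp add: algebra_simps)
      also have "\<bar>\<dots>\<bar> \<le> \<bar>p$1 * \<rho> m * (S m p0 - h z0)\<bar> + \<bar>h z0 * (\<rho> m * (p$1 - z$1) + z$1 * (\<rho> m - inverse s0))\<bar>"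
        by (rule abs_triangle_ineq)
      also have "\<bar>p$1 * \<rho> m * (S m p0 - h z0)\<bar> \<le> (1 * \<rho> m) * (2 * \<eta>)"
        unfolding abs_mult using p1 \<rho>0 2 by (intro mult_mono) auto
      also have "\<bar>h z0 * (\<rho> m * (p$1 - z$1) + z$1 * (\<rho> m - inverse s0))\<bar> \<le>
          M * (\<rho> m * (1 / real (\<nu> m$1)) + \<bar>\<rho> m - inverse s0\<bar>)"
        unfolding abs_mult
      proof (intro mult_mono M boxes M0)
        have "\<bar>\<rho> m * (p$1 - z$1)\<bar> \<le> \<rho> m * (1 / real (\<nu> m$1))"
          unfolding abs_mult using \<rho>0 p1(3) by (intro mult_mono) auto
        moreover have "\<bar>z$1 * (\<rho> m - inverse s0)\<bar> \<le> 1 * \<bar>\<rho> m - inverse s0\<bar>"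
          unfolding abs_mult using z01[of 1] by (intro mult_mono) auto
        ultimately show "\<bar>\<rho> m * (p$1 - z$1) + z$1 * (\<rho> m - inverse s0)\<bar> \<le> \<rho> m * (1 / real (\<nu> m$1)) + \<bar>\<rho> m - inverse s0\<bar>"
          unfolding mult_1 by (rule order_trans[OF abs_triangle_ineq add_mono])
      qed simp
      finally have "\<bar>p$1 * \<rho> m * S m p0 - z$1 * inverse s0 * h z0\<bar> \<le>
          2 * \<eta> * \<rho> m + M * (\<rho> m * (1 / real (\<nu> m$1)) + \<bar>\<rho> m - inverse s0\<bar>)"
        by (simp add: mult.commute)
      with 1 elim(4) have "\<bar>S m p - p$1 * \<rho> m * S m p0 - (h z - z$1 * inverse s0 * h z0)\<bar> \<le> \<omega>"
        by linarith
      moreover have "centered s0 h z = h z - z$1 * inverse s0 * h z0"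
        by (simp add: centered_def z0_def divide_inverse)
      ultimately show "\<bar>S m (\<chi> j. real (k j) / real (\<nu> m$j)) - real (k 1) / real (nat \<lfloor>real (\<nu> m$1) * s0\<rfloor>) *
          S m (\<chi> j. if j = 1 then s0 else real (k j) / real (\<nu> m$j)) - centered s0 h z\<bar> \<le> \<omega>"
        unfolding frac p_def[symmetric] p0_def[symmetric] by simp
    qed
  qed
qed

text \<open>The index point \<open>x m\<close> moves with \<open>m\<close>, which is what makes the convergence uniform on compact sets.\<close>

lemma F_stat_tendsto:
  fixes \<nu> :: "nat \<Rightarrow> nat^3" and e :: "nat \<Rightarrow> int^3 \<Rightarrow> 'w \<Rightarrow> real" and w :: "nat \<Rightarrow> 'w"
    and x :: "nat \<Rightarrow> real^4"
  assumes s0: "0 < s0" "s0 < 1" and \<Omega>: "\<And>j. 0 < \<Omega>$j"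
    and \<nu>: "\<And>j. filterlim (\<lambda>m. \<nu> m$j) at_top sequentially"
    and periods: "\<And>j. (\<lambda>m. real (\<nu> m$j) * \<tau> j (\<nu> m$j)) \<longlonglongrightarrow> \<tau>bar$j"
    and h: "continuous_on (cbox 0 1) h"
    and S: "uniform_limit (cbox 0 1) (\<lambda>m v. partial_sum (e m) (\<nu> m) v (w m)) h sequentially"
    and f: "\<And>(n::nat^3) i1 k1 i2 i3. i1 \<in> {1..n$1} \<Longrightarrow> k1 \<in> {1..n$1} \<Longrightarrow> i2 \<in> {1..n$2} \<Longrightarrow> i3 \<in> {1..n$3} \<Longrightarrow>
      f (real i1 * \<tau> 1 (n$1)) (real i2 * \<tau> 2 (n$2)) (real i3 * \<tau> 3 (n$3)) =
      f (real k1 * \<tau> 1 (n$1)) (real i2 * \<tau> 2 (n$2)) (real i3 * \<tau> 3 (n$3))"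
    and x: "\<And>m. 0 \<le> x m$1 \<and> x m$1 \<le> 1" and lim: "x \<longlonglongrightarrow> x'"
  shows "(\<lambda>m. F_stat \<Omega> \<tau> s0 (\<nu> m) (obs f (e m) \<tau> (\<nu> m)) (x m) (w m)) \<longlonglongrightarrow>
    sqrt (\<Prod>j\<in>UNIV. \<tau>bar$j) * sinc_faces \<Omega> (vector [x'$2, x'$3, x'$4]) \<tau>bar (vector [x'$1, 1, 1]) (centered s0 h)"
proof -
  define y :: "nat \<Rightarrow> real^3" where "y m = vector [x m$2, x m$3, x m$4]" for m
  define c :: "nat \<Rightarrow> real^3" where "c m = (\<chi> j. real (\<nu> m$j) * \<tau> j (\<nu> m$j))" for m
  define P where "P m = nat \<lfloor>real (\<nu> m$1) * s0\<rfloor>" for m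
  define L :: "nat \<Rightarrow> 3 \<Rightarrow> nat" where "L m = (\<lambda>j. if j = 1 then nat \<lfloor>real (\<nu> m$1) * x m$1\<rfloor> else \<nu> m$j)" for m
  define b :: "nat \<Rightarrow> real^3" where "b m = (\<chi> j. real (L m j) / real (\<nu> m$j))" for m
  define \<alpha> where "\<alpha> m = (\<lambda>j t. sinc_kernel (\<Omega>$j) (y m$j - c m$j * t))" for m
  define T where "T m = (\<lambda>k. partial_sum (e m) (\<nu> m) (\<chi> j. real (k j) / real (\<nu> m$j)) (w m) -
      real (k 1) / real (P m) * partial_sum (e m) (\<nu> m) (\<chi> j. if j = 1 then s0 else real (k j) / real (\<nu> m$j)) (w m))" for m
  define G where "G m = (\<Sum>k\<in>PiE UNIV (\<lambda>j. {..L m j}). T m k * (\<Prod>j\<in>UNIV. if k j < L m j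
      then \<alpha> m j (real (k j) / real (\<nu> m$j)) - \<alpha> m j (real (Suc (k j)) / real (\<nu> m$j))
      else \<alpha> m j (real (L m j) / real (\<nu> m$j))))" for m
  have L_le: "L m j \<le> \<nu> m$j" for m j
  proof -
    have "real (\<nu> m$1) * x m$1 \<le> real (\<nu> m$1) * 1"
      using x by (intro mult_left_mono) auto
    then show ?thesis
      unfolding L_def by (cases "j = 1") (simp_all, linarith)
  qed
  have b_box: "b m \<in> cbox 0 1" for m
    using L_le[of m] by (auto simp: b_def mem_box_cart divide_le_eq_1)
  have pos: "eventually (\<lambda>m. \<forall>j. 0 < \<nu> m$j) sequentially"
    unfolding less_eq_Suc_le by (intro eventually_all_finite filterlim_at_top[THEN iffD1, OF \<nu>, rule_format])
  have y_lim: "y \<longlonglongrightarrow> vector [x'$2, x'$3, x'$4]"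
  proof (rule vec_tendstoI)
    fix j
    show "(\<lambda>m. y m$j) \<longlonglongrightarrow> vector [x'$2, x'$3, x'$4] $ j"
      using tendsto_vec_nth[OF lim] exhaust_3[of j] by (auto simp: y_def)
  qed
  have c_lim: "c \<longlonglongrightarrow> \<tau>bar"
    by (rule vec_tendstoI) (simp add: c_def periods)
  have b_lim: "b \<longlonglongrightarrow> vector [x'$1, 1, 1]"
  proof (rule vec_tendstoI)
    fix j
    have "(\<lambda>m. b m$1) \<longlonglongrightarrow> x'$1"
      unfolding b_def L_def using floor_ratio_tendsto[OF \<nu> tendsto_vec_nth[OF lim]] x by simp
    moreover have "(\<lambda>m. b m$j) \<longlonglongrightarrow> 1" if "j \<noteq> 1"
      by (rule tendsto_eventually, rule eventually_mono[OF pos]) (use that in \<open>simp add: b_def L_def\<close>)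
    ultimately show "(\<lambda>m. b m$j) \<longlonglongrightarrow> vector [x'$1, 1, 1] $ j"
      using exhaust_3[of j] by auto
  qed
  have H: "continuous_on (cbox 0 1) (centered s0 h)"
    using h s0 by (intro continuous_on_centered) auto
  define A where "A m = sinc_faces \<Omega> (y m) (c m) (b m) (centered s0 h)" for m
  have A_lim: "A \<longlonglongrightarrow> sinc_faces \<Omega> (vector [x'$2, x'$3, x'$4]) \<tau>bar (vector [x'$1, 1, 1]) (centered s0 h)"
    unfolding A_def by (rule sinc_faces_tendsto[OF \<Omega> H b_box b_lim y_lim c_lim])
  obtain K where K: "0 \<le> K"
    and \<alpha>K: "\<And>m j t. 0 \<le> t \<Longrightarrow> t \<le> 1 \<Longrightarrow> \<bar>sinc_kernel (\<Omega>$j) (y m$j - c m$j * t)\<bar> \<le> K"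
    and uK: "\<And>m j t. 0 \<le> t \<Longrightarrow> t \<le> 1 \<Longrightarrow> \<bar>- (c m$j) * sinc_kernel_deriv (\<Omega>$j) (y m$j - c m$j * t)\<bar> \<le> K"
    by (rule sinc_shift_bounds[OF \<Omega> y_lim c_lim]; rule that; assumption)
  define C where "C = (\<Sum>v\<in>(UNIV::3 set set). K ^ card v * K ^ card (-v))"
  have C: "0 \<le> C"
    unfolding C_def using K by (intro sum_nonneg) simp
  have "(\<lambda>m. G m - A m) \<longlonglongrightarrow> 0"
  proof (rule LIMSEQ_I)
    fix r :: real
    assume r: "0 < r"
    define \<omega> where "\<omega> = r / (C + 1)"
    have \<omega>: "0 < \<omega>" "\<omega> * C < r"
      using r C by (auto simp: \<omega>_def field_simps)
    have "eventually (\<lambda>m. norm (G m - A m - 0) < r) sequentially"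
      using centered_partial_sums_close[OF s0 \<nu> h S \<omega>(1)] pos
    proof eventually_elim
      case (elim m)
      have "\<bar>G m - A m\<bar> \<le> \<omega> * C"
        unfolding G_def A_def sinc_faces_def b_def C_def \<alpha>_def
      proof (rule lattice_sum_minus_ibp_faces_le[OF H DERIV_sinc_shift[OF \<Omega>] isCont_sinc_deriv_shift[OF \<Omega>] \<alpha>K uK K
            less_imp_le[OF \<omega>(1)] _ L_le])
        show "\<bar>T m k - centered s0 h z\<bar> \<le> \<omega>" if "\<And>j. k j \<le> \<nu> m$j" "z \<in> cbox 0 1"
          "\<And>j. \<bar>real (k j) / real (\<nu> m$j) - z$j\<bar> \<le> 1 / real (\<nu> m$j)" for k z
          using elim(1) that unfolding T_def P_def by blast
      qed (use elim(2) in auto)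
      then show ?case
        using \<omega>(2) by simp
    qed
    then show "\<exists>m0. \<forall>m\<ge>m0. norm (G m - A m - 0) < r"
      unfolding eventually_sequentially .
  qed
  from tendsto_add[OF this A_lim]
  have "G \<longlonglongrightarrow> sinc_faces \<Omega> (vector [x'$2, x'$3, x'$4]) \<tau>bar (vector [x'$1, 1, 1]) (centered s0 h)"
    by simp
  moreover have "(\<lambda>m. sqrt (\<Prod>j\<in>UNIV. c m$j)) \<longlonglongrightarrow> sqrt (\<Prod>j\<in>UNIV. \<tau>bar$j)"
    using c_lim by (intro tendsto_intros tendsto_prod)
  ultimately have "(\<lambda>m. sqrt (\<Prod>j\<in>UNIV. c m$j) * G m) \<longlonglongrightarrow>
      sqrt (\<Prod>j\<in>UNIV. \<tau>bar$j) * sinc_faces \<Omega> (vector [x'$2, x'$3, x'$4]) \<tau>bar (vector [x'$1, 1, 1]) (centered s0 h)"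
    by (intro tendsto_mult)
  moreover have "eventually (\<lambda>m. 0 < P m) sequentially"
  proof -
    have "(\<lambda>m. real (P m) / real (\<nu> m$1)) \<longlonglongrightarrow> s0"
      unfolding P_def using s0 by (intro floor_ratio_tendsto[OF \<nu> tendsto_const]) auto
    from order_tendstoD(1)[OF this s0(1)] show ?thesis
      by eventually_elim (auto simp: zero_less_divide_iff)
  qed
  with pos have "eventually (\<lambda>m. sqrt (\<Prod>j\<in>UNIV. c m$j) * G m =
      F_stat \<Omega> \<tau> s0 (\<nu> m) (obs f (e m) \<tau> (\<nu> m)) (x m) (w m)) sequentially"
  proof eventually_elim
    case (elim m)
    have "F_stat \<Omega> \<tau> s0 (\<nu> m) (obs f (e m) \<tau> (\<nu> m)) (x m) (w m) =
        sqrt (\<Prod>j\<in>UNIV. real (\<nu> m$j) * \<tau> j (\<nu> m$j)) * G m"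
      unfolding G_def
    proof (rule F_stat_eq_lattice_sum[where P = "P m"])
      show "P m = nat \<lfloor>real (\<nu> m$1) * s0\<rfloor>" "0 < P m" "s0 \<le> 1" "x m$1 \<le> 1"
        using elim(2) s0 x by (auto simp: P_def)
      show "\<alpha> m = (\<lambda>j t. sinc_kernel (\<Omega>$j) (vector [x m$2, x m$3, x m$4] $ j - real (\<nu> m$j) * \<tau> j (\<nu> m$j) * t))"
        by (simp add: \<alpha>_def y_def c_def)
      show "0 < \<nu> m$j" for j
        using elim(1) by blast
      show "f (real i1 * \<tau> 1 (\<nu> m$1)) (real i2 * \<tau> 2 (\<nu> m$2)) (real i3 * \<tau> 3 (\<nu> m$3)) =
          f (real k1 * \<tau> 1 (\<nu> m$1)) (real i2 * \<tau> 2 (\<nu> m$2)) (real i3 * \<tau> 3 (\<nu> m$3))"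
        if "i1 \<in> {1..\<nu> m$1}" "k1 \<in> {1..\<nu> m$1}" "i2 \<in> {1..\<nu> m$2}" "i3 \<in> {1..\<nu> m$3}" for i1 k1 i2 i3
        using that by (rule f)
    qed (simp_all only: L_def T_def s0)
    then show ?case
      by (simp add: c_def)
  qed
  ultimately show ?thesis
    by (rule Lim_transform_eventually)
qed

text \<open>If the convergence is not uniform, a sequence of points at which it fails has a convergent subsequence.\<close>

lemma uniform_limit_compact_sequences:
  fixes F :: "nat \<Rightarrow> 'a::metric_space \<Rightarrow> real"
  assumes K: "compact K" and cont: "continuous_on K \<Phi>"
    and lim: "\<And>(r :: nat \<Rightarrow> nat) x x'. strict_mono r \<Longrightarrow> (\<And>m. x m \<in> K) \<Longrightarrow> x \<longlonglongrightarrow> x' \<Longrightarrow>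
      (\<lambda>m. F (r m) (x m)) \<longlonglongrightarrow> \<Phi> x'"
  shows "uniform_limit K F \<Phi> sequentially"
proof (rule ccontr)
  assume "\<not> ?thesis"
  then obtain d where d: "0 < d" "\<not> eventually (\<lambda>m. \<forall>x\<in>K. dist (F m x) (\<Phi> x) < d) sequentially"
    unfolding uniform_limit_iff by blast
  obtain r :: "nat \<Rightarrow> nat" where r: "strict_mono r" "\<And>m. \<exists>x\<in>K. d \<le> dist (F (r m) x) (\<Phi> x)"
    using not_eventually_sequentiallyD[OF d(2)] by (auto simp: not_less)
  then obtain x where x: "\<And>m. x m \<in> K" "\<And>m. d \<le> dist (F (r m) (x m)) (\<Phi> (x m))"
    by metis
  obtain x' q where q: "x' \<in> K" "strict_mono (q :: nat \<Rightarrow> nat)" "(x \<circ> q) \<longlonglongrightarrow> x'"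
    using K x(1) unfolding compact_def by blast
  have "(\<lambda>m. F (r (q m)) (x (q m))) \<longlonglongrightarrow> \<Phi> x'"
    using lim[of "r \<circ> q" "x \<circ> q" x'] strict_mono_o[OF r(1) q(2)] q(3) x(1) by (simp add: o_def)
  moreover have "(\<lambda>m. \<Phi> (x (q m))) \<longlonglongrightarrow> \<Phi> x'"
    using cont q x(1) unfolding continuous_on_sequentially by (auto simp: o_def)
  ultimately have "(\<lambda>m. dist (F (r (q m)) (x (q m))) (\<Phi> (x (q m)))) \<longlonglongrightarrow> dist (\<Phi> x') (\<Phi> x')"
    by (rule tendsto_dist)
  then have "d \<le> dist (\<Phi> x') (\<Phi> x')"
    using x(2) by (intro LIMSEQ_le_const) auto
  then show False
    using d(1) by simp
qed

text \<open>The limit process as a functional of a path \<open>h\<close>, which will be \<open>\<sigma> B\<close>.\<close>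

definition signal_limit :: "real^3 \<Rightarrow> real^3 \<Rightarrow> real \<Rightarrow> (real^3 \<Rightarrow> real) \<Rightarrow> real^4 \<Rightarrow> real" where
  "signal_limit \<Omega> \<tau>bar s0 h x = sqrt (\<Prod>j\<in>UNIV. \<tau>bar$j) *
     sinc_faces \<Omega> (vector [x$2, x$3, x$4]) \<tau>bar (vector [x$1, 1, 1]) (centered s0 h)"

lemma face_integral_mult: "face_integral v b (\<lambda>z. c * h z) u = c * face_integral v b h u"
  by (simp add: face_integral_def mult.assoc)

lemma sinc_faces_mult: "sinc_faces \<Omega> y c b (\<lambda>z. r * h z) = r * sinc_faces \<Omega> y c b h"
  unfolding sinc_faces_def ibp_faces_def face_integral_mult by (simp add: sum_distrib_left mult_ac)

lemma F_limit_eq_signal_limit: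
  fixes B :: "real^3 \<Rightarrow> 'v \<Rightarrow> real"
  assumes s0: "0 < s0" "s0 < 1" and \<Omega>: "\<And>j. 0 < \<Omega>$j"
    and B: "continuous_on (cbox 0 1) (\<lambda>v. B v \<omega>)" "\<And>z j. z \<in> cbox 0 1 \<Longrightarrow> z$j = 0 \<Longrightarrow> B z \<omega> = 0"
    and x: "0 < x$1" "x$1 \<le> 1"
  shows "F_limit \<Omega> \<tau>bar s0 \<sigma> B x \<omega> = signal_limit \<Omega> \<tau>bar s0 (\<lambda>v. \<sigma> * B v \<omega>) x"
proof -
  define y :: "real^3" where "y = vector [x$2, x$3, x$4]"
  define b :: "real^3" where "b = vector [x$1, 1, 1]"
  have b: "b \<in> cbox 0 1" "0 < b$j" for j
    using x exhaust_3[of j] by (auto simp: b_def mem_box_cart forall_3)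
  have kernel: "kernel \<Omega> (x$2 - \<tau>bar$1 * z$1) (x$3 - \<tau>bar$2 * z$2) (x$4 - \<tau>bar$3 * z$3) =
      (\<Prod>j\<in>UNIV. sinc_kernel (\<Omega>$j) (y$j - \<tau>bar$j * z$j))" for z :: "real^3"
    by (simp add: prod_UNIV_3 kernel_def y_def)
  have centred: "B_centered s0 B z \<omega> = centered s0 (\<lambda>v. B v \<omega>) z" for z
    by (simp add: B_centered_def centered_def)
  have "ibp_integral 0 b (\<lambda>z. \<Prod>j\<in>UNIV. sinc_kernel (\<Omega>$j) (y$j - \<tau>bar$j * z$j)) (centered s0 (\<lambda>v. B v \<omega>)) =
      sinc_faces \<Omega> y \<tau>bar b (centered s0 (\<lambda>v. B v \<omega>))"
    unfolding sinc_faces_def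
    by (rule ibp_integral_prod[OF b _ _ DERIV_sinc_shift[OF \<Omega>] isCont_sinc_deriv_shift[OF \<Omega>]])
      (use s0 B in \<open>auto intro: continuous_on_centered centered_zero\<close>)
  moreover have "centered s0 (\<lambda>v. \<sigma> * B v \<omega>) = (\<lambda>z. \<sigma> * centered s0 (\<lambda>v. B v \<omega>) z)"
    by (auto simp: centered_def fun_eq_iff right_diff_distrib)
  ultimately show ?thesis
    unfolding F_limit_def signal_limit_def kernel centred y_def[symmetric] b_def[symmetric] sinc_faces_mult
    by (simp add: sinc_faces_mult prod_UNIV_3)
qed

lemma continuous_on_signal_limit:
  assumes "0 < s0" "s0 < 1" "\<And>j. 0 < \<Omega>$j" "continuous_on (cbox 0 1) h" "\<And>x. x \<in> K \<Longrightarrow> 0 \<le> x$1 \<and> x$1 \<le> 1"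
  shows "continuous_on K (signal_limit \<Omega> \<tau>bar s0 h)"
  unfolding continuous_on_sequentially
proof (intro allI ballI impI, elim conjE)
  fix x :: "nat \<Rightarrow> real^4" and x'
  assume x: "\<forall>n. x n \<in> K" "x \<longlonglongrightarrow> x'" "x' \<in> K"
  have "(\<lambda>m. vector [x m$2, x m$3, x m$4] $ j :: real) \<longlonglongrightarrow> vector [x'$2, x'$3, x'$4] $ j" for j :: 3
    using exhaust_3[of j] tendsto_vec_nth[OF x(2)] by auto
  then have y: "(\<lambda>m. vector [x m$2, x m$3, x m$4] :: real^3) \<longlonglongrightarrow> vector [x'$2, x'$3, x'$4]"
    by (rule vec_tendstoI)
  have "(\<lambda>m. vector [x m$1, 1, 1] $ j :: real) \<longlonglongrightarrow> vector [x'$1, 1, 1] $ j" for j :: 3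
    using exhaust_3[of j] tendsto_vec_nth[OF x(2)] by auto
  then have b: "(\<lambda>m. vector [x m$1, 1, 1] :: real^3) \<longlonglongrightarrow> vector [x'$1, 1, 1]"
    by (rule vec_tendstoI)
  have "continuous_on (cbox 0 1) (centered s0 h)"
    using assms by (intro continuous_on_centered) auto
  from sinc_faces_tendsto[OF assms(3) this _ b y tendsto_const]
  show "((signal_limit \<Omega> \<tau>bar s0 h) \<circ> x) \<longlonglongrightarrow> signal_limit \<Omega> \<tau>bar s0 h x'"
    unfolding signal_limit_def o_def using x(1) assms(5)
    by (intro tendsto_mult tendsto_const) (auto simp: mem_box_cart forall_3)
qed

lemma F_stat_uniform_limit:
  fixes \<nu> :: "nat \<Rightarrow> nat^3" and e :: "nat \<Rightarrow> int^3 \<Rightarrow> 'w \<Rightarrow> real" and w :: "nat \<Rightarrow> 'w"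
  assumes s0: "0 < s0" "s0 < 1" and \<Omega>: "\<And>j. 0 < \<Omega>$j"
    and \<nu>: "\<And>j. filterlim (\<lambda>m. \<nu> m$j) at_top sequentially"
    and periods: "\<And>j. (\<lambda>m. real (\<nu> m$j) * \<tau> j (\<nu> m$j)) \<longlonglongrightarrow> \<tau>bar$j"
    and h: "continuous_on (cbox 0 1) h"
    and S: "uniform_limit (cbox 0 1) (\<lambda>m v. partial_sum (e m) (\<nu> m) v (w m)) h sequentially"
    and f: "\<And>(n::nat^3) i1 k1 i2 i3. i1 \<in> {1..n$1} \<Longrightarrow> k1 \<in> {1..n$1} \<Longrightarrow> i2 \<in> {1..n$2} \<Longrightarrow> i3 \<in> {1..n$3} \<Longrightarrow>
      f (real i1 * \<tau> 1 (n$1)) (real i2 * \<tau> 2 (n$2)) (real i3 * \<tau> 3 (n$3)) =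
      f (real k1 * \<tau> 1 (n$1)) (real i2 * \<tau> 2 (n$2)) (real i3 * \<tau> 3 (n$3))"
    and K: "compact K" "\<And>x. x \<in> K \<Longrightarrow> 0 \<le> x$1 \<and> x$1 \<le> 1"
  shows "uniform_limit K (\<lambda>m x. F_stat \<Omega> \<tau> s0 (\<nu> m) (obs f (e m) \<tau> (\<nu> m)) x (w m))
    (signal_limit \<Omega> \<tau>bar s0 h) sequentially"
proof (rule uniform_limit_compact_sequences[OF K(1)])
  show "continuous_on K (signal_limit \<Omega> \<tau>bar s0 h)"
    using s0 \<Omega> h K(2) by (rule continuous_on_signal_limit)
  fix r :: "nat \<Rightarrow> nat" and x x'
  assume r: "strict_mono r" and x: "\<And>m. x m \<in> K" "x \<longlonglongrightarrow> x'"
  have r_top: "filterlim r at_top sequentially"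
    using r by (rule filterlim_subseq)
  show "(\<lambda>m. F_stat \<Omega> \<tau> s0 (\<nu> (r m)) (obs f (e (r m)) \<tau> (\<nu> (r m))) (x m) (w (r m))) \<longlonglongrightarrow> signal_limit \<Omega> \<tau>bar s0 h x'"
    unfolding signal_limit_def
  proof (rule F_stat_tendsto[where \<nu> = "\<lambda>m. \<nu> (r m)" and e = "\<lambda>m. e (r m)" and w = "\<lambda>m. w (r m)" and f = f and \<tau> = \<tau>, OF s0 \<Omega> _ _ h _ f _ x(2)])
    show "filterlim (\<lambda>m. \<nu> (r m)$j) at_top sequentially" for j
      using filterlim_compose[OF \<nu> r_top] .
    show "(\<lambda>m. real (\<nu> (r m)$j) * \<tau> j (\<nu> (r m)$j)) \<longlonglongrightarrow> \<tau>bar$j" for j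
      using filterlim_compose[OF periods r_top] .
    show "uniform_limit (cbox 0 1) (\<lambda>m v. partial_sum (e (r m)) (\<nu> (r m)) v (w (r m))) h sequentially"
      using filterlim_compose[OF S r_top] .
    show "0 \<le> x m$1 \<and> x m$1 \<le> 1" for m
      using K(2) x(1) .
  qed
qed

section \<open>Measurability of the statistic and noise with a prescribed path\<close>

text \<open>The path is a linear combination, with random coefficients, of kernels that are switched on when \<open>s\<close>
  reaches \<open>l\<^sub>1 / n\<^sub>1\<close>.\<close>

lemma measurable_F_stat:
  fixes e :: "int^3 \<Rightarrow> 'w \<Rightarrow> real"
  assumes \<Omega>: "\<And>j. 0 < \<Omega>$j" and e: "\<And>i. e i \<in> borel_measurable M" and box: "\<And>x. x \<in> cbox a b \<Longrightarrow> x$1 \<le> 1"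
  shows "(\<lambda>w. restrict (\<lambda>x. F_stat \<Omega> \<tau> s0 n (obs f e \<tau> n) x w) (cbox a b)) \<in> M \<rightarrow>\<^sub>M skorohod_borel a b"
proof -
  define c where "c = (\<lambda>(l1, l2, l3) w. sqrt (\<tau> 1 (n$1) * \<tau> 2 (n$2) * \<tau> 3 (n$3)) *
    (obs f e \<tau> n l1 l2 l3 w - obs_mean s0 n (obs f e \<tau> n) l2 l3 w))"
  define \<phi> where "\<phi> = (\<lambda>(l1, l2, l3) (x :: real^4). kernel \<Omega> (x$2 - real l1 * \<tau> 1 (n$1)) (x$3 - real l2 * \<tau> 2 (n$2)) (x$4 - real l3 * \<tau> 3 (n$3)))"
  define g where "g = (\<lambda>l (x :: real^4). if real (fst l) / real (n$1) \<le> x$1 then \<phi> l x else 0)"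
  define I where "I = {1..n$1} \<times> {1..n$2} \<times> {1..n$3}"
  have "(\<lambda>w. restrict (\<lambda>x. \<Sum>l\<in>I. c l w * g l x) (cbox a b)) \<in> M \<rightarrow>\<^sub>M skorohod_borel a b"
  proof (rule measurable_skorohod_sum)
    show "finite I"
      by (simp add: I_def)
    show "c l \<in> borel_measurable M" for l
      unfolding c_def obs_mean_def obs_def using e by (cases l) simp
    have sinc: "continuous_on S (\<lambda>x. sinc_kernel (\<Omega>$j) (u x))" if "continuous_on S u"
      for S and u :: "real^4 \<Rightarrow> real" and j
      by (rule continuous_on_compose2[OF continuous_at_imp_continuous_on that])
        (use isCont_sinc_kernel[OF \<Omega>] in auto)
    have "continuous_on (cbox a b) (\<phi> l)" for l
      unfolding \<phi>_def kernel_def by (cases l) (simp, intro continuous_intros sinc)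
    then show "quadrant_regular a b (g l)" for l
      unfolding g_def by (rule quadrant_regular_step)
  qed
  moreover have "F_stat \<Omega> \<tau> s0 n (obs f e \<tau> n) x w = (\<Sum>l\<in>I. c l w * g l x)" if x: "x \<in> cbox a b" for x w
  proof -
    let ?t = "\<lambda>l1 l2 l3. c (l1, l2, l3) w * \<phi> (l1, l2, l3) x"
    have iff: "l1 \<in> {1..nat \<lfloor>real (n$1) * x$1\<rfloor>} \<longleftrightarrow> real l1 / real (n$1) \<le> x$1" if "l1 \<in> {1..n$1}" for l1
    proof -
      have "real l1 / real (n$1) \<le> x$1 \<longleftrightarrow> real l1 \<le> real (n$1) * x$1"
        using that by (simp add: divide_le_eq mult.commute)
      also have "\<dots> \<longleftrightarrow> l1 \<le> nat \<lfloor>real (n$1) * x$1\<rfloor>"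
      proof
        assume "l1 \<le> nat \<lfloor>real (n$1) * x$1\<rfloor>"
        moreover have "1 \<le> l1"
          using that by simp
        ultimately show "real l1 \<le> real (n$1) * x$1"
          by linarith
      qed (rule le_nat_floor)
      finally show ?thesis
        using that by simp
    qed
    have "real (n$1) * x$1 \<le> real (n$1) * 1"
      using box[OF x] by (intro mult_left_mono) auto
    then have le: "{1..nat \<lfloor>real (n$1) * x$1\<rfloor>} \<subseteq> {1..n$1}"
      by (auto intro: order_trans) linarith
    have "F_stat \<Omega> \<tau> s0 n (obs f e \<tau> n) x w = (\<Sum>l1 = 1..nat \<lfloor>real (n$1) * x$1\<rfloor>. \<Sum>l2 = 1..n$2. \<Sum>l3 = 1..n$3. ?t l1 l2 l3)"
      unfolding F_stat_def c_def \<phi>_def by (simp add: sum_distrib_left mult.assoc)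
    also have "\<dots> = (\<Sum>l1 = 1..n$1. if l1 \<in> {1..nat \<lfloor>real (n$1) * x$1\<rfloor>} then \<Sum>l2 = 1..n$2. \<Sum>l3 = 1..n$3. ?t l1 l2 l3 else 0)"
      using le by (subst sum.inter_restrict[symmetric]) (auto simp: Int_absorb1)
    also have "\<dots> = (\<Sum>l1 = 1..n$1. \<Sum>l2 = 1..n$2. \<Sum>l3 = 1..n$3. c (l1, l2, l3) w * g (l1, l2, l3) x)"
    proof (intro sum.cong refl)
      fix l1
      assume "l1 \<in> {1..n$1}"
      from iff[OF this] show "(if l1 \<in> {1..nat \<lfloor>real (n$1) * x$1\<rfloor>} then \<Sum>l2 = 1..n$2. \<Sum>l3 = 1..n$3. ?t l1 l2 l3 else 0) =
          (\<Sum>l2 = 1..n$2. \<Sum>l3 = 1..n$3. c (l1, l2, l3) w * g (l1, l2, l3) x)"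
        by (cases "real l1 / real (n$1) \<le> x$1") (simp_all only: g_def fst_conv if_True if_False mult_zero_right sum.neutral_const)
    qed
    also have "\<dots> = (\<Sum>l\<in>I. c l w * g l x)"
      unfolding I_def by (simp add: sum.cartesian_product)
    finally show ?thesis .
  qed
  ultimately show ?thesis
    by (simp cong: restrict_cong)
qed

text \<open>Outside the unit box the value is set to \<open>0\<close>: the path of a Brownian motion consists of random
  variables on the box only, and the noise below has to be random at every index.\<close>

definition lattice_value :: "nat \<Rightarrow> (real^3 \<Rightarrow> real) \<Rightarrow> nat \<Rightarrow> nat \<Rightarrow> nat \<Rightarrow> real" where
  "lattice_value n h i1 i2 i3 = (let v = vector [real i1 / real n, real i2 / real n, real i3 / real n]
     in if v \<in> cbox 0 1 then h v else 0)"

text \<open>The mixed backward difference in all three directions.\<close>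

definition lattice_increment :: "(nat \<Rightarrow> nat \<Rightarrow> nat \<Rightarrow> real) \<Rightarrow> nat \<Rightarrow> nat \<Rightarrow> nat \<Rightarrow> real" where
  "lattice_increment Q i1 i2 i3 =
     (let A = (\<lambda>i1 i2. Q i1 i2 i3 - Q i1 i2 (i3 - 1)); A' = (\<lambda>i1. A i1 i2 - A i1 (i2 - 1))
      in A' i1 - A' (i1 - 1))"

lemma sum_backward_differences: "(\<Sum>i = 1..(k::nat). g i - g (i - 1)) = g k - (g 0 :: real)"
  by (induction k) auto

text \<open>Telescoping in the three directions one after the other; the lower boundary terms vanish.\<close>

lemma sum_lattice_increment:
  assumes "\<And>i1 i2 i3. i1 = 0 \<or> i2 = 0 \<or> i3 = 0 \<Longrightarrow> Q i1 i2 i3 = 0"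
  shows "(\<Sum>i1 = 1..k1. \<Sum>i2 = 1..k2. \<Sum>i3 = 1..k3. lattice_increment Q i1 i2 i3) = Q k1 k2 k3"
proof -
  define A where "A i1 i2 i3 = Q i1 i2 i3 - Q i1 i2 (i3 - 1)" for i1 i2 i3
  define A' where "A' i1 i2 i3 = A i1 i2 i3 - A i1 (i2 - 1) i3" for i1 i2 i3
  have 3: "(\<Sum>i3 = 1..k3. A i1 i2 i3) = Q i1 i2 k3" for i1 i2
    unfolding A_def by (subst sum_backward_differences) (simp add: assms)
  have "(\<Sum>i2 = 1..k2. \<Sum>i3 = 1..k3. A' i1 i2 i3) = (\<Sum>i2 = 1..k2. Q i1 i2 k3 - Q i1 (i2 - 1) k3)" for i1
    unfolding A'_def sum_subtractf 3 ..
  then have 2: "(\<Sum>i2 = 1..k2. \<Sum>i3 = 1..k3. A' i1 i2 i3) = Q i1 k2 k3" for i1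
    by (subst (asm) sum_backward_differences) (simp add: assms)
  have "(\<Sum>i1 = 1..k1. \<Sum>i2 = 1..k2. \<Sum>i3 = 1..k3. A' i1 i2 i3 - A' (i1 - 1) i2 i3) =
      (\<Sum>i1 = 1..k1. Q i1 k2 k3 - Q (i1 - 1) k2 k3)"
    unfolding sum_subtractf 2 ..
  also have "\<dots> = Q k1 k2 k3"
    by (subst sum_backward_differences) (simp add: assms)
  finally show ?thesis
    by (simp add: lattice_increment_def A_def A'_def Let_def)
qed

text \<open>The factor undoes the normalisation of \<open>partial_sum\<close>, so that the partial sum process of this noise
  is \<open>h\<close> sampled on the lattice, provided that \<open>h\<close> vanishes on the lower faces.\<close>

definition increment_noise :: "nat \<Rightarrow> (real^3 \<Rightarrow> real) \<Rightarrow> int^3 \<Rightarrow> real" where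
  "increment_noise n h i = sqrt (real n * real n * real n) *
    lattice_increment (lattice_value n h) (nat (i$1)) (nat (i$2)) (nat (i$3))"

lemma partial_sum_increment_noise:
  assumes w: "h' w = h" and N: "0 < N" and h0: "\<And>z j. z \<in> cbox 0 1 \<Longrightarrow> z$j = 0 \<Longrightarrow> h z = 0" and v: "v \<in> cbox 0 1"
  shows "partial_sum (\<lambda>i w. increment_noise N (h' w) i) (\<chi> j. N) v w = h (\<chi> j. real (nat \<lfloor>real N * v$j\<rfloor>) / real N)"
proof -
  have "lattice_value N h i1 i2 i3 = 0" if "i1 = 0 \<or> i2 = 0 \<or> i3 = 0" for i1 i2 i3
  proof -
    let ?v = "vector [real i1 / real N, real i2 / real N, real i3 / real N] :: real^3"
    have "\<exists>j. ?v $ j = 0"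
      using that by (metis div_0 of_nat_0 vector_3)
    then show ?thesis
      unfolding lattice_value_def Let_def using h0[of ?v] by auto
  qed
  then have "partial_sum (\<lambda>i w. increment_noise N (h' w) i) (\<chi> j. N) v w =
      lattice_value N h (nat \<lfloor>real N * v$1\<rfloor>) (nat \<lfloor>real N * v$2\<rfloor>) (nat \<lfloor>real N * v$3\<rfloor>)"
    unfolding partial_sum_def increment_noise_def w vec_lambda_beta sum_distrib_left[symmetric] vector_3 nat_int
    using N by (simp only: sum_lattice_increment) simp
  also have "\<dots> = h (\<chi> j. real (nat \<lfloor>real N * v$j\<rfloor>) / real N)"
  proof -
    have "real (nat \<lfloor>real N * v$j\<rfloor>) / real N \<le> 1" for j
    proof -
      have "real N * v$j \<le> real N * 1"
        using v by (intro mult_left_mono) (auto simp: mem_box_cart)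
      then have "nat \<lfloor>real N * v$j\<rfloor> \<le> N"
        by linarith
      then show ?thesis
        using N by (simp add: divide_le_eq_1)
    qed
    then have "(\<chi> j. real (nat \<lfloor>real N * v$j\<rfloor>) / real N) \<in> cbox 0 (1 :: real^3)"
      by (auto simp: mem_box_cart)
    moreover have "(\<chi> j. real (nat \<lfloor>real N * v$j\<rfloor>) / real N) = (vector [real (nat \<lfloor>real N * v$1\<rfloor>) / real N,
        real (nat \<lfloor>real N * v$2\<rfloor>) / real N, real (nat \<lfloor>real N * v$3\<rfloor>) / real N] :: real^3)"
      by (simp add: vec_eq_iff forall_3)
    ultimately show ?thesis
      by (simp add: lattice_value_def Let_def)
  qed
  finally show ?thesis .
qed

lemma increment_noise_uniform_limit:
  fixes h :: "real^3 \<Rightarrow> real"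
  assumes h: "continuous_on (cbox 0 1) h" and h0: "\<And>z j. z \<in> cbox 0 1 \<Longrightarrow> z$j = 0 \<Longrightarrow> h z = 0" and w: "h' w = h"
  shows "uniform_limit (cbox 0 1) (\<lambda>m v. partial_sum (\<lambda>i w. increment_noise (Suc m) (h' w) i) (\<chi> j. Suc m) v w) h sequentially"
  unfolding uniform_limit_iff
proof (intro allI impI)
  fix e :: real
  assume e: "0 < e"
  obtain d where d: "0 < d" "\<And>x y. x \<in> cbox 0 1 \<Longrightarrow> y \<in> cbox 0 1 \<Longrightarrow> (\<And>j. \<bar>x$j - y$j\<bar> < d) \<Longrightarrow> \<bar>h x - h y\<bar> < e"
    using continuous_on_box_modulus[OF h e] by blast
  have "eventually (\<lambda>m. inverse (real (Suc m)) < d) sequentially"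
    using order_tendstoD(2)[OF LIMSEQ_inverse_real_of_nat d(1)] .
  then show "eventually (\<lambda>m. \<forall>v\<in>cbox 0 1. dist (partial_sum (\<lambda>i w. increment_noise (Suc m) (h' w) i) (\<chi> j. Suc m) v w) (h v) < e) sequentially"
  proof eventually_elim
    case (elim m)
    show ?case
    proof
      fix v :: "real^3"
      assume v: "v \<in> cbox 0 1"
      define p :: "real^3" where "p = (\<chi> j. real (nat \<lfloor>real (Suc m) * v$j\<rfloor>) / real (Suc m))"
      have near: "0 \<le> p$j \<and> p$j \<le> v$j \<and> v$j - p$j \<le> inverse (real (Suc m))" for j
      proof -
        have "0 \<le> real (Suc m) * v$j"
          using v by (simp add: mem_box_cart)
        then have "real (nat \<lfloor>real (Suc m) * v$j\<rfloor>) \<le> v$j * real (Suc m)"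
          "v$j * real (Suc m) \<le> real (nat \<lfloor>real (Suc m) * v$j\<rfloor>) + 1"
          by (simp_all only: mult.commute, linarith+)
        then have "p$j \<le> v$j" "v$j \<le> (real (nat \<lfloor>real (Suc m) * v$j\<rfloor>) + 1) / real (Suc m)"
          unfolding p_def vec_lambda_beta
          by (simp_all only: pos_divide_le_eq[of "real (Suc m)"] pos_le_divide_eq[of "real (Suc m)"] of_nat_0_less_iff zero_less_Suc)
        moreover have "(real (nat \<lfloor>real (Suc m) * v$j\<rfloor>) + 1) / real (Suc m) = p$j + inverse (real (Suc m))"
          by (simp only: p_def vec_lambda_beta add_divide_distrib inverse_eq_divide)
        moreover have "0 \<le> p$j"
          by (simp add: p_def)
        ultimately show ?thesis
          by linarith
      qed
      have "p \<in> cbox 0 1"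
        using near v order_trans unfolding mem_box_cart by (metis one_index zero_index)
      moreover have "\<bar>p$j - v$j\<bar> < d" for j
        using near[of j] elim by linarith
      ultimately have "\<bar>h p - h v\<bar> < e"
        using v by (intro d(2))
      then show "dist (partial_sum (\<lambda>i w. increment_noise (Suc m) (h' w) i) (\<chi> j. Suc m) v w) (h v) < e"
        by (subst partial_sum_increment_noise[of h' w h, OF w _ h0 v]) (simp_all add: p_def dist_real_def)
    qed
  qed
qed

section \<open>Weak convergence of the detector statistic\<close>

lemma min_at_top_filterlim:
  assumes "\<And>m. m \<le> Min (range (($) (\<nu> m)))"
  shows "filterlim \<nu> min_at_top sequentially" "filterlim (\<lambda>m. \<nu> m$j) at_top sequentially"
proof -
  show "filterlim \<nu> min_at_top sequentially"
    unfolding min_at_top_def filterlim_filtercomap_iff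
    by (rule filterlim_at_top_mono[OF filterlim_ident]) (use assms in auto)
  show "filterlim (\<lambda>m. \<nu> m$j) at_top sequentially"
  proof (rule filterlim_at_top_mono[OF filterlim_ident always_eventually], rule allI)
    fix m
    have "Min (range (($) (\<nu> m))) \<le> \<nu> m$j"
      by (intro Min_le) auto
    then show "m \<le> \<nu> m$j"
      using assms[of m] by linarith
  qed
qed

theorem theorem4p2:
  fixes M :: "'w measure" and N :: "'v measure"
    and \<epsilon> :: "int^3 \<Rightarrow> 'w \<Rightarrow> real" and B :: "real^3 \<Rightarrow> 'v \<Rightarrow> real"
    and f f0 :: "real \<Rightarrow> real \<Rightarrow> real \<Rightarrow> real"
    and \<Omega> \<tau>bar :: "real^3" and \<tau> :: "3 \<Rightarrow> nat \<Rightarrow> real" and s0 \<sigma> :: real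
  assumes "prob_space M" and "prob_space N"
    and "0 < s0" and "s0 < 1" and "\<And>j. 0 < \<Omega>$j" and "\<And>j. 0 < \<tau>bar$j"
    and "\<And>j m. 1 \<le> m \<Longrightarrow> 0 < \<tau> j m"
    and stationary: "weakly_stationary M \<epsilon>"
    and mean_zero: "\<And>i. (\<integral>\<omega>. \<epsilon> i \<omega> \<partial>M) = 0"
    and "0 < \<sigma>" and variance: "long_run_variance M \<epsilon> (\<sigma>\<^sup>2)"
    and brownian: "brownian_motion N B"
    and fclt: "converges_weakly 0 1 min_at_top M (\<lambda>n. partial_sum \<epsilon> n) N (\<lambda>v \<omega>. \<sigma> * B v \<omega>)"
    and periods: "\<And>j. ((\<lambda>n. real (n$j) * \<tau> j (n$j)) \<longlongrightarrow> \<tau>bar$j) min_at_top"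
    and time_constant: "\<And>t r2 r3. t \<in> {0..\<tau>bar$1} \<Longrightarrow> r2 \<in> {0..\<tau>bar$2} \<Longrightarrow> r3 \<in> {0..\<tau>bar$3} \<Longrightarrow>
      f0 t r2 r3 = f0 0 r2 r3"
    and time_constant_sampling: "\<And>(n::nat^3) i1 k1 i2 i3.
      i1 \<in> {1..n$1} \<Longrightarrow> k1 \<in> {1..n$1} \<Longrightarrow> i2 \<in> {1..n$2} \<Longrightarrow> i3 \<in> {1..n$3} \<Longrightarrow>
      f0 (real i1 * \<tau> 1 (n$1)) (real i2 * \<tau> 2 (n$2)) (real i3 * \<tau> 3 (n$3)) =
      f0 (real k1 * \<tau> 1 (n$1)) (real i2 * \<tau> 2 (n$2)) (real i3 * \<tau> 3 (n$3))"
    and H0: "f = f0"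
  shows "converges_weakly (vector [s0, 0, 0, 0]) (vector [1, \<tau>bar$1, \<tau>bar$2, \<tau>bar$3]) min_at_top
    M (\<lambda>n. F_stat \<Omega> \<tau> s0 n (obs f \<epsilon> \<tau> n))
    N (F_limit \<Omega> \<tau>bar s0 \<sigma> B)"
proof -
  note s0 = \<open>0 < s0\<close> \<open>s0 < 1\<close> and \<Omega> = \<open>\<And>j. 0 < \<Omega>$j\<close>
  define a :: "real^4" where "a = vector [s0, 0, 0, 0]"
  define b :: "real^4" where "b = vector [1, \<tau>bar$1, \<tau>bar$2, \<tau>bar$3]"
  have x1: "s0 \<le> x$1 \<and> x$1 \<le> 1" if "x \<in> cbox a b" for x
    using that by (simp add: a_def b_def mem_box_cart forall_4 vector_4)
  have x01: "0 \<le> x$1 \<and> x$1 \<le> 1" if "x \<in> cbox a b" for x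
    using x1[OF that] s0 by linarith
  interpret S': Metric_space "skorohod_space a b" "skorohod_dist a b"
    by (rule Metric_space_skorohod)
  have borel_eq: "skorohod_borel u v = sigma (skorohod_space u v)
      {U. openin (Metric_space.mtopology (skorohod_space u v) (skorohod_dist u v)) U}" for u v :: "real^'q::finite"
    by (simp add: skorohod_borel_def skorohod_topology_def)
  have in_space: "Y w \<in> skorohod_space u v" if "Y \<in> R \<rightarrow>\<^sub>M skorohod_borel u v" "w \<in> space R"
    for Y u w and v :: "real^'q::finite" and R :: "'r measure"
    using measurable_space[OF that] by (simp add: skorohod_borel_def space_measure_of_conv)
  have \<epsilon>: "\<epsilon> i \<in> borel_measurable M" for i
    using stationary unfolding weakly_stationary_def by blast

  obtain S' Z' where S': "\<And>n. S' n \<in> M \<rightarrow>\<^sub>M skorohod_borel 0 1"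
      "\<And>n. AE w in M. \<forall>v\<in>cbox 0 1. S' n w v = partial_sum \<epsilon> n v w"
    and Z': "Z' \<in> N \<rightarrow>\<^sub>M skorohod_borel 0 1" "AE \<omega> in N. \<forall>v\<in>cbox 0 1. Z' \<omega> v = \<sigma> * B v \<omega>"
    and conv: "\<And>g. continuous_map (skorohod_topology 0 1) euclideanreal g \<Longrightarrow>
      bounded (g ` skorohod_space 0 1) \<Longrightarrow> ((\<lambda>n. \<integral>w. g (S' n w) \<partial>M) \<longlongrightarrow> (\<integral>\<omega>. g (Z' \<omega>) \<partial>N)) min_at_top"
    using fclt unfolding converges_weakly_def skorohod_version_def by blast

  have "AE \<omega> in N. continuous_on (cbox 0 1) (\<lambda>v. B v \<omega>) \<and> (\<forall>v\<in>cbox 0 1. (\<exists>j. v$j = 0) \<longrightarrow> B v \<omega> = 0)"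
    using brownian unfolding brownian_motion_def by auto
  then obtain N0 where N0: "N0 \<in> null_sets N"
    "\<And>\<omega>. \<omega> \<in> space N \<Longrightarrow> \<omega> \<notin> N0 \<Longrightarrow> continuous_on (cbox 0 1) (\<lambda>v. B v \<omega>)"
    "\<And>\<omega> v j. \<omega> \<in> space N \<Longrightarrow> \<omega> \<notin> N0 \<Longrightarrow> v \<in> cbox 0 1 \<Longrightarrow> v$j = 0 \<Longrightarrow> B v \<omega> = 0"
    unfolding eventually_ae_filter by blast
  \<comment> \<open>On the exceptional null set the path is replaced by \<open>0\<close>; afterwards every path is continuous and
    vanishes on the lower faces.\<close>
  define h where "h \<omega> v = (if \<omega> \<in> N0 then 0 else \<sigma> * B v \<omega>)" for \<omega> v
  have h_cont: "continuous_on (cbox 0 1) (h \<omega>)" if "\<omega> \<in> space N" for \<omega>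
    using N0(2)[OF that] unfolding h_def by (cases "\<omega> \<in> N0") (auto intro!: continuous_intros)
  have h_zero: "h \<omega> v = 0" if "\<omega> \<in> space N" "v \<in> cbox 0 1" "v$j = 0" for \<omega> v j
    using N0(3)[OF that(1) _ that(2,3)] by (auto simp: h_def)
  have h_meas: "(\<lambda>\<omega>. h \<omega> v) \<in> borel_measurable N" if "v \<in> cbox 0 1" for v
  proof -
    have [measurable]: "B v \<in> borel_measurable N" "N0 \<in> sets N"
      using brownian that N0(1) unfolding brownian_motion_def by auto
    show ?thesis
      unfolding h_def by measurable
  qed
  define X' where "X' n w = restrict (\<lambda>x. F_stat \<Omega> \<tau> s0 n (obs f \<epsilon> \<tau> n) x w) (cbox a b)" for n w
  define W' where "W' \<omega> = restrict (signal_limit \<Omega> \<tau>bar s0 (h \<omega>)) (cbox a b)" for \<omega>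
  have X': "X' n \<in> M \<rightarrow>\<^sub>M skorohod_borel a b" for n
    unfolding X'_def using \<Omega> \<epsilon> x1 by (intro measurable_F_stat) auto
  have limit_cont: "continuous_on (cbox a b) (signal_limit \<Omega> \<tau>bar s0 (h \<omega>))" if "\<omega> \<in> space N" for \<omega>
    using continuous_on_signal_limit[OF s0 \<Omega> h_cont[OF that] x01] .
  have W'_in: "W' \<omega> \<in> skorohod_space a b" if "\<omega> \<in> space N" for \<omega>
    unfolding W'_def by (intro restrict_in_skorohod_space quadrant_regular_continuous limit_cont that)
  have lim_box: "(\<lambda>k. skorohod_dist a b (restrict (Y k) (cbox a b)) (W' \<omega>)) \<longlonglongrightarrow> 0"
    if "\<omega> \<in> space N" "\<And>k. restrict (Y k) (cbox a b) \<in> skorohod_space a b"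
      "uniform_limit (cbox a b) Y (signal_limit \<Omega> \<tau>bar s0 (h \<omega>)) sequentially" for \<omega> Y
    by (rule skorohod_dist_tendsto_uniform[OF that(2) W'_in[OF that(1)]])
      (rule uniform_limit_cong'[THEN iffD1, OF _ _ that(3)], auto simp: W'_def)

  have periods_seq: "(\<lambda>m. real (\<nu> m$j) * \<tau> j (\<nu> m$j)) \<longlonglongrightarrow> \<tau>bar$j"
    if "\<And>m. m \<le> Min (range (($) (\<nu> m)))" for \<nu> j
    using filterlim_compose[OF periods min_at_top_filterlim(1)[OF that]] .

  \<comment> \<open>Measurability of the limit: it is the limit of the statistics for signal \<open>0\<close> and noise made of the
    lattice increments of the path.\<close>
  have W': "W' \<in> N \<rightarrow>\<^sub>M skorohod_borel a b"
    unfolding borel_eq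
  proof (rule S'.measurable_mtopology_limit)
    define e where "e m = (\<lambda>i \<omega>. increment_noise (Suc m) (h \<omega>) i)" for m
    define \<nu> :: "nat \<Rightarrow> nat^3" where "\<nu> m = (\<chi> j. Suc m)" for m
    let ?X = "\<lambda>m \<omega>. restrict (\<lambda>x. F_stat \<Omega> \<tau> s0 (\<nu> m) (obs (\<lambda>_ _ _. 0) (e m) \<tau> (\<nu> m)) x \<omega>) (cbox a b)"
    have "e m i \<in> borel_measurable N" for m i
    proof -
      have "(\<lambda>\<omega>. lattice_value n (h \<omega>) i1 i2 i3) \<in> borel_measurable N" for n i1 i2 i3
        unfolding lattice_value_def Let_def using h_meas by (cases "vector [real i1 / real n, real i2 / real n, real i3 / real n] \<in> cbox 0 (1 :: real^3)") auto
      then show ?thesis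
        unfolding e_def increment_noise_def lattice_increment_def Let_def by measurable
    qed
    then have meas: "?X m \<in> N \<rightarrow>\<^sub>M skorohod_borel a b" for m
      using \<Omega> x1 by (intro measurable_F_stat) auto
    then show "?X m \<in> N \<rightarrow>\<^sub>M sigma (skorohod_space a b) {U. openin S'.mtopology U}" for m
      by (simp add: borel_eq)
    fix \<omega>
    assume \<omega>: "\<omega> \<in> space N"
    show "W' \<omega> \<in> skorohod_space a b"
      by (rule W'_in[OF \<omega>])
    have rank: "m \<le> Min (range (($) (\<nu> m)))" for m
      by (simp add: \<nu>_def)
    show "(\<lambda>m. skorohod_dist a b (?X m \<omega>) (W' \<omega>)) \<longlonglongrightarrow> 0"
    proof (rule lim_box[OF \<omega>])
      show "?X m \<omega> \<in> skorohod_space a b" for m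
        by (rule in_space[OF meas \<omega>])
      show "uniform_limit (cbox a b) (\<lambda>m x. F_stat \<Omega> \<tau> s0 (\<nu> m) (obs (\<lambda>_ _ _. 0) (e m) \<tau> (\<nu> m)) x \<omega>)
          (signal_limit \<Omega> \<tau>bar s0 (h \<omega>)) sequentially"
      proof (rule F_stat_uniform_limit[OF s0 \<Omega> min_at_top_filterlim(2)[OF rank] periods_seq[OF rank] h_cont[OF \<omega>]])
        show "uniform_limit (cbox 0 1) (\<lambda>m v. partial_sum (e m) (\<nu> m) v \<omega>) (h \<omega>) sequentially"
          unfolding e_def \<nu>_def by (rule increment_noise_uniform_limit[OF h_cont[OF \<omega>] h_zero[OF \<omega>]]) auto
      qed (use x01 in auto)
    qed
  qed

  \<comment> \<open>Skorohod convergence of partial sums to a Brownian path is uniform, so the deterministic limit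
    theorem applies outcome by outcome.\<close>
  have path: "AE \<omega> in N. \<forall>\<nu> w. (\<forall>k. k \<le> Min (range (($) (\<nu> k))) \<and> w k \<in> space M \<and>
        (\<forall>v\<in>cbox 0 1. S' (\<nu> k) (w k) v = partial_sum \<epsilon> (\<nu> k) v (w k))) \<longrightarrow>
      (\<lambda>k. skorohod_dist 0 1 (S' (\<nu> k) (w k)) (Z' \<omega>)) \<longlonglongrightarrow> 0 \<longrightarrow>
      (\<lambda>k. skorohod_dist a b (X' (\<nu> k) (w k)) (W' \<omega>)) \<longlonglongrightarrow> 0"
    using Z'(2) AE_not_in[OF N0(1)] AE_space
  proof eventually_elim
    case (elim \<omega>)
    note \<omega> = elim(3)
    have Zh: "Z' \<omega> v = h \<omega> v" if "v \<in> cbox 0 1" for v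
      using elim(1,2) that by (simp add: h_def)
    show ?case
    proof (intro allI impI)
      fix \<nu> w
      assume *: "\<forall>k. k \<le> Min (range (($) (\<nu> k))) \<and> w k \<in> space M \<and>
          (\<forall>v\<in>cbox 0 1. S' (\<nu> k) (w k) v = partial_sum \<epsilon> (\<nu> k) v (w k))"
        and lim: "(\<lambda>k. skorohod_dist 0 1 (S' (\<nu> k) (w k)) (Z' \<omega>)) \<longlonglongrightarrow> 0"
      have rank: "k \<le> Min (range (($) (\<nu> k)))" and w: "w k \<in> space M"
        and good: "v \<in> cbox 0 1 \<Longrightarrow> S' (\<nu> k) (w k) v = partial_sum \<epsilon> (\<nu> k) v (w k)" for k v
        using * by blast+
      have "continuous_on (cbox 0 1) (Z' \<omega>)"
        using h_cont[OF \<omega>] Zh by (simp cong: continuous_on_cong)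
      from uniform_limit_skorohod[OF in_space[OF S'(1) w] in_space[OF Z'(1) \<omega>] this lim]
      have S_lim: "uniform_limit (cbox 0 1) (\<lambda>k v. partial_sum \<epsilon> (\<nu> k) v (w k)) (h \<omega>) sequentially"
        by (rule uniform_limit_cong'[THEN iffD1, rotated 2]) (simp_all add: good Zh)
      show "(\<lambda>k. skorohod_dist a b (X' (\<nu> k) (w k)) (W' \<omega>)) \<longlonglongrightarrow> 0"
        unfolding X'_def
      proof (rule lim_box[OF \<omega>])
        show "restrict (\<lambda>x. F_stat \<Omega> \<tau> s0 (\<nu> k) (obs f \<epsilon> \<tau> (\<nu> k)) x (w k)) (cbox a b) \<in> skorohod_space a b" for k
          using in_space[OF X' w] unfolding X'_def .
        show "uniform_limit (cbox a b) (\<lambda>k x. F_stat \<Omega> \<tau> s0 (\<nu> k) (obs f \<epsilon> \<tau> (\<nu> k)) x (w k))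
            (signal_limit \<Omega> \<tau>bar s0 (h \<omega>)) sequentially"
        proof (rule F_stat_uniform_limit[where e = "\<lambda>_. \<epsilon>" and \<nu> = \<nu> and w = w and f = f and \<tau> = \<tau> and K = "cbox a b",
              OF s0 \<Omega> min_at_top_filterlim(2)[OF rank] periods_seq[OF rank] h_cont[OF \<omega>] S_lim])
          show "f (real i1 * \<tau> 1 (n$1)) (real i2 * \<tau> 2 (n$2)) (real i3 * \<tau> 3 (n$3)) =
              f (real k1 * \<tau> 1 (n$1)) (real i2 * \<tau> 2 (n$2)) (real i3 * \<tau> 3 (n$3))"
            if "i1 \<in> {1..n$1}" "k1 \<in> {1..n$1}" "i2 \<in> {1..n$2}" "i3 \<in> {1..n$3}" for n :: "nat^3" and i1 k1 i2 i3
            unfolding H0 using that by (rule time_constant_sampling)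
          show "0 \<le> x$1 \<and> x$1 \<le> 1" if "x \<in> cbox a b" for x
            by (rule x01[OF that])
        qed (rule compact_cbox)
      qed
    qed
  qed

  show ?thesis
    unfolding converges_weakly_def a_def[symmetric] b_def[symmetric]
  proof (intro exI[of _ X'] exI[of _ W'] conjI allI impI)
    show "skorohod_version M a b (F_stat \<Omega> \<tau> s0 n (obs f \<epsilon> \<tau> n)) (X' n)" for n
      unfolding skorohod_version_def using X' by (auto simp: X'_def)
    have "AE \<omega> in N. \<forall>x\<in>cbox a b. W' \<omega> x = F_limit \<Omega> \<tau>bar s0 \<sigma> B x \<omega>"
      using AE_not_in[OF N0(1)] AE_space
    proof eventually_elim
      case (elim \<omega>)
      have "h \<omega> = (\<lambda>v. \<sigma> * B v \<omega>)"
        using elim(1) by (simp add: h_def fun_eq_iff)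
      moreover have "F_limit \<Omega> \<tau>bar s0 \<sigma> B x \<omega> = signal_limit \<Omega> \<tau>bar s0 (\<lambda>v. \<sigma> * B v \<omega>) x"
        if "x \<in> cbox a b" for x
      proof (rule F_limit_eq_signal_limit[where B = B and \<omega> = \<omega>, OF s0 \<Omega> N0(2)[OF elim(2,1)] N0(3)[OF elim(2,1)]])
        show "0 < x$1" "x$1 \<le> 1"
          using x1[OF that] s0(1) by linarith+
      qed
      ultimately show ?case
        by (simp add: W'_def)
    qed
    then show "skorohod_version N a b (F_limit \<Omega> \<tau>bar s0 \<sigma> B) W'"
      unfolding skorohod_version_def using W' by blast
  next
    fix G
    assume G: "continuous_map (skorohod_topology a b) euclideanreal G" "bounded (G ` skorohod_space a b)"
    show "((\<lambda>n. \<integral>\<omega>. G (X' n \<omega>) \<partial>M) \<longlongrightarrow> (\<integral>\<omega>. G (W' \<omega>) \<partial>N)) min_at_top"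
      unfolding min_at_top_def
      by (rule extended_continuous_mapping[where S = S' and Z = Z' and
            good = "\<lambda>n w. \<forall>v\<in>cbox 0 1. S' n w v = partial_sum \<epsilon> n v w",
            OF \<open>prob_space M\<close> \<open>prob_space N\<close> Metric_space_skorohod Metric_space_skorohod
              S'(1)[unfolded borel_eq] X'[unfolded borel_eq] Z'(1)[unfolded borel_eq] W'[unfolded borel_eq]
              conv[unfolded skorohod_topology_def min_at_top_def] S'(2) path G[unfolded skorohod_topology_def]])
  qed
qed

end
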